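(* Endowed with the right shift $\alpha_{p^n}$ in each component, $$\bigoplus_{p\in\mathbb{P}}\bigoplus_{n\in\mathbb{N}}(F_{p^n}((t)),\alpha_{p^n})^{\nu(p,n)}$$ is a locally compact abelian torsion contraction group for each family $(\nu(p,n))_{(p,n)\in\mathbb{P}\times\mathbb{N}}\in\mathbb{N}_0^{(\mathbb{P}\times\mathbb{N})}$. Any locally compact abelian torsion contraction group is isomorphic to a contraction group of the preceding form, for a uniquely determined family $(\nu(p,n))_{(p,n)\in\mathbb{P}\times\mathbb{N}}$. Notably, there are only countably many locally compact abelian contraction groups which are torsion groups, up to isomorphism.
   Context: A locally compact contraction group is a pair $(G,\alpha)$ where $G$ is a (Hausdorff) locally compact group and $\alpha$ a bicontinuous automorphism of $G$ with $\alpha^n(x)\to e$ as $n\to\infty$ for each $x\in G$; it is called abelian (resp. torsion) if $G$ is abelian (resp. a torsion group). Isomorphisms of contraction groups are isomorphisms of topological groups intertwining the given automorphisms. $\mathbb{P}$ is the set of primes, $\mathbb{N}=\{1,2,\ldots\}$, $\mathbb{N}_0=\mathbb{N}\cup\{0\}$, and $\mathbb{N}_0^{(\mathbb{P}\times\mathbb{N})}$ is the set of families of elements of $\mathbb{N}_0$ indexed by $\mathbb{P}\times\mathbb{N}$ with only finitely many non-zero entries. $F_{p^n}:=\mathbb{Z}/p^n\mathbb{Z}$, and $F_{p^n}((t))$ is the additive group of formal Laurent series $\sum_{i\geq N}x_it^i$ ($N\in\mathbb{Z}$, $x_i\in F_{p^n}$), identified with $F_{p^n}^{(-\mathbb{N})}\times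 F_{p^n}^{\mathbb{N}_0}$ (finitely supported sequences indexed by $-\mathbb{N}$ with the discrete topology, times the compact product); $\alpha_{p^n}$ is the right shift $x\mapsto tx$. A power $(\cdot)^{\nu}$ denotes the direct sum of $\nu$ copies. *)

theory Defs
  imports
    "HOL-Analysis.Analysis"
    "HOL-Algebra.Elementary_Groups"
    "HOL-Algebra.Product_Groups"
    "HOL-Computational_Algebra.Primes"
begin

record 'a cgroup = "'a monoid" +
  gtop :: "'a topology"
  gaut :: "'a \<Rightarrow> 'a"

definition topological_group :: "('a, 'b) cgroup_scheme \<Rightarrow> bool" where
  "topological_group G \<longleftrightarrow>
     group G \<and> topspace (gtop G) = carrier G \<and>
     continuous_map (prod_topology (gtop G) (gtop G)) (gtop G) (\<lambda>(x, y). x \<otimes>\<^bsub>G\<^esub> y) \<and>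
     continuous_map (gtop G) (gtop G) (\<lambda>x. inv\<^bsub>G\<^esub> x)"

definition lc_contraction_group :: "('a, 'b) cgroup_scheme \<Rightarrow> bool" where
  "lc_contraction_group G \<longleftrightarrow>
     topological_group G \<and> Hausdorff_space (gtop G) \<and> locally_compact_space (gtop G) \<and>
     gaut G \<in> iso G G \<and> homeomorphic_map (gtop G) (gtop G) (gaut G) \<and>
     (\<forall>x \<in> carrier G. limitin (gtop G) (\<lambda>n. (gaut G ^^ n) x) \<one>\<^bsub>G\<^esub> sequentially)"

definition torsion_group :: "('a, 'b) monoid_scheme \<Rightarrow> bool" where
  "torsion_group G \<longleftrightarrow>
     group G \<and> (\<forall>x \<in> carrier G. \<exists>n::nat. n > 0 \<and> x [^]\<^bsub>G\<^esub> n = \<one>\<^bsub>G\<^esub>)"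

definition lc_abelian_torsion_contraction_group :: "('a, 'b) cgroup_scheme \<Rightarrow> bool" where
  "lc_abelian_torsion_contraction_group G \<longleftrightarrow>
     lc_contraction_group G \<and> comm_group G \<and> torsion_group G"

definition cgroup_isomorphic :: "('a, 'c) cgroup_scheme \<Rightarrow> ('b, 'd) cgroup_scheme \<Rightarrow> bool"
    (infix \<open>\<cong>\<^sub>c\<close> 50) where
  "G \<cong>\<^sub>c H \<longleftrightarrow>
     (\<exists>h. h \<in> iso G H \<and> homeomorphic_map (gtop G) (gtop H) h \<and>
          (\<forall>x \<in> carrier G. h (gaut G x) = gaut H (h x)))"

text \<open>
  The additive group of formal Laurent series over \<open>\<int>/m\<int>\<close>; a series is represented by its
  coefficient function. The topology is transported along the bijection
  \<open>x \<mapsto> ((x\<^sub>i)\<^sub>i\<^sub><\<^sub>0, (x\<^sub>i)\<^sub>i\<^sub>\<ge>\<^sub>0)\<close> onto (discrete direct sum) \<open>\<times>\<close> (compact product).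
\<close>

definition laurent_carrier :: "nat \<Rightarrow> (int \<Rightarrow> int) set" where
  "laurent_carrier m =
     {x. (\<forall>i. x i \<in> carrier (integer_mod_group m)) \<and>
         (\<exists>N. \<forall>i<N. x i = \<one>\<^bsub>integer_mod_group m\<^esub>)}"

definition laurent_topology :: "nat \<Rightarrow> (int \<Rightarrow> int) topology" where
  "laurent_topology m =
     pullback_topology (laurent_carrier m) (\<lambda>x. (restrict x {..<0}, restrict x {0..}))
       (prod_topology
          (discrete_topology (carrier (sum_group {..<0} (\<lambda>_. integer_mod_group m))))
          (product_topology (\<lambda>_. discrete_topology (carrier (integer_mod_group m))) {0..}))"

definition laurent_cgroup :: "nat \<Rightarrow> (int \<Rightarrow> int) cgroup" where
  "laurent_cgroup m =
     \<lparr>carrier = laurent_carrier m,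
      monoid.mult = (\<lambda>x y i. x i \<otimes>\<^bsub>integer_mod_group m\<^esub> y i),
      one = (\<lambda>i. \<one>\<^bsub>integer_mod_group m\<^esub>),
      gtop = laurent_topology m,
      gaut = (\<lambda>x i. x (i - 1))\<rparr>"

text \<open>
  Only meant for families in which \<open>I\<close> is finite: there the direct sum of topological groups
  carries the product topology.
\<close>

definition direct_sum_cgroup :: "'i set \<Rightarrow> ('i \<Rightarrow> 'a cgroup) \<Rightarrow> ('i \<Rightarrow> 'a) cgroup" where
  "direct_sum_cgroup I G =
     \<lparr>carrier = carrier (sum_group I G),
      monoid.mult = monoid.mult (sum_group I G),
      one = one (sum_group I G),
      gtop = product_topology (\<lambda>i. gtop (G i)) I,
      gaut = (\<lambda>x. \<lambda>i\<in>I. gaut (G i) (x i))\<rparr>"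

text \<open>
  A family indexed by (primes) \<open>\<times>\<close> (positive integers) is extended by zero to all pairs of
  natural numbers, so that it is determined by its values on the actual index set.
\<close>

definition finsupp_families :: "(nat \<times> nat \<Rightarrow> nat) set" where
  "finsupp_families =
     {\<nu>. {i. \<nu> i \<noteq> 0} \<subseteq> {p. prime p} \<times> {1..} \<and> finite {i. \<nu> i \<noteq> 0}}"

text \<open>
  The iterated direct sum is taken over the single index set of all \<open>(p, n, k)\<close> with
  \<open>k < \<nu>(p, n)\<close>, where \<open>k\<close> numbers the copies of the summand belonging to \<open>(p, n)\<close>.
\<close>

definition standard_cgroup ::
    "(nat \<times> nat \<Rightarrow> nat) \<Rightarrow> (nat \<times> nat \<times> nat \<Rightarrow> int \<Rightarrow> int) cgroup" where
  "standard_cgroup \<nu> =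
     direct_sum_cgroup {(p, n, k). prime p \<and> n \<ge> 1 \<and> k < \<nu> (p, n)}
       (\<lambda>(p, n, k). laurent_cgroup (p ^ n))"

end

theory Submission
  imports Defs "HOL-Algebra.Multiplicative_Group" "HOL-Number_Theory.Cong"
begin

text \<open>
  Baire's theorem gives \<open>G\<close> a finite exponent and makes the contraction uniform on compact sets, so
  \<open>G\<close> has a compact open subgroup \<open>W 0\<close> with \<open>\<alpha> (W 0) \<subseteq> W 0\<close>, and the subgroups
  \<open>W k = \<alpha>\<^sup>k (W 0)\<close> for integers \<open>k\<close> form a complete filtration that defines the topology.
  For a prime \<open>p\<close> let \<open>V p j\<close> be the \<open>p\<close>-torsion of \<open>p\<^sup>j G\<close>.  The finite vector space
  \<open>W 0 / W 1\<close> restricted to \<open>V p 0\<close> has a basis adapted to the images of all \<open>V p j\<close>.  Dividing each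
  basis element \<open>b\<close> by the largest possible power \<open>p ^ (n - 1)\<close> yields generators \<open>y\<close> of order \<open>p ^ n\<close>, and
  every element of \<open>G\<close> is a unique convergent series in the \<open>\<alpha>\<^sup>s (y)\<close>:  uniqueness is
  tested on the socle, existence follows by removing one prime at a time from the exponent.
  An isomorphism of standard groups distorts the filtrations by a bounded shift only, so that counting
  socle elements supported in an interval of growing length recovers the multiplicities.
\<close>

section \<open>Filtered groups\<close>

text \<open>The model is the theorem that an abelian group of bounded exponent is a direct sum of
  cyclic groups, proved through heights in the socle. Here \<alpha> plays the role of multiplication
  by t, so each socle behaves like a vector space over F_p((t)). One finite residue basis serves
  every level, because the subgroups \<open>V p j\<close> are stable under \<alpha> and \<alpha>
  carries \<open>W k / W (k + 1)\<close> onto the next such quotient. The obstacle is continuity of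
  division by p: a root of an element of \<open>W k\<close> may lie arbitrarily far out. Roots are
  therefore taken of the finitely many basis elements only, and other elements are divided
  coefficient by coefficient. The loss is then a constant fixed by the generators, and this constant
  makes the inverse of the coordinate map continuous. The topology is condensed into the axioms of
  \<open>compact_filtered_cgroup\<close>; the theory of expansions is algebra with the subgroups
  \<open>W k\<close>.\<close>

lemma (in comm_group) quot_mult:
  assumes "x \<in> carrier G" "x' \<in> carrier G" "y \<in> carrier G" "y' \<in> carrier G"
  shows "inv (x \<otimes> y) \<otimes> (x' \<otimes> y') = (inv x \<otimes> x') \<otimes> (inv y \<otimes> y')"
  using assms by (simp add: inv_mult m_ac)

lemma (in comm_group) quot_inv:
  assumes "x \<in> carrier G" "y \<in> carrier G"
  shows "inv (inv x) \<otimes> inv y = inv (inv x \<otimes> y)"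
  using assms by (simp add: inv_mult m_ac)

lemma (in group) quot_quot:
  assumes "x \<in> carrier G" "y \<in> carrier G" "z \<in> carrier G"
  shows "(inv x \<otimes> y) \<otimes> (inv y \<otimes> z) = inv x \<otimes> z"
  using assms by (metis inv_closed inv_solve_left m_assoc m_closed r_inv r_one)

text \<open>The last axiom says that the cosets of the \<open>W k\<close> generate the topology, and
  \<open>gaut_W_iff\<close> says that the automorphism raises the level by exactly one, so
  topological claims become claims about levels. The arbitrary group and the standard groups are
  both instances, which allows one lemma to compare them.\<close>

locale filtered_cgroup = comm_group G for G :: "('a, 'b) cgroup_scheme" (structure) +
  fixes W :: "int \<Rightarrow> 'a set"
  assumes W_subgroup: "subgroup (W k) G"
    and W_Suc: "W (k + 1) \<subseteq> W k"
    and W_exhaust: "x \<in> carrier G \<Longrightarrow> \<exists>k. x \<in> W k"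
    and W_separated: "(\<And>k. x \<in> W k) \<Longrightarrow> x = \<one>"
    and gaut_iso: "gaut G \<in> iso G G"
    and gaut_W_iff: "x \<in> carrier G \<Longrightarrow> gaut G x \<in> W (k + 1) \<longleftrightarrow> x \<in> W k"
    and openin_filtration: "openin (gtop G) U \<longleftrightarrow>
          U \<subseteq> carrier G \<and> (\<forall>x\<in>U. \<exists>k. \<forall>y\<in>carrier G. inv x \<otimes> y \<in> W k \<longrightarrow> y \<in> U)"
begin

lemma W_carrier: "x \<in> W k \<Longrightarrow> x \<in> carrier G"
  using W_subgroup subgroup.mem_carrier by metis

lemma W_mult: "x \<in> W k \<Longrightarrow> y \<in> W k \<Longrightarrow> x \<otimes> y \<in> W k"
  using W_subgroup subgroup.m_closed by metis

lemma W_inv: "x \<in> W k \<Longrightarrow> inv x \<in> W k"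
  using W_subgroup subgroup.m_inv_closed by metis

lemma W_one: "\<one> \<in> W k"
  using W_subgroup subgroup.one_closed by metis

lemma W_antimono: "j \<le> k \<Longrightarrow> W k \<subseteq> W j"
  by (induction k rule: int_ge_induct) (use W_Suc in auto)

lemma W_mono_mem: "x \<in> W k \<Longrightarrow> j \<le> k \<Longrightarrow> x \<in> W j"
  using W_antimono by auto

lemma topspace_eq: "topspace (gtop G) = carrier G"
proof -
  have "openin (gtop G) (carrier G)"
    by (auto simp: openin_filtration)
  moreover have "topspace (gtop G) \<subseteq> carrier G"
    using openin_filtration openin_topspace by blast
  ultimately show ?thesis
    by (meson openin_subset subset_antisym)
qed

lemma openin_coset:
  assumes "x \<in> carrier G"
  shows "openin (gtop G) {y \<in> carrier G. inv x \<otimes> y \<in> W k}"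
  unfolding openin_filtration
proof (intro conjI ballI)
  fix y assume y: "y \<in> {y \<in> carrier G. inv x \<otimes> y \<in> W k}"
  have "z \<in> {y \<in> carrier G. inv x \<otimes> y \<in> W k}" if "z \<in> carrier G" "inv y \<otimes> z \<in> W k" for z
    using quot_quot[of x y z] W_mult[of "inv x \<otimes> y" k "inv y \<otimes> z"] that y assms by auto
  then show "\<exists>j. \<forall>z\<in>carrier G. inv y \<otimes> z \<in> W j \<longrightarrow> z \<in> {y \<in> carrier G. inv x \<otimes> y \<in> W k}"
    by blast
qed auto

lemma continuous_map_quotI:
  assumes "\<And>x. x \<in> carrier G \<Longrightarrow> f x \<in> carrier G"
    and "\<And>x k. x \<in> carrier G \<Longrightarrow>
           \<exists>l. \<forall>y\<in>carrier G. inv x \<otimes> y \<in> W l \<longrightarrow> inv (f x) \<otimes> f y \<in> W k"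
  shows "continuous_map (gtop G) (gtop G) f"
  unfolding continuous_map_def topspace_eq
proof (intro conjI allI impI)
  show "f \<in> carrier G \<rightarrow> carrier G" using assms by auto
  fix U assume U: "openin (gtop G) U"
  show "openin (gtop G) {x \<in> carrier G. f x \<in> U}"
    unfolding openin_filtration
  proof (intro conjI ballI)
    fix x assume x: "x \<in> {x \<in> carrier G. f x \<in> U}"
    then obtain k where k: "\<forall>y\<in>carrier G. inv (f x) \<otimes> y \<in> W k \<longrightarrow> y \<in> U"
      using U unfolding openin_filtration by blast
    obtain l where "\<forall>y\<in>carrier G. inv x \<otimes> y \<in> W l \<longrightarrow> inv (f x) \<otimes> f y \<in> W k"
      using assms(2) x by blast
    then show "\<exists>l. \<forall>y\<in>carrier G. inv x \<otimes> y \<in> W l \<longrightarrow> y \<in> {x \<in> carrier G. f x \<in> U}"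
      using k assms(1) by blast
  qed auto
qed

lemma continuous_map_mult:
  "continuous_map (prod_topology (gtop G) (gtop G)) (gtop G) (\<lambda>(x, y). x \<otimes> y)"
  unfolding continuous_map_def topspace_prod_topology topspace_eq
proof (intro conjI allI impI)
  fix U assume U: "openin (gtop G) U"
  show "openin (prod_topology (gtop G) (gtop G))
          {z \<in> carrier G \<times> carrier G. (case z of (x, y) \<Rightarrow> x \<otimes> y) \<in> U}"
    unfolding openin_prod_topology_alt
  proof (intro allI impI)
    fix x y assume "(x, y) \<in> {z \<in> carrier G \<times> carrier G. (case z of (x, y) \<Rightarrow> x \<otimes> y) \<in> U}"
    then have xy: "x \<in> carrier G" "y \<in> carrier G" "x \<otimes> y \<in> U" by auto
    then obtain k where k: "\<forall>z\<in>carrier G. inv (x \<otimes> y) \<otimes> z \<in> W k \<longrightarrow> z \<in> U"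
      using U unfolding openin_filtration by blast
    let ?B = "\<lambda>x. {y \<in> carrier G. inv x \<otimes> y \<in> W k}"
    have "?B x \<times> ?B y \<subseteq> {z \<in> carrier G \<times> carrier G. (case z of (x, y) \<Rightarrow> x \<otimes> y) \<in> U}"
      using k xy quot_mult W_mult by auto
    moreover have "x \<in> ?B x" "y \<in> ?B y"
      using xy W_one by auto
    ultimately show "\<exists>T V. openin (gtop G) T \<and> openin (gtop G) V \<and> x \<in> T \<and> y \<in> V \<and>
        T \<times> V \<subseteq> {z \<in> carrier G \<times> carrier G. (case z of (x, y) \<Rightarrow> x \<otimes> y) \<in> U}"
      using openin_coset xy by blast
  qed
qed auto

lemma topological_group: "topological_group G"
proof -
  have "continuous_map (gtop G) (gtop G) (\<lambda>x. inv x)"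
  proof (rule continuous_map_quotI)
    fix x k assume "x \<in> carrier G"
    then show "\<exists>l. \<forall>y\<in>carrier G. inv x \<otimes> y \<in> W l \<longrightarrow> inv (inv x) \<otimes> inv y \<in> W k"
      using quot_inv W_inv by metis
  qed auto
  then show ?thesis
    unfolding topological_group_def using topspace_eq continuous_map_mult group_axioms by auto
qed

lemma gaut_closed: "x \<in> carrier G \<Longrightarrow> gaut G x \<in> carrier G"
  using gaut_iso by (auto simp: iso_def hom_def)

lemma gaut_funpow_W: "x \<in> W k \<Longrightarrow> (gaut G ^^ n) x \<in> W (k + int n)"
proof (induction n)
  case (Suc n)
  have "gaut G ((gaut G ^^ n) x) \<in> W (k + int n + 1)"
    using Suc gaut_W_iff W_carrier by blast
  then show ?case by (simp add: algebra_simps)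
qed auto

lemma gaut_contracts:
  assumes "x \<in> carrier G"
  shows "limitin (gtop G) (\<lambda>n. (gaut G ^^ n) x) \<one> sequentially"
  unfolding limitin_def
proof (intro conjI allI impI)
  show "\<one> \<in> topspace (gtop G)" by (simp add: topspace_eq)
  fix U assume "openin (gtop G) U \<and> \<one> \<in> U"
  then obtain k where k: "\<forall>y\<in>carrier G. inv \<one> \<otimes> y \<in> W k \<longrightarrow> y \<in> U"
    unfolding openin_filtration by blast
  obtain j where j: "x \<in> W j" using assms W_exhaust by blast
  have "(gaut G ^^ n) x \<in> U" if "n \<ge> nat (k - j)" for n
  proof -
    have "(gaut G ^^ n) x \<in> W k"
      by (rule W_mono_mem[OF gaut_funpow_W[OF j, of n]]) (use that in linarith)
    then show ?thesis using k W_carrier by simp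
  qed
  then show "\<forall>\<^sub>F n in sequentially. (gaut G ^^ n) x \<in> U"
    unfolding eventually_sequentially by blast
qed

end

lemma hom_quot:
  assumes "group G" "group H" "h \<in> hom G H" "x \<in> carrier G" "y \<in> carrier G"
  shows "h (inv\<^bsub>G\<^esub> x \<otimes>\<^bsub>G\<^esub> y) = inv\<^bsub>H\<^esub> (h x) \<otimes>\<^bsub>H\<^esub> h y"
proof -
  interpret group_hom G H h using assms by (simp add: group_hom_def group_hom_axioms_def)
  show ?thesis using assms by simp
qed

text \<open>A homomorphism turns the quotient of two points into the quotient of their images, so
  continuity at the identity spreads to all points. The two conditions are continuity at the
  identity of \<open>h\<close> and of its inverse.\<close>

lemma filtered_homeomorphic_map:
  assumes G: "filtered_cgroup G W" and H: "filtered_cgroup H V" and h: "h \<in> iso G H"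
    and cont: "\<And>k. \<exists>l. \<forall>x\<in>W l. h x \<in> V k"
    and op: "\<And>k. \<exists>l. \<forall>x\<in>carrier G. h x \<in> V l \<longrightarrow> x \<in> W k"
  shows "homeomorphic_map (gtop G) (gtop H) h"
proof -
  interpret G: filtered_cgroup G W by fact
  interpret H: filtered_cgroup H V by fact
  have hom: "h \<in> hom G H" and bij: "bij_betw h (carrier G) (carrier H)"
    using h by (auto simp: iso_def)
  have clo: "h x \<in> carrier H" if "x \<in> carrier G" for x
    using hom that by (auto simp: hom_def)
  have quot: "h (inv\<^bsub>G\<^esub> x \<otimes>\<^bsub>G\<^esub> y) = inv\<^bsub>H\<^esub> (h x) \<otimes>\<^bsub>H\<^esub> h y" if "x \<in> carrier G" "y \<in> carrier G" for x y
    using hom_quot[OF G.is_group H.is_group hom that] .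
  show ?thesis
  proof (rule bijective_open_imp_homeomorphic_map)
    show "continuous_map (gtop G) (gtop H) h"
      unfolding continuous_map_def G.topspace_eq H.topspace_eq
    proof (intro conjI allI impI)
      show "h \<in> carrier G \<rightarrow> carrier H" using clo by auto
      fix U assume U: "openin (gtop H) U"
      show "openin (gtop G) {x \<in> carrier G. h x \<in> U}"
        unfolding G.openin_filtration
      proof (intro conjI ballI)
        fix x assume x: "x \<in> {x \<in> carrier G. h x \<in> U}"
        then obtain k where k: "\<forall>y\<in>carrier H. inv\<^bsub>H\<^esub> (h x) \<otimes>\<^bsub>H\<^esub> y \<in> V k \<longrightarrow> y \<in> U"
          using U unfolding H.openin_filtration by blast
        obtain l where "\<forall>x\<in>W l. h x \<in> V k" using cont by blast
        then show "\<exists>l. \<forall>y\<in>carrier G. inv\<^bsub>G\<^esub> x \<otimes>\<^bsub>G\<^esub> y \<in> W l \<longrightarrow> y \<in> {x \<in> carrier G. h x \<in> U}"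
          using k clo quot x by (metis (mono_tags, lifting) mem_Collect_eq)
      qed auto
    qed
    show "open_map (gtop G) (gtop H) h"
      unfolding open_map_def
    proof (intro allI impI)
      fix U assume U: "openin (gtop G) U"
      then have sub: "U \<subseteq> carrier G" by (simp add: G.openin_filtration)
      show "openin (gtop H) (h ` U)"
        unfolding H.openin_filtration
      proof (intro conjI ballI)
        show "h ` U \<subseteq> carrier H" using sub clo by auto
        fix z assume "z \<in> h ` U"
        then obtain x where x: "x \<in> U" "z = h x" by auto
        then obtain k where k: "\<forall>y\<in>carrier G. inv\<^bsub>G\<^esub> x \<otimes>\<^bsub>G\<^esub> y \<in> W k \<longrightarrow> y \<in> U"
          using U unfolding G.openin_filtration by blast
        obtain l where l: "\<forall>x\<in>carrier G. h x \<in> V l \<longrightarrow> x \<in> W k" using op by blast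
        have "y \<in> h ` U" if y: "y \<in> carrier H" "inv\<^bsub>H\<^esub> z \<otimes>\<^bsub>H\<^esub> y \<in> V l" for y
        proof -
          obtain y' where y': "y' \<in> carrier G" "y = h y'"
            using bij y by (auto simp: bij_betw_def)
          then have "inv\<^bsub>G\<^esub> x \<otimes>\<^bsub>G\<^esub> y' \<in> W k"
            using l y x sub quot by auto
          then show ?thesis using k y' by auto
        qed
        then show "\<exists>l. \<forall>y\<in>carrier H. inv\<^bsub>H\<^esub> z \<otimes>\<^bsub>H\<^esub> y \<in> V l \<longrightarrow> y \<in> h ` U" by blast
      qed
    qed
    show "h ` topspace (gtop G) = topspace (gtop H)" "inj_on h (topspace (gtop G))"
      using bij by (auto simp: G.topspace_eq H.topspace_eq bij_betw_def)
  qed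
qed

lemma (in filtered_cgroup) gaut_homeomorphic: "homeomorphic_map (gtop G) (gtop G) (gaut G)"
proof (rule filtered_homeomorphic_map[OF _ _ gaut_iso])
  fix k
  have "\<forall>x\<in>W (k - 1). gaut G x \<in> W k"
    using gaut_W_iff[of _ "k - 1"] W_carrier by auto
  then show "\<exists>l. \<forall>x\<in>W l. gaut G x \<in> W k" by blast
  show "\<exists>l. \<forall>x\<in>carrier G. gaut G x \<in> W l \<longrightarrow> x \<in> W k"
    using gaut_W_iff by blast
qed (rule filtered_cgroup_axioms)+

lemma (in filtered_cgroup) lc_contraction_groupI:
  assumes "Hausdorff_space (gtop G)" "locally_compact_space (gtop G)"
  shows "lc_contraction_group G"
  unfolding lc_contraction_group_def
  using assms topological_group gaut_iso gaut_homeomorphic gaut_contracts by auto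

section \<open>Compact open filtrations of torsion contraction groups\<close>

definition gpow :: "('a, 'b) cgroup_scheme \<Rightarrow> int \<Rightarrow> 'a \<Rightarrow> 'a" where
  "gpow G s = (if 0 \<le> s then gaut G ^^ nat s else inv_into (carrier G) (gaut G) ^^ nat (- s))"

locale automorphic_group = comm_group G for G :: "('a, 'b) cgroup_scheme" (structure) +
  assumes gaut_automorphism: "gaut G \<in> iso G G"
begin

lemma gaut_bij: "bij_betw (gaut G) (carrier G) (carrier G)"
  using gaut_automorphism by (simp add: iso_def)

lemma gaut_mult: "x \<in> carrier G \<Longrightarrow> y \<in> carrier G \<Longrightarrow> gaut G (x \<otimes> y) = gaut G x \<otimes> gaut G y"
  using gaut_automorphism by (auto simp: iso_def hom_def)

lemma gpow_closed: "x \<in> carrier G \<Longrightarrow> gpow G s x \<in> carrier G"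
proof -
  assume x: "x \<in> carrier G"
  have "(gaut G ^^ n) x \<in> carrier G" for n
    by (induction n) (use x gaut_bij in \<open>auto simp: bij_betw_def\<close>)
  moreover have "(inv_into (carrier G) (gaut G) ^^ n) x \<in> carrier G" for n
    by (induction n) (use x bij_betw_inv_into[OF gaut_bij] in \<open>auto simp: bij_betw_def\<close>)
  ultimately show ?thesis by (simp add: gpow_def)
qed

lemma gpow_0: "gpow G 0 x = x"
  by (simp add: gpow_def)

lemma gaut_gpow:
  assumes "x \<in> carrier G"
  shows "gaut G (gpow G s x) = gpow G (s + 1) x"
proof (cases "0 \<le> s")
  case True
  then show ?thesis by (simp add: gpow_def nat_add_distrib)
next
  case False
  let ?b = "inv_into (carrier G) (gaut G)"
  obtain n where n: "s = - int (Suc n)"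
    using False by (metis linorder_not_less negD)
  have "gpow G (- int n) x = (?b ^^ n) x"
    by (auto simp: gpow_def)
  moreover have "(?b ^^ n) x \<in> carrier G"
    using gpow_closed[OF assms, of "- int n"] calculation by simp
  moreover have "gpow G s x = ?b ((?b ^^ n) x)"
    unfolding n gpow_def by (simp del: of_nat_Suc)
  moreover have "s + 1 = - int n" by (simp add: n)
  ultimately show ?thesis
    using gaut_bij by (simp add: f_inv_into_f bij_betw_def)
qed

lemma gaut_inject:
  "x \<in> carrier G \<Longrightarrow> y \<in> carrier G \<Longrightarrow> gaut G x = gaut G y \<Longrightarrow> x = y"
  using gaut_bij by (auto simp: bij_betw_def inj_on_def)

lemma gpow_add:
  assumes "x \<in> carrier G"
  shows "gpow G (s + t) x = gpow G s (gpow G t x)"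
proof (induction s rule: int_induct[where k = 0])
  case base
  show ?case by (simp add: gpow_0)
next
  case (step1 i)
  then show ?case
    using gaut_gpow[OF assms, of "i + t"] gaut_gpow[OF gpow_closed[OF assms], of i t]
    by (simp add: algebra_simps)
next
  case (step2 i)
  \<comment> \<open>Going down, both sides are compared after one application of
    \<open>gaut\<close>: this raises the exponent to the one in the induction hypothesis, and
    \<open>gaut\<close> is injective on the carrier.\<close>
  have "gaut G (gpow G (i - 1 + t) x) = gaut G (gpow G (i - 1) (gpow G t x))"
    using step2 gaut_gpow[OF assms, of "i - 1 + t"] gaut_gpow[OF gpow_closed[OF assms], of "i - 1" t]
    by (simp add: algebra_simps)
  then show ?case
    using gaut_inject gpow_closed assms by metis
qed

lemma gpow_gaut: "x \<in> carrier G \<Longrightarrow> gpow G s (gaut G x) = gpow G (s + 1) x"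
  using gpow_add[of x s 1] gaut_gpow[of x 0] by (simp add: gpow_0)

lemma gpow_cancel: "x \<in> carrier G \<Longrightarrow> gpow G s (gpow G (- s) x) = x"
  using gpow_add[of x s "- s"] by (simp add: gpow_0)

lemma gpow_nat: "gpow G (int n) x = (gaut G ^^ n) x"
  by (simp add: gpow_def)

lemma gpow_mult:
  assumes "x \<in> carrier G" "y \<in> carrier G"
  shows "gpow G s (x \<otimes> y) = gpow G s x \<otimes> gpow G s y"
proof (induction s rule: int_induct[where k = 0])
  case base
  show ?case by (simp add: gpow_0)
next
  case (step1 i)
  then show ?case
    using gaut_gpow[of _ i] gaut_mult[of "gpow G i x" "gpow G i y"] assms gpow_closed
    by (metis m_closed)
next
  case (step2 i)
  have "gaut G (gpow G (i - 1) (x \<otimes> y)) = gaut G (gpow G (i - 1) x \<otimes> gpow G (i - 1) y)"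
    using step2 assms gaut_gpow[of _ "i - 1"] gpow_closed by (simp add: gaut_mult)
  then show ?case
    using gaut_inject gpow_closed assms by (metis m_closed)
qed

lemma gpow_hom: "gpow G s \<in> hom G G"
  by (auto simp: hom_def gpow_closed gpow_mult)

lemma gpow_group_hom: "group_hom G G (gpow G s)"
  by (simp add: group_hom_def group_hom_axioms_def gpow_hom)

lemma gpow_one: "gpow G s \<one> = \<one>"
  using group_hom.hom_one[OF gpow_group_hom] .

lemma gpow_inv: "x \<in> carrier G \<Longrightarrow> gpow G s (inv x) = inv (gpow G s x)"
  using group_hom.hom_inv[OF gpow_group_hom] by simp

end

text \<open>In exponent \<open>m\<close> the inverse of \<open>x\<close> is its power
  \<open>m - 1\<close>, so a submonoid is already a subgroup.\<close>

lemma (in comm_group) subgroup_of_exponentI: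
  assumes "H \<subseteq> carrier G" "\<one> \<in> H" "\<And>x y. x \<in> H \<Longrightarrow> y \<in> H \<Longrightarrow> x \<otimes> y \<in> H"
    and "m > 0" "\<And>x. x \<in> carrier G \<Longrightarrow> x [^] (m::nat) = \<one>"
  shows "subgroup H G"
proof (rule subgroup.intro)
  fix x assume x: "x \<in> H"
  then have xc: "x \<in> carrier G" using assms by auto
  have pow: "x [^] n \<in> H" for n :: nat
    by (induction n) (use x assms in auto)
  have "x [^] (m - 1) \<otimes> x = \<one>"
    using assms(4,5) xc by (metis Suc_pred' nat_pow_Suc)
  then have "inv x = x [^] (m - 1)"
    using xc by (metis inv_equality nat_pow_closed)
  then show "inv x \<in> H" using pow by simp
qed (use assms in auto)

text \<open>Commutativity and bounded exponent make finitely generated submonoids finite: adjoining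
  \<open>f\<close> multiplies the number of elements by at most \<open>m\<close>, since powers of
  \<open>f\<close> repeat modulo \<open>m\<close>.\<close>

lemma (in comm_group) finite_submonoid_of_exponent:
  assumes "finite F" "F \<subseteq> carrier G" and m: "m > 0" "\<And>x. x \<in> carrier G \<Longrightarrow> x [^] (m::nat) = \<one>"
  shows "\<exists>P. finite P \<and> F \<subseteq> P \<and> P \<subseteq> carrier G \<and> \<one> \<in> P \<and> (\<forall>x\<in>P. \<forall>y\<in>P. x \<otimes> y \<in> P)"
  using assms(1,2)
proof (induction F rule: finite_induct)
  case empty
  show ?case by (intro exI[of _ "{\<one>}"]) auto
next
  case (insert f F)
  then obtain P where P: "finite P" "F \<subseteq> P" "P \<subseteq> carrier G" "\<one> \<in> P" "\<forall>x\<in>P. \<forall>y\<in>P. x \<otimes> y \<in> P"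
    by auto
  have f: "f \<in> carrier G" using insert by simp
  let ?Q = "(\<lambda>(i, x). f [^] i \<otimes> x) ` ({..<m} \<times> P)"
  have red: "f [^] i = f [^] (i mod m)" for i :: nat
  proof -
    have "f [^] i = (f [^] m) [^] (i div m) \<otimes> f [^] (i mod m)"
      using f by (simp add: nat_pow_pow nat_pow_mult)
    then show ?thesis using m f by simp
  qed
  have memQ: "f [^] i \<otimes> x \<in> ?Q" if "x \<in> P" for x and i :: nat
    using that m red[of i] by (intro image_eqI[of _ _ "(i mod m, x)"]) auto
  have "\<forall>x\<in>?Q. \<forall>y\<in>?Q. x \<otimes> y \<in> ?Q"
  proof safe
    fix i j :: nat and x y assume xy: "x \<in> P" "y \<in> P"
    then have "(f [^] i \<otimes> x) \<otimes> (f [^] j \<otimes> y) = f [^] (i + j) \<otimes> (x \<otimes> y)"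
      using P f by (subst nat_pow_mult[symmetric]) (auto simp: m_ac subset_iff)
    then show "(f [^] i \<otimes> x) \<otimes> (f [^] j \<otimes> y) \<in> ?Q"
      using memQ P xy by metis
  qed
  moreover have "\<one> \<in> ?Q"
    using memQ[of \<one> 0] P by simp
  moreover have "insert f F \<subseteq> ?Q"
    using memQ[of \<one> 1] memQ[of _ 0] P f by (auto simp: subset_iff)
  moreover have "?Q \<subseteq> carrier G" using P f by auto
  moreover have "finite ?Q" using P by simp
  ultimately show ?case by blast
qed

text \<open>What the expansion theory takes from compactness of \<open>W 0\<close>. Finite index is
  asked at one level only, as shifting by \<alpha> transports it to the others. In
  \<open>complete\<close> the rate of convergence is prescribed: step \<open>n\<close> has to lie in
  \<open>W n\<close>.\<close>

locale compact_filtered_cgroup = filtered_cgroup G W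
  for G :: "('a, 'b) cgroup_scheme" (structure) and W +
  assumes bounded_exponent: "\<exists>m::nat. m > 0 \<and> (\<forall>x\<in>carrier G. x [^] m = \<one>)"
    and finite_index: "\<exists>F. finite F \<and> F \<subseteq> carrier G \<and> (\<forall>x\<in>W 0. \<exists>a\<in>F. inv a \<otimes> x \<in> W 1)"
    and complete: "\<lbrakk>\<And>n. u n \<in> carrier G; \<And>n. inv (u n) \<otimes> u (Suc n) \<in> W (int n)\<rbrakk>
                    \<Longrightarrow> \<exists>z\<in>carrier G. \<forall>n. inv (u n) \<otimes> z \<in> W (int n)"

section \<open>Topological input: Baire category, compact open subgroups, uniform
  contraction\<close>

locale lc_torsion_cgroup = comm_group G for G :: "('a, 'b) cgroup_scheme" (structure) +
  assumes lc: "lc_contraction_group G" and torsion: "torsion_group G"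
begin

sublocale automorphic_group G
  using lc by unfold_locales (simp add: lc_contraction_group_def)

lemma topspace_eq: "topspace (gtop G) = carrier G"
  and Hausdorff: "Hausdorff_space (gtop G)"
  and locally_compact: "locally_compact_space (gtop G)"
  and continuous_mult: "continuous_map (prod_topology (gtop G) (gtop G)) (gtop G) (\<lambda>(x, y). x \<otimes> y)"
  and homeomorphic_gaut: "homeomorphic_map (gtop G) (gtop G) (gaut G)"
  and contraction: "x \<in> carrier G \<Longrightarrow> limitin (gtop G) (\<lambda>n. (gaut G ^^ n) x) \<one> sequentially"
  using lc by (auto simp: lc_contraction_group_def topological_group_def)

lemma regular: "regular_space (gtop G)"
  using locally_compact Hausdorff locally_compact_Hausdorff_imp_regular_space by blast

lemma openin_sub: "openin (gtop G) U \<Longrightarrow> U \<subseteq> carrier G"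
  using openin_subset topspace_eq by metis

lemma continuous_mult_fun:
  assumes "continuous_map X (gtop G) f" "continuous_map X (gtop G) g"
  shows "continuous_map X (gtop G) (\<lambda>x. f x \<otimes> g x)"
  using continuous_map_compose[OF continuous_map_pairedI[OF assms] continuous_mult]
  by (simp add: o_def)

lemma continuous_translation: "a \<in> carrier G \<Longrightarrow> continuous_map (gtop G) (gtop G) (\<lambda>x. a \<otimes> x)"
  by (rule continuous_mult_fun) (auto simp: topspace_eq)

lemma openin_translate:
  "a \<in> carrier G \<Longrightarrow> openin (gtop G) U \<Longrightarrow> openin (gtop G) {x \<in> carrier G. a \<otimes> x \<in> U}"
  using openin_continuous_map_preimage[OF continuous_translation] topspace_eq by auto

lemma continuous_nat_pow: "continuous_map (gtop G) (gtop G) (\<lambda>x. x [^] (n::nat))"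
  by (induction n) (auto simp: topspace_eq intro: continuous_mult_fun)

lemma continuous_gpow: "continuous_map (gtop G) (gtop G) (gpow G s)"
proof -
  let ?b = "inv_into (carrier G) (gaut G)"
  obtain g where g: "homeomorphic_maps (gtop G) (gtop G) (gaut G) g"
    using homeomorphic_gaut homeomorphic_map_maps by blast
  \<comment> \<open>The continuous inverse supplied by the homeomorphism is compared with
    \<open>inv_into\<close> on the carrier, which is the whole space of the topology.\<close>
  have "g x = ?b x" if "x \<in> carrier G" for x
    using g that gaut_bij unfolding homeomorphic_maps_def topspace_eq
    by (metis bij_betw_inv_into_left continuous_map_image_subset_topspace image_subset_iff topspace_eq)
  then have b: "continuous_map (gtop G) (gtop G) ?b"
    using g continuous_map_eq topspace_eq unfolding homeomorphic_maps_def by metis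
  have a: "continuous_map (gtop G) (gtop G) (gaut G)"
    using homeomorphic_gaut homeomorphic_imp_continuous_map by blast
  have "continuous_map (gtop G) (gtop G) (f ^^ n)" if "continuous_map (gtop G) (gtop G) f" for f n
  proof (induction n)
    case (Suc n)
    then show ?case using continuous_map_compose[OF Suc that] by (simp add: o_def)
  qed (simp add: id_def)
  then show ?thesis using a b by (simp add: gpow_def)
qed

text \<open>Translation by \<open>u \<otimes> inv h\<close> moves \<open>h\<close> to a point
  \<open>u\<close> of \<open>U\<close>, so the preimage of \<open>U\<close> under it is an open
  neighbourhood of \<open>h\<close>, and it stays inside the subgroup.\<close>

lemma open_subgroupI:
  assumes "subgroup H G" "openin (gtop G) U" "U \<noteq> {}" "U \<subseteq> H"
  shows "openin (gtop G) H"
proof (subst openin_subopen, intro ballI)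
  fix h assume h: "h \<in> H"
  interpret H: subgroup H G by fact
  obtain u where u: "u \<in> U" using assms by auto
  have c: "u \<in> H" "h \<in> carrier G" "u \<in> carrier G" using u h assms by auto
  let ?T = "{x \<in> carrier G. (u \<otimes> inv h) \<otimes> x \<in> U}"
  have "h \<in> ?T" using c u by (simp add: m_assoc)
  moreover have "?T \<subseteq> H"
  proof
    fix x assume x: "x \<in> ?T"
    then have "(u \<otimes> inv h) \<otimes> x \<in> H" using assms by auto
    then have "inv (u \<otimes> inv h) \<otimes> ((u \<otimes> inv h) \<otimes> x) \<in> H"
      using c h by (meson H.m_closed H.m_inv_closed)
    moreover have "inv (u \<otimes> inv h) \<otimes> ((u \<otimes> inv h) \<otimes> x) = x"
      using x c by (metis (no_types, lifting) inv_closed l_inv l_one m_assoc m_closed mem_Collect_eq)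
    ultimately show "x \<in> H" by simp
  qed
  moreover have "openin (gtop G) ?T" using openin_translate assms c by auto
  ultimately show "\<exists>T. openin (gtop G) T \<and> h \<in> T \<and> T \<subseteq> H" by blast
qed

lemma Baire_closed_cover:
  assumes "\<And>n::nat. closedin (gtop G) (C n)" "carrier G \<subseteq> (\<Union>n. C n)"
  shows "\<exists>n U. openin (gtop G) U \<and> U \<noteq> {} \<and> U \<subseteq> C n"
proof (rule ccontr)
  assume con: "\<not> ?thesis"
  have "gtop G interior_of (\<Union>(range C)) = {}"
  proof (rule Baire_category_alt)
    show "completely_metrizable_space (gtop G) \<or> locally_compact_space (gtop G) \<and> regular_space (gtop G)"
      using locally_compact regular by blast
    fix T assume "T \<in> range C"
    then show "closedin (gtop G) T \<and> gtop G interior_of T = {}"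
      using assms con by (metis imageE interior_of_subset openin_interior_of)
  qed auto
  moreover have "carrier G \<subseteq> gtop G interior_of (\<Union>(range C))"
    using assms(2) by (metis interior_of_maximal openin_topspace topspace_eq)
  ultimately show False using one_closed by auto
qed

lemma eventually_in_nhd:
  assumes "openin (gtop G) U" "\<one> \<in> U" "x \<in> carrier G"
  shows "\<exists>n. \<forall>k\<ge>n. (gaut G ^^ k) x \<in> U"
  using contraction[OF assms(3)] assms unfolding limitin_def eventually_sequentially by blast

text \<open>Baire yields an open subgroup of elements killed by one fixed factorial. Some power of
  \<alpha> carries any given element into it, and an automorphism preserves orders, so the same
  factorial kills the whole group.\<close>

lemma bounded_exponent: "\<exists>m::nat. m > 0 \<and> (\<forall>x\<in>carrier G. x [^] m = \<one>)"
proof -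
  \<comment> \<open>Factorials instead of \<open>n\<close>: \<open>fact 0 = 1\<close> keeps the
    exponent positive at \<open>n = 0\<close>, and every positive \<open>n\<close> divides
    \<open>fact n\<close>.\<close>
  let ?T = "\<lambda>n::nat. {x \<in> carrier G. x [^] (fact n :: nat) = \<one>}"
  have closed: "closedin (gtop G) (?T n)" for n
  proof -
    have "closedin (gtop G) {x \<in> topspace (gtop G). x [^] (fact n :: nat) \<in> {\<one>}}"
      by (rule closedin_continuous_map_preimage[OF continuous_nat_pow])
        (simp add: Hausdorff closedin_Hausdorff_singleton topspace_eq)
    then show ?thesis by (simp add: topspace_eq)
  qed
  have "x \<in> (\<Union>n. ?T n)" if x: "x \<in> carrier G" for x
  proof -
    obtain n :: nat where n: "n > 0" "x [^] n = \<one>"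
      using torsion x by (auto simp: torsion_group_def)
    obtain r where r: "fact n = n * r"
      using n(1) by (metis dvd_def dvd_fact le_refl less_eq_Suc_le One_nat_def)
    have "x [^] (fact n :: nat) = (x [^] n) [^] r"
      using r x by (simp add: nat_pow_pow)
    then show ?thesis using n x by auto
  qed
  then have cover: "carrier G \<subseteq> (\<Union>n. ?T n)" by blast
  obtain n U where U: "openin (gtop G) U" "U \<noteq> {}" "U \<subseteq> ?T n"
    using Baire_closed_cover[of ?T, OF closed cover] by blast
  have sub: "subgroup (?T n) G"
    by (rule subgroupI) (auto simp: nat_pow_distrib nat_pow_inv)
  have op: "openin (gtop G) (?T n)"
    using open_subgroupI[OF sub U] .
  have "x [^] (fact n :: nat) = \<one>" if x: "x \<in> carrier G" for x
  proof -
    obtain k where k: "(gaut G ^^ k) x \<in> ?T n"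
      using eventually_in_nhd[OF op _ x] by auto
    have "gpow G (int k) (x [^] (fact n :: nat)) = (gpow G (int k) x) [^] (fact n :: nat)"
      using group_hom.hom_nat_pow[OF gpow_group_hom] x by blast
    also have "\<dots> = \<one>" using k by (simp add: gpow_nat)
    finally have "gpow G (- int k) (gpow G (int k) (x [^] (fact n :: nat))) = \<one>"
      by (simp add: gpow_one)
    then show ?thesis
      using gpow_cancel[of "x [^] (fact n :: nat)" "- int k"] x by simp
  qed
  then show ?thesis by (intro exI[of _ "fact n"]) auto
qed

lemma compact_cover_translates:
  assumes "compactin (gtop G) C" "openin (gtop G) U" "\<one> \<in> U"
  shows "\<exists>F. finite F \<and> F \<subseteq> C \<and> (\<forall>x\<in>C. \<exists>a\<in>F. inv a \<otimes> x \<in> U)"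
proof -
  let ?T = "\<lambda>a. {x \<in> carrier G. inv a \<otimes> x \<in> U}"
  have C: "C \<subseteq> carrier G" using assms compactin_subset_topspace topspace_eq by metis
  have "\<forall>V\<in>?T ` C. openin (gtop G) V" using C openin_translate assms by auto
  moreover have "C \<subseteq> \<Union>(?T ` C)" using C assms(3) by fastforce
  ultimately obtain \<F> where F: "finite \<F>" "\<F> \<subseteq> ?T ` C" "C \<subseteq> \<Union>\<F>"
    using assms(1) unfolding compactin_def by meson
  obtain F where "F \<subseteq> C" "finite F" "\<F> = ?T ` F"
    using finite_subset_image[OF F(1,2)] by blast
  then show ?thesis using F(3) by (intro exI[of _ F]) auto
qed

text \<open>Let \<open>K\<close> be a compact neighbourhood of the identity containing the open
  \<open>U\<close>. Finitely many translates \<open>a U\<close> cover \<open>K K\<close>, and the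
  translating elements lie in a finite submonoid \<open>P\<close>. Then \<open>P K\<close> is closed
  under products, because \<open>(p k) (q l) = (p q a) (inv a k l)\<close> with the last factor in
  \<open>U\<close>.\<close>

lemma compact_open_subgroup: "\<exists>H. subgroup H G \<and> compactin (gtop G) H \<and> openin (gtop G) H"
proof -
  obtain m :: nat where m: "m > 0" "\<And>x. x \<in> carrier G \<Longrightarrow> x [^] m = \<one>"
    using bounded_exponent by blast
  obtain U K where UK: "openin (gtop G) U" "compactin (gtop G) K" "\<one> \<in> U" "U \<subseteq> K"
    using locally_compact topspace_eq one_closed unfolding locally_compact_space_def by metis
  have K: "K \<subseteq> carrier G" using UK compactin_subset_topspace topspace_eq by metis
  have prod_compact: "compactin (gtop G) ((\<lambda>(x, y). x \<otimes> y) ` (C \<times> K))"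
    if "compactin (gtop G) C" for C
    by (rule image_compactin[OF _ continuous_mult]) (use that UK compactin_Times in blast)
  obtain F where F: "finite F" "F \<subseteq> (\<lambda>(x, y). x \<otimes> y) ` (K \<times> K)"
    "\<forall>x\<in>(\<lambda>(x, y). x \<otimes> y) ` (K \<times> K). \<exists>a\<in>F. inv a \<otimes> x \<in> U"
    using compact_cover_translates[OF prod_compact[OF UK(2)] UK(1,3)] by blast
  have Fc: "F \<subseteq> carrier G" using F(2) K by fastforce
  obtain P where P: "finite P" "F \<subseteq> P" "P \<subseteq> carrier G" "\<one> \<in> P" "\<forall>x\<in>P. \<forall>y\<in>P. x \<otimes> y \<in> P"
    using finite_submonoid_of_exponent[OF F(1) Fc m] by blast
  define H where "H = (\<lambda>(x, y). x \<otimes> y) ` (P \<times> K)"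
  have comp: "compactin (gtop G) H"
    unfolding H_def by (rule prod_compact) (use P topspace_eq finite_imp_compactin in metis)
  have memH: "p \<otimes> k \<in> H" if "p \<in> P" "k \<in> K" for p k
    using that unfolding H_def by (intro image_eqI[of _ _ "(p, k)"]) auto
  have HU: "U \<subseteq> H" using memH[of \<one>] P UK K by (metis l_one subset_iff)
  have sub: "subgroup H G"
  proof (rule subgroup_of_exponentI[OF _ _ _ m])
    show "H \<subseteq> carrier G" using P K by (auto simp: H_def)
    show "\<one> \<in> H" using HU UK by auto
    fix x y assume "x \<in> H" "y \<in> H"
    then obtain p k q l where pk: "p \<in> P" "k \<in> K" "q \<in> P" "l \<in> K" "x = p \<otimes> k" "y = q \<otimes> l"
      by (auto simp: H_def)
    then have c: "p \<in> carrier G" "k \<in> carrier G" "q \<in> carrier G" "l \<in> carrier G"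
      using P K by auto
    obtain a where a: "a \<in> F" "inv a \<otimes> (k \<otimes> l) \<in> U"
      using F(3) pk by force
    have ac: "a \<in> carrier G" using a Fc by auto
    have "x \<otimes> y = ((p \<otimes> q) \<otimes> a) \<otimes> (inv a \<otimes> (k \<otimes> l))"
    proof -
      have "((p \<otimes> q) \<otimes> a) \<otimes> (inv a \<otimes> (k \<otimes> l)) = (p \<otimes> q) \<otimes> ((a \<otimes> inv a) \<otimes> (k \<otimes> l))"
        using c ac by (metis inv_closed m_assoc m_closed)
      then show ?thesis using c ac pk by (simp add: m_ac)
    qed
    moreover have "(p \<otimes> q) \<otimes> a \<in> P" using P pk a by auto
    ultimately show "x \<otimes> y \<in> H" using memH a UK by auto
  qed
  then show ?thesis using comp open_subgroupI[OF sub UK(1) _ HU] UK by blast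
qed

text \<open>Pointwise convergence covers the group by such sets as \<open>n\<close> varies; since
  they are closed, Baire's theorem applies to the cover.\<close>

lemma closedin_eventually:
  assumes "closedin (gtop G) C"
  shows "closedin (gtop G) {x \<in> carrier G. \<forall>k\<ge>n. (gaut G ^^ k) x \<in> C}"
proof -
  have "{x \<in> carrier G. \<forall>k\<ge>n. (gaut G ^^ k) x \<in> C}
      = (\<Inter>k\<in>{n..}. {x \<in> topspace (gtop G). gpow G (int k) x \<in> C})"
    by (auto simp: gpow_nat topspace_eq)
  moreover have "closedin (gtop G) \<dots>"
    by (rule closedin_INT) (use closedin_continuous_map_preimage[OF continuous_gpow assms] in auto)
  ultimately show ?thesis by simp
qed

text \<open>Baire's theorem makes the pointwise convergence uniform on some nonempty open set, and finitely
  many translates of that set cover \<open>C\<close>.\<close>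

lemma uniform_contraction:
  assumes C: "compactin (gtop G) C" and V: "openin (gtop G) V" "\<one> \<in> V"
  shows "\<exists>n. \<forall>x\<in>C. (gaut G ^^ n) x \<in> V"
proof -
  have Cc: "C \<subseteq> carrier G" using assms compactin_subset_topspace topspace_eq by metis
  have "openin (prod_topology (gtop G) (gtop G)) {z \<in> topspace (prod_topology (gtop G) (gtop G)). (\<lambda>(x, y). x \<otimes> y) z \<in> V}"
    by (rule openin_continuous_map_preimage[OF continuous_mult V(1)])
  moreover have "(\<one>, \<one>) \<in> {z \<in> topspace (prod_topology (gtop G) (gtop G)). (\<lambda>(x, y). x \<otimes> y) z \<in> V}"
    using V by (auto simp: topspace_eq)
  ultimately obtain S T where ST: "openin (gtop G) S" "openin (gtop G) T" "\<one> \<in> S" "\<one> \<in> T"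
     "S \<times> T \<subseteq> {z \<in> topspace (prod_topology (gtop G) (gtop G)). (\<lambda>(x, y). x \<otimes> y) z \<in> V}"
    unfolding openin_prod_topology_alt by meson
  \<comment> \<open>Baire needs closed sets, so \<open>T\<close> is shrunk to a closed
    \<open>D\<close> that still contains an open neighbourhood \<open>Q\<close> of the
    identity.\<close>
  obtain Q D where Q: "openin (gtop G) Q" "closedin (gtop G) D" "\<one> \<in> Q" "Q \<subseteq> D" "D \<subseteq> T"
    using regular ST unfolding neighbourhood_base_of_closedin[symmetric] neighbourhood_base_of by meson
  let ?M = "\<lambda>n. {x \<in> carrier G. \<forall>k\<ge>n. (gaut G ^^ k) x \<in> D}"
  have cover: "carrier G \<subseteq> (\<Union>n. ?M n)"
  proof
    fix x assume "x \<in> carrier G"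
    moreover then obtain n where "\<forall>k\<ge>n. (gaut G ^^ k) x \<in> Q"
      using eventually_in_nhd[OF Q(1,3)] by blast
    ultimately have "x \<in> ?M n" using Q(4) by auto
    then show "x \<in> (\<Union>n. ?M n)" by blast
  qed
  obtain n R where R: "openin (gtop G) R" "R \<noteq> {}" "R \<subseteq> ?M n"
    using Baire_closed_cover[of ?M, OF closedin_eventually[OF Q(2)] cover] by blast
  obtain x where x: "x \<in> R" using R by auto
  have xc: "x \<in> carrier G" using x R by auto
  obtain F where F: "finite F" "F \<subseteq> C" "\<forall>w\<in>C. \<exists>a\<in>F. inv a \<otimes> w \<in> {z \<in> carrier G. x \<otimes> z \<in> R}"
    using compact_cover_translates[OF C openin_translate[OF xc R(1)]] xc x by auto
  have "\<forall>a\<in>F. \<exists>n. \<forall>k\<ge>n. (gaut G ^^ k) (a \<otimes> inv x) \<in> S"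
    using eventually_in_nhd[OF ST(1,3)] F(2) Cc xc by auto
  then obtain N where N: "\<And>a k. a \<in> F \<Longrightarrow> k \<ge> N a \<Longrightarrow> (gaut G ^^ k) (a \<otimes> inv x) \<in> S"
    by metis
  define k where "k = max n (Max (N ` F))"
  have "(gaut G ^^ k) w \<in> V" if w: "w \<in> C" for w
  proof -
    obtain a where a: "a \<in> F" "x \<otimes> (inv a \<otimes> w) \<in> R" using F w by auto
    have c: "a \<in> carrier G" "w \<in> carrier G" using a F w Cc by auto
    \<comment> \<open>The first factor runs through a finite set, so one \<open>k\<close> contracts
      all its values into \<open>S\<close>. The second lies in \<open>R\<close>, whose points are in
      \<open>D\<close> from time \<open>n\<close> on. Hence \<open>k\<close> depends on
      \<open>C\<close> and \<open>V\<close> but not on \<open>w\<close>.\<close>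
    have eq: "(a \<otimes> inv x) \<otimes> (x \<otimes> (inv a \<otimes> w)) = w"
    proof -
      have "(a \<otimes> inv x) \<otimes> (x \<otimes> (inv a \<otimes> w)) = a \<otimes> ((inv x \<otimes> x) \<otimes> (inv a \<otimes> w))"
        using c xc by (metis inv_closed m_assoc m_closed)
      also have "\<dots> = (a \<otimes> inv a) \<otimes> w"
        using c xc by (simp add: m_assoc[symmetric])
      finally show ?thesis using c by simp
    qed
    have "N a \<le> k" using a F(1) by (auto simp: k_def le_max_iff_disj)
    then have "(gaut G ^^ k) (a \<otimes> inv x) \<in> S" using N a by auto
    moreover have "(gaut G ^^ k) (x \<otimes> (inv a \<otimes> w)) \<in> T"
    proof -
      have "x \<otimes> (inv a \<otimes> w) \<in> ?M n" using a R(3) by blast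
      then show ?thesis using Q(5) by (auto simp: k_def)
    qed
    ultimately have "(gaut G ^^ k) (a \<otimes> inv x) \<otimes> (gaut G ^^ k) (x \<otimes> (inv a \<otimes> w)) \<in> V"
      using ST(5) by auto
    moreover have "gpow G (int k) ((a \<otimes> inv x) \<otimes> (x \<otimes> (inv a \<otimes> w)))
        = gpow G (int k) (a \<otimes> inv x) \<otimes> gpow G (int k) (x \<otimes> (inv a \<otimes> w))"
      using gpow_mult c xc by simp
    ultimately show ?thesis using eq by (simp add: gpow_nat)
  qed
  then show ?thesis by blast
qed

text \<open>The elements whose whole forward orbit stays in a compact open \<open>H\<close> form a
  closed invariant subgroup, compact because it lies in \<open>H\<close>. The issue is openness,
  which again comes from Baire.\<close>

lemma compact_open_invariant_subgroup:
  "\<exists>L. subgroup L G \<and> compactin (gtop G) L \<and> openin (gtop G) L \<and> (\<forall>x\<in>L. gaut G x \<in> L)"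
proof -
  obtain H where H: "subgroup H G" "compactin (gtop G) H" "openin (gtop G) H"
    using compact_open_subgroup by blast
  interpret H: subgroup H G by fact
  have Hcl: "closedin (gtop G) H" using H Hausdorff compactin_imp_closedin by blast
  let ?L = "\<lambda>n. {x \<in> carrier G. \<forall>k\<ge>n. (gaut G ^^ k) x \<in> H}"
  have closed: "closedin (gtop G) (?L n)" for n using closedin_eventually[OF Hcl] .
  have cover: "carrier G \<subseteq> (\<Union>n. ?L n)"
    using eventually_in_nhd[OF H(3)] H.one_closed by blast
  obtain n U where U: "openin (gtop G) U" "U \<noteq> {}" "U \<subseteq> ?L n"
    using Baire_closed_cover[of ?L, OF closed cover] by blast
  have sub: "subgroup (?L n) G" for n
    by (rule subgroupI)
      (auto simp: gpow_nat[symmetric] gpow_mult gpow_inv gpow_one intro: exI[of _ \<one>])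
  have LH: "?L 0 \<subseteq> H" by (auto dest!: spec[of _ 0])
  \<comment> \<open>This is the image of \<open>U\<close> under the \<open>n\<close>-th power of
    \<alpha>: orbits known to stay in \<open>H\<close> from time \<open>n\<close> on become orbits
    that stay there from time 0.\<close>
  let ?U = "{x \<in> topspace (gtop G). gpow G (- int n) x \<in> U}"
  have "openin (gtop G) ?U"
    by (rule openin_continuous_map_preimage[OF continuous_gpow U(1)])
  moreover have "?U \<noteq> {}"
  proof -
    obtain u where u: "u \<in> U" using U by auto
    then have "u \<in> carrier G" using U by auto
    then have "gpow G (int n) u \<in> ?U"
      using u gpow_cancel[of u "- int n"] gpow_closed topspace_eq by auto
    then show ?thesis by auto
  qed
  moreover have "?U \<subseteq> ?L 0"
  proof
    fix x assume x: "x \<in> ?U"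
    then have xc: "x \<in> carrier G" by (simp add: topspace_eq)
    have "(gaut G ^^ k) x \<in> H" for k
    proof -
      have "gpow G (int (k + n)) (gpow G (- int n) x) = gpow G (int k) x"
        using gpow_add[OF xc, of "int (k + n)" "- int n"] by simp
      moreover have "(gaut G ^^ (k + n)) (gpow G (- int n) x) \<in> H"
        using x U(3) by auto
      ultimately show ?thesis by (simp add: gpow_nat del: of_nat_add)
    qed
    then show "x \<in> ?L 0" using xc by simp
  qed
  ultimately have "openin (gtop G) (?L 0)" using open_subgroupI[OF sub[of 0], of ?U] by fast
  moreover have "compactin (gtop G) (?L 0)"
    using closed_compactin[OF H(2) LH closed] .
  moreover have "gaut G x \<in> ?L 0" if "x \<in> ?L 0" for x
  proof -
    have "(gaut G ^^ k) (gaut G x) \<in> H" for k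
    proof -
      have "(gaut G ^^ Suc k) x \<in> H" using that by blast
      then show ?thesis by (simp add: funpow_swap1)
    qed
    then show ?thesis using that gaut_bij by (auto simp: bij_betw_def)
  qed
  ultimately show ?thesis using sub[of 0] by (intro exI[of _ "?L 0"] conjI ballI) assumption+
qed

lemma compact_nested_Inter:
  assumes "\<And>n::nat. closedin (gtop G) (C n)" "compactin (gtop G) (C 0)"
    "\<And>n. C (Suc n) \<subseteq> C n" "\<And>n. C n \<noteq> {}"
  shows "(\<Inter>n. C n) \<noteq> {}"
proof
  assume emp: "(\<Inter>n. C n) = {}"
  let ?T = "\<lambda>n. topspace (gtop G) - C n"
  have "C 0 \<subseteq> \<Union>(range ?T)"
    using emp compactin_subset_topspace[OF assms(2)] by blast
  moreover have "\<forall>U\<in>range ?T. openin (gtop G) U" using assms(1) by auto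
  ultimately obtain \<F> where F: "finite \<F>" "\<F> \<subseteq> range ?T" "C 0 \<subseteq> \<Union>\<F>"
    using assms(2) unfolding compactin_def by meson
  obtain I where I: "finite I" "\<F> = ?T ` I"
    using finite_subset_image[OF F(1,2)] by blast
  have anti: "C n \<subseteq> C k" if "k \<le> n" for k n
    using that assms(3) by (metis lift_Suc_antimono_le)
  define N where "N = Max (insert 0 I)"
  obtain x where x: "x \<in> C N" using assms(4) by blast
  then have "x \<in> C k" if "k \<in> I" for k
    using anti[of k N] that I(1) by (auto simp: N_def)
  moreover have "x \<in> C 0" using x anti[of 0 N] by auto
  ultimately show False using F(3) I(2) by auto
qed

text \<open>\<open>W k\<close> is the image of \<open>L\<close> under the \<open>k\<close>-th power
  of \<alpha>, written as a preimage so that continuity makes it both open and closed. The exact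
  shift by one is then built in.\<close>

theorem compact_filtration: "\<exists>W. compact_filtered_cgroup G W"
proof -
  obtain L where L: "subgroup L G" "compactin (gtop G) L" "openin (gtop G) L"
    "\<And>x. x \<in> L \<Longrightarrow> gaut G x \<in> L"
    using compact_open_invariant_subgroup by blast
  interpret L: subgroup L G by fact
  define W where "W k = {x \<in> carrier G. gpow G (- k) x \<in> L}" for k :: int
  have W_open: "openin (gtop G) (W k)" for k
    using openin_continuous_map_preimage[OF continuous_gpow L(3)] by (simp add: W_def topspace_eq)
  have W_closed: "closedin (gtop G) (W k)" for k
    using closedin_continuous_map_preimage[OF continuous_gpow compactin_imp_closedin[OF Hausdorff L(2)]]
    by (simp add: W_def topspace_eq)
  have W_sub: "subgroup (W k) G" for k
    by (rule subgroupI) (auto simp: W_def gpow_mult gpow_inv gpow_one intro: exI[of _ \<one>])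
  have W0: "W 0 = L" by (auto simp: W_def gpow_0)
  \<comment> \<open>Uniform contraction of the compact \<open>L\<close> says precisely that the
    \<open>W k\<close> form a neighbourhood base at the identity; separation and the description of
    the topology both rest on this.\<close>
  have base: "\<exists>k. W (int k) \<subseteq> V" if V: "openin (gtop G) V" "\<one> \<in> V" for V
  proof -
    obtain n where n: "\<forall>x\<in>L. (gaut G ^^ n) x \<in> V"
      using uniform_contraction[OF L(2) V] by blast
    have "W (int n) \<subseteq> V"
    proof
      fix x assume "x \<in> W (int n)"
      then have x: "x \<in> carrier G" "gpow G (- int n) x \<in> L" by (auto simp: W_def)
      then have "gpow G (int n) (gpow G (- int n) x) \<in> V"
        using n by (simp add: gpow_nat)
      then show "x \<in> V" using gpow_cancel x by simp
    qed
    then show ?thesis by blast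
  qed
  have filt: "filtered_cgroup G W"
  proof (intro filtered_cgroup.intro filtered_cgroup_axioms.intro)
    show W_Suc: "W (k + 1) \<subseteq> W k" for k
    proof
      fix x assume x: "x \<in> W (k + 1)"
      then have "gaut G (gpow G (- (k + 1)) x) \<in> L" using L(4) by (auto simp: W_def)
      then show "x \<in> W k" using x gaut_gpow[of x "- (k + 1)"] by (auto simp: W_def)
    qed
    show "\<exists>k. x \<in> W k" if x: "x \<in> carrier G" for x
    proof -
      obtain n where "(gaut G ^^ n) x \<in> L"
        using eventually_in_nhd[OF L(3) L.one_closed x] by blast
      then have "x \<in> W (- int n)" using x by (simp add: W_def gpow_nat)
      then show ?thesis by blast
    qed
    show "x = \<one>" if x: "\<And>k. x \<in> W k" for x
    proof (rule ccontr)
      assume ne: "x \<noteq> \<one>"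
      have "x \<in> topspace (gtop G)" using x[of 0] by (simp add: W_def topspace_eq)
      then obtain U V where "openin (gtop G) U" "openin (gtop G) V" "x \<in> U" "\<one> \<in> V" "disjnt U V"
        using Hausdorff ne topspace_eq unfolding Hausdorff_space_def by (metis one_closed)
      moreover then obtain k where "W (int k) \<subseteq> V" using base by blast
      ultimately show False using x by (auto simp: disjnt_iff)
    qed
    show "gaut G x \<in> W (k + 1) \<longleftrightarrow> x \<in> W k" if "x \<in> carrier G" for x k
      using that gpow_gaut[OF that, of "- (k + 1)"] gaut_bij by (auto simp: W_def bij_betw_def)
    show "openin (gtop G) U \<longleftrightarrow> U \<subseteq> carrier G \<and>
        (\<forall>x\<in>U. \<exists>k. \<forall>y\<in>carrier G. inv x \<otimes> y \<in> W k \<longrightarrow> y \<in> U)" for U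
    proof (intro iffI conjI ballI)
      assume U: "openin (gtop G) U"
      show "U \<subseteq> carrier G" using openin_sub[OF U] .
      fix x assume x: "x \<in> U"
      then have xc: "x \<in> carrier G" using openin_sub[OF U] by auto
      obtain k where k: "W (int k) \<subseteq> {y \<in> carrier G. x \<otimes> y \<in> U}"
        using base[OF openin_translate[OF xc U]] x xc by auto
      have "y \<in> U" if "y \<in> carrier G" "inv x \<otimes> y \<in> W (int k)" for y
      proof -
        have "x \<otimes> (inv x \<otimes> y) \<in> U" using k that by auto
        then show ?thesis using xc that by (simp add: m_assoc[symmetric])
      qed
      then show "\<exists>k. \<forall>y\<in>carrier G. inv x \<otimes> y \<in> W k \<longrightarrow> y \<in> U" by blast
    next
      assume U: "U \<subseteq> carrier G \<and> (\<forall>x\<in>U. \<exists>k. \<forall>y\<in>carrier G. inv x \<otimes> y \<in> W k \<longrightarrow> y \<in> U)"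
      show "openin (gtop G) U"
      proof (subst openin_subopen, intro ballI)
        fix x assume x: "x \<in> U"
        then have xc: "x \<in> carrier G" using U by auto
        obtain k where k: "\<forall>y\<in>carrier G. inv x \<otimes> y \<in> W k \<longrightarrow> y \<in> U" using U x by blast
        have "x \<in> {y \<in> carrier G. inv x \<otimes> y \<in> W k}"
          using xc W_sub[of k] subgroup.one_closed by fastforce
        moreover have "openin (gtop G) {y \<in> carrier G. inv x \<otimes> y \<in> W k}"
          using openin_translate[OF _ W_open] xc by auto
        moreover have "{y \<in> carrier G. inv x \<otimes> y \<in> W k} \<subseteq> U" using k by auto
        ultimately show "\<exists>T. openin (gtop G) T \<and> x \<in> T \<and> T \<subseteq> U" by blast
      qed
    qed
  qed (use W_sub gaut_automorphism comm_group_axioms in auto)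
  interpret F: filtered_cgroup G W by fact
  have "compact_filtered_cgroup G W"
  proof unfold_locales
    show "\<exists>m::nat. m > 0 \<and> (\<forall>x\<in>carrier G. x [^] m = \<one>)" by (rule bounded_exponent)
    obtain A where A: "finite A" "A \<subseteq> L" "\<forall>x\<in>L. \<exists>a\<in>A. inv a \<otimes> x \<in> W 1"
      using compact_cover_translates[OF L(2) W_open F.W_one, of 1] by blast
    then show "\<exists>F. finite F \<and> F \<subseteq> carrier G \<and> (\<forall>x\<in>W 0. \<exists>a\<in>F. inv a \<otimes> x \<in> W 1)"
      using W0 L.subset by (intro exI[of _ A]) auto
    fix u assume u: "\<And>n. u n \<in> carrier G" "\<And>n. inv (u n) \<otimes> u (Suc n) \<in> W (int n)"
    \<comment> \<open>The limit is a common point of the cosets \<open>u n W n\<close>. They are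
      nested because step \<open>n\<close> of the sequence lies in \<open>W n\<close>, closed
      because \<open>W n\<close> is, and the largest is a translate of the compact
      \<open>L\<close>.\<close>
    define C where "C n = {y \<in> carrier G. inv (u n) \<otimes> y \<in> W (int n)}" for n
    have "(\<Inter>n. C n) \<noteq> {}"
    proof (rule compact_nested_Inter)
      fix n
      show "closedin (gtop G) (C n)"
        using closedin_continuous_map_preimage[OF continuous_translation W_closed] u
        by (simp add: C_def topspace_eq)
      show "C n \<noteq> {}" using u F.W_one by (auto simp: C_def intro: exI[of _ "u n"])
      show "C (Suc n) \<subseteq> C n"
      proof
        fix y assume y: "y \<in> C (Suc n)"
        then have "inv (u (Suc n)) \<otimes> y \<in> W (int n)"
          using F.W_Suc[of "int n"] by (auto simp: C_def algebra_simps)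
        then show "y \<in> C n"
          using y F.W_mult[OF u(2)[of n], of "inv (u (Suc n)) \<otimes> y"] quot_quot[OF u(1)[of n] u(1)[of "Suc n"], of y]
          by (simp add: C_def)
      qed
      have "C 0 = (\<lambda>y. u 0 \<otimes> y) ` W 0"
      proof (intro Set.set_eqI iffI)
        fix y assume y: "y \<in> C 0"
        then have "y = u 0 \<otimes> (inv (u 0) \<otimes> y)" using u by (simp add: C_def m_assoc[symmetric])
        then show "y \<in> (\<lambda>y. u 0 \<otimes> y) ` W 0" using y by (auto simp: C_def)
      next
        fix y assume "y \<in> (\<lambda>y. u 0 \<otimes> y) ` W 0"
        then show "y \<in> C 0" using u F.W_carrier by (auto simp: C_def m_assoc[symmetric])
      qed
      then show "compactin (gtop G) (C 0)"
        using image_compactin[OF L(2) continuous_translation] u W0 by simp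
    qed
    then show "\<exists>z\<in>carrier G. \<forall>n. inv (u n) \<otimes> z \<in> W (int n)"
      by (auto simp: C_def)
  qed
  then show ?thesis by blast
qed

end

section \<open>Bases adapted to the divisible socle filtration\<close>

lemma (in comm_group) finprod_in_subgroup:
  assumes "subgroup H G" "\<And>i. i \<in> A \<Longrightarrow> f i \<in> H"
  shows "finprod G f A \<in> H"
proof -
  interpret H: subgroup H G by fact
  show ?thesis using assms(2)
  proof (induction A rule: infinite_finite_induct)
    case (insert a A)
    then have "f \<in> A \<rightarrow> carrier G" "f a \<in> carrier G" by auto
    then show ?case using insert by simp
  qed auto
qed

context compact_filtered_cgroup
begin

sublocale automorphic_group G
  by unfold_locales (rule gaut_iso)

lemma gpow_W_iff:
  assumes "x \<in> carrier G"
  shows "gpow G s x \<in> W (k + s) \<longleftrightarrow> x \<in> W k"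
proof (induction s rule: int_induct[where k = 0])
  case base
  show ?case by (simp add: gpow_0)
next
  case (step1 i)
  then show ?case
    using gaut_W_iff[OF gpow_closed[OF assms], of i "k + i"] gaut_gpow[OF assms, of i]
    by (simp add: add.assoc)
next
  case (step2 i)
  then show ?case
    using gaut_W_iff[OF gpow_closed[OF assms], of "i - 1" "k + (i - 1)"] gaut_gpow[OF assms, of "i - 1"]
    by simp
qed

lemma gpow_W: "x \<in> W k \<Longrightarrow> gpow G s x \<in> W (k + s)"
  using gpow_W_iff W_carrier by blast

text \<open>\<open>V p 0\<close> is the whole \<open>p\<close>-socle, and \<open>j\<close> bounds
  the height from below: it counts how often an element can be divided by \<open>p\<close>.\<close>

definition V :: "nat \<Rightarrow> nat \<Rightarrow> 'a set" where
  "V p j = {x \<in> carrier G. x [^] p = \<one> \<and> (\<exists>u\<in>carrier G. x = u [^] (p ^ j))}"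

lemma V_subgroup: "subgroup (V p j) G"
proof (rule subgroupI)
  show "V p j \<noteq> {}"
    by (auto simp: V_def intro!: exI[of _ \<one>] bexI[of _ \<one>])
  fix x y assume x: "x \<in> V p j"
  then obtain u where u: "u \<in> carrier G" "x = u [^] (p ^ j)" by (auto simp: V_def)
  then have "inv x = (inv u) [^] (p ^ j)" by (simp add: nat_pow_inv)
  moreover have "inv x [^] p = \<one>" using x by (simp add: V_def nat_pow_inv)
  ultimately show "inv x \<in> V p j" using x u unfolding V_def by blast
  assume y: "y \<in> V p j"
  then obtain v where v: "v \<in> carrier G" "y = v [^] (p ^ j)" by (auto simp: V_def)
  then have "x \<otimes> y = (u \<otimes> v) [^] (p ^ j)" using u by (simp add: nat_pow_distrib)
  moreover have "(x \<otimes> y) [^] p = \<one>" using x y by (simp add: V_def nat_pow_distrib)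
  ultimately show "x \<otimes> y \<in> V p j" using x y u v unfolding V_def by blast
qed (auto simp: V_def)

lemma V_Suc: "V p (Suc j) \<subseteq> V p j"
proof
  fix x assume x: "x \<in> V p (Suc j)"
  then obtain u where u: "u \<in> carrier G" "x = u [^] (p ^ Suc j)" by (auto simp: V_def)
  then have "x = (u [^] p) [^] (p ^ j)" by (simp add: nat_pow_pow)
  then show "x \<in> V p j" using x u by (auto simp: V_def)
qed

lemma V_antimono: "i \<le> j \<Longrightarrow> V p j \<subseteq> V p i"
  using V_Suc by (metis lift_Suc_antimono_le)

lemma gpow_V: "x \<in> V p j \<Longrightarrow> gpow G s x \<in> V p j"
proof -
  assume x: "x \<in> V p j"
  then obtain u where u: "u \<in> carrier G" "x = u [^] (p ^ j)" by (auto simp: V_def)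
  have pow: "gpow G s (z [^] n) = gpow G s z [^] n" if "z \<in> carrier G" for z and n :: nat
    using group_hom.hom_nat_pow[OF gpow_group_hom that] .
  then have "gpow G s x [^] p = \<one>" using x by (auto simp: V_def gpow_one pow[symmetric])
  moreover have "gpow G s x = gpow G s u [^] (p ^ j)" using pow u by simp
  ultimately show ?thesis using x u gpow_closed by (auto simp: V_def)
qed

lemma nat_pow_coprime_eq_one:
  assumes "x \<in> carrier G" "x [^] (a::nat) = \<one>" "x [^] (b::nat) = \<one>" "coprime a b"
  shows "x = \<one>"
proof -
  have "ord x dvd a" "ord x dvd b" using assms pow_eq_id by auto
  then have "ord x = 1" using assms(4) by (metis coprime_common_divisor_nat)
  then show ?thesis using assms(1) ord_eq_1 by blast
qed

text \<open>If the exponent is \<open>p^J r\<close> with \<open>r\<close> prime to \<open>p\<close>,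
  then a \<open>p^J\<close>-th power is killed by \<open>r\<close>; killed by \<open>p\<close> as
  well, it is trivial. The basis construction starts at this end of the chain.\<close>

lemma V_trivial:
  assumes "prime p"
  shows "\<exists>J. V p J = {\<one>}"
proof -
  obtain m :: nat where m: "m > 0" "\<And>x. x \<in> carrier G \<Longrightarrow> x [^] m = \<one>"
    using bounded_exponent by blast
  define J where "J = multiplicity p m"
  obtain r where r: "m = p ^ J * r" "\<not> p dvd r"
    using multiplicity_decompose'[of m p] m assms unfolding J_def
    by (metis not_prime_unit neq0_conv)
  have "x = \<one>" if x: "x \<in> V p J" for x
  proof -
    obtain u where u: "u \<in> carrier G" "x = u [^] (p ^ J)" using x by (auto simp: V_def)
    have "x [^] r = \<one>" using u m r by (simp add: nat_pow_pow)
    moreover have "x [^] p = \<one>" "x \<in> carrier G" using that by (auto simp: V_def)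
    moreover have "coprime p r" using r assms prime_imp_coprime by blast
    ultimately show ?thesis using nat_pow_coprime_eq_one by blast
  qed
  moreover have "\<one> \<in> V p J" using V_subgroup subgroup.one_closed by blast
  ultimately show ?thesis by blast
qed

text \<open>Linear independence over F_p of the images in \<open>W 0 / W 1\<close>. Integer
  exponents avoid building the quotient space; they matter only modulo \<open>p\<close>, since
  elements of \<open>V p 0\<close> are killed by \<open>p\<close>.\<close>

definition residually_independent :: "nat \<Rightarrow> 'a set \<Rightarrow> bool" where
  "residually_independent p B \<longleftrightarrow> finite B \<and> B \<subseteq> W 0 \<inter> V p 0 \<and>
     (\<forall>g::'a \<Rightarrow> int. (\<Otimes>b\<in>B. b [^] g b) \<in> W 1 \<longrightarrow> (\<forall>b\<in>B. int p dvd g b))"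

lemma residually_independentD:
  fixes g :: "'a \<Rightarrow> int"
  shows "residually_independent p B \<Longrightarrow> (\<Otimes>b\<in>B. b [^] g b) \<in> W 1 \<Longrightarrow> b \<in> B \<Longrightarrow> int p dvd g b"
  unfolding residually_independent_def by blast

text \<open>Instantiates the quantified exponents without unfolding the definition at every
  use.\<close>

lemma residually_independent_card_bounded:
  assumes "prime p"
  shows "\<exists>N. \<forall>B. residually_independent p B \<longrightarrow> card B \<le> N"
proof -
  obtain F where F: "finite F" "F \<subseteq> carrier G" "\<forall>x\<in>W 0. \<exists>a\<in>F. inv a \<otimes> x \<in> W 1"
    using finite_index by blast
  then obtain c where c: "\<And>x. x \<in> W 0 \<Longrightarrow> c x \<in> F \<and> inv (c x) \<otimes> x \<in> W 1" by metis
  have "card B \<le> card F" if B: "residually_independent p B" for B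
  proof (rule card_inj_on_le[of c])
    have Bsub: "finite B" "B \<subseteq> W 0" using B by (auto simp: residually_independent_def)
    show "c ` B \<subseteq> F" using c Bsub by auto
    show "inj_on c B"
    proof (rule inj_onI, rule ccontr)
      fix b d assume bd: "b \<in> B" "d \<in> B" "c b = c d" "b \<noteq> d"
      have car: "b \<in> carrier G" "d \<in> carrier G" "c d \<in> carrier G"
        using bd Bsub c F(2) W_carrier by blast+
      have W: "inv (c d) \<otimes> b \<in> W 1" "inv (c d) \<otimes> d \<in> W 1"
        using c[of b] c[of d] bd Bsub by auto
      have "inv (inv (c d) \<otimes> d) \<otimes> (inv (c d) \<otimes> b) = inv d \<otimes> b"
        using quot_mult[of "inv (c d)" "inv (c d)" d b] car by simp
      then have mem: "inv d \<otimes> b \<in> W 1" using W W_mult W_inv by metis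
      let ?g = "\<lambda>x. if x = b then 1 else if x = d then -1 else 0 :: int"
      have "(\<Otimes>x\<in>B. x [^] ?g x) = (\<Otimes>x\<in>{b, d}. x [^] ?g x)"
        by (rule finprod_mono_neutral_cong_right) (use bd Bsub W_carrier in auto)
      also have "\<dots> = b \<otimes> inv d"
        using bd car by (simp add: int_pow_neg Pi_def)
      also have "\<dots> = inv d \<otimes> b" using car by (simp add: m_comm)
      finally have "int p dvd ?g b"
        using residually_independentD[OF B, of ?g b] mem bd(1) by simp
      then show False using assms by (simp add: not_prime_unit[of "int p"])
    qed
  qed (use F in auto)
  then show ?thesis by blast
qed

text \<open>Basis exchange by cardinality: among the independent extensions of \<open>B0\<close>
  inside \<open>V p j\<close> there is a largest one, and it spans, because adding any further
  \<open>x\<close> produces a relation that can be solved for \<open>x\<close>.\<close>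

lemma residually_independent_extend:
  assumes p: "prime p" and B0: "residually_independent p B0" "B0 \<subseteq> V p j"
  shows "\<exists>B. B0 \<subseteq> B \<and> residually_independent p B \<and> B \<subseteq> V p j \<and>
           (\<forall>x\<in>W 0 \<inter> V p j. \<exists>g::'a \<Rightarrow> int. x \<otimes> inv (\<Otimes>b\<in>B. b [^] g b) \<in> W 1)"
proof -
  let ?P = "\<lambda>B. B0 \<subseteq> B \<and> residually_independent p B \<and> B \<subseteq> V p j"
  obtain N where "\<forall>B. residually_independent p B \<longrightarrow> card B \<le> N"
    using residually_independent_card_bounded[OF p] by blast
  then have "\<exists>B. ?P B \<and> (\<forall>B'. ?P B' \<longrightarrow> card B' \<le> card B)"
    using ex_has_greatest_nat[of ?P B0 card "Suc N"] B0 by (metis (lifting) le_imp_less_Suc order.refl)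
  then obtain B where B: "B0 \<subseteq> B" "residually_independent p B" "B \<subseteq> V p j"
    and max: "\<And>B'. ?P B' \<Longrightarrow> card B' \<le> card B" by blast
  have fin: "finite B" and Bsub: "B \<subseteq> W 0" "B \<subseteq> V p 0" and Bcar: "B \<subseteq> carrier G"
    using B W_carrier by (auto simp: residually_independent_def)
  have "\<exists>g::'a \<Rightarrow> int. x \<otimes> inv (\<Otimes>b\<in>B. b [^] g b) \<in> W 1" if x: "x \<in> W 0 \<inter> V p j" for x
  proof (cases "x \<in> B")
    case True
    let ?g = "\<lambda>b. if b = x then 1 else 0 :: int"
    have xc: "x \<in> carrier G" using x W_carrier by auto
    have "(\<Otimes>b\<in>B. b [^] ?g b) = (\<Otimes>b\<in>{x}. b [^] ?g b)"
      by (rule finprod_mono_neutral_cong_right) (use True fin Bcar xc in auto)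
    also have "\<dots> = x" using xc by simp
    finally show ?thesis using xc W_one by (intro exI[of _ ?g]) simp
  next
    case False
    have xc: "x \<in> carrier G" using x W_carrier by auto
    have "\<not> ?P (insert x B)" using max[of "insert x B"] False fin by auto
    then have "\<not> residually_independent p (insert x B)" using B x by auto
    moreover have "insert x B \<subseteq> W 0 \<inter> V p 0"
      using x Bsub V_antimono[of 0 j p] by auto
    ultimately obtain g :: "'a \<Rightarrow> int" where
      g: "(\<Otimes>b\<in>insert x B. b [^] g b) \<in> W 1" "\<exists>b\<in>insert x B. \<not> int p dvd g b"
      using fin by (auto simp: residually_independent_def)
    have ins: "(\<Otimes>b\<in>insert x B. b [^] g b) = x [^] g x \<otimes> (\<Otimes>b\<in>B. b [^] g b)"
      using fin False Bcar xc by (subst finprod_insert) auto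
    \<comment> \<open>Otherwise \<open>x\<close> would drop out, as it is killed by
      \<open>p\<close>, and leave a nontrivial relation within the independent
      \<open>B\<close>.\<close>
    have ndvd: "\<not> int p dvd g x"
    proof
      assume dvd: "int p dvd g x"
      then obtain t where t: "g x = int p * t" by auto
      have "x [^] g x = (x [^] int p) [^] t" using t xc by (simp add: int_pow_pow)
      also have "\<dots> = \<one>" using x by (auto simp: V_def int_pow_int)
      finally have "(\<Otimes>b\<in>B. b [^] g b) \<in> W 1"
        using g(1) ins Bcar by (simp add: Pi_def subset_iff)
      then show False using B(2) g(2) dvd by (auto simp: residually_independent_def)
    qed
    then have "coprime (g x) (int p)"
      using p by (metis coprime_commute prime_imp_coprime prime_nat_int_transfer)
    \<comment> \<open>Raising the relation to the power \<open>a\<close> makes the exponent of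
      \<open>x\<close> congruent to 1 modulo \<open>p\<close>, so \<open>x\<close> itself appears;
      the wanted coefficients are then \<open>- a\<close> times the old ones.\<close>
    then obtain a where a: "[g x * a = 1] (mod int p)"
      using cong_solve_coprime_int by blast
    have c: "(\<Otimes>b\<in>B. b [^] g b) \<in> carrier G" using Bcar by (auto intro: finprod_closed)
    have pow: "(\<Otimes>b\<in>B. b [^] g b) [^] a = (\<Otimes>b\<in>B. b [^] (g b * a))"
      using fin Bcar
    proof (induction B rule: finite_induct)
      case (insert b B)
      have "(\<Otimes>b\<in>B. b [^] g b) \<in> carrier G"
        using insert by (auto intro: finprod_closed)
      then show ?case
        using insert by (simp add: int_pow_distrib int_pow_pow Pi_def subset_iff)
    qed simp
    obtain t where "g x * a - 1 = int p * t"
      using a unfolding cong_iff_dvd_diff by (elim dvdE)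
    then have t: "g x * a = 1 + int p * t" by simp
    have "(x [^] g x \<otimes> (\<Otimes>b\<in>B. b [^] g b)) [^] a \<in> W 1"
      using g(1) ins subgroup_int_pow_closed[OF W_subgroup] by metis
    moreover have "(x [^] g x \<otimes> (\<Otimes>b\<in>B. b [^] g b)) [^] a = x [^] (g x * a) \<otimes> (\<Otimes>b\<in>B. b [^] (g b * a))"
      using xc c by (simp add: int_pow_distrib int_pow_pow pow)
    moreover have "x [^] (g x * a) = x"
    proof -
      have "x [^] (g x * a) = x \<otimes> (x [^] int p) [^] t"
        using xc unfolding t by (simp add: int_pow_mult int_pow_pow)
      then show ?thesis using x xc by (auto simp: V_def int_pow_int)
    qed
    moreover have "inv (\<Otimes>b\<in>B. b [^] (g b * - a)) = (\<Otimes>b\<in>B. b [^] (g b * a))"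
      using fin Bcar
    proof (induction B rule: finite_induct)
      case (insert b B)
      have "(\<Otimes>b\<in>B. b [^] (g b * - a)) \<in> carrier G" "(\<Otimes>b\<in>B. b [^] (g b * a)) \<in> carrier G"
        using insert by (auto intro: finprod_closed)
      then show ?case
        using insert by (simp add: inv_mult int_pow_neg Pi_def subset_iff)
    qed simp
    ultimately have "x \<otimes> inv (\<Otimes>b\<in>B. b [^] (g b * - a)) \<in> W 1" by simp
    then show ?thesis by (intro exI[of _ "\<lambda>b. g b * - a"])
  qed
  then show ?thesis using B by blast
qed

text \<open>The chain \<open>V p j\<close> is climbed from its trivial end towards the socle, each
  step enlarging the basis found so far. Earlier elements are never replaced, so one set is adapted
  to all members of the chain.\<close>

lemma adapted_basis:
  assumes p: "prime p"
  shows "\<exists>B. residually_independent p B \<and>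
    (\<forall>i. \<forall>x\<in>W 0 \<inter> V p i. \<exists>g::'a \<Rightarrow> int. x \<otimes> inv (\<Otimes>b\<in>B \<inter> V p i. b [^] g b) \<in> W 1)"
proof -
  obtain J where J: "V p J = {\<one>}" using V_trivial[OF p] by blast
  let ?span = "\<lambda>B i. \<forall>x\<in>W 0 \<inter> V p i. \<exists>g::'a \<Rightarrow> int. x \<otimes> inv (\<Otimes>b\<in>B \<inter> V p i. b [^] g b) \<in> W 1"
  have "\<exists>B. residually_independent p B \<and> B \<subseteq> V p 0 \<and> (\<forall>i\<ge>0. ?span B i)"
    using le0[of J]
  proof (induction rule: inc_induct)
    case base
    have "V p i = {\<one>}" if "i \<ge> J" for i
      using V_antimono[OF that, of p] J subgroup.one_closed[OF V_subgroup[of p i]] by auto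
    then have "\<forall>i\<ge>J. ?span {} i" using W_one by auto
    then show ?case by (intro exI[of _ "{}"]) (auto simp: residually_independent_def)
  next
    case (step j)
    then obtain B0 where B0: "residually_independent p B0" "B0 \<subseteq> V p (Suc j)" "\<forall>i\<ge>Suc j. ?span B0 i" by blast
    then obtain B where B: "B0 \<subseteq> B" "residually_independent p B" "B \<subseteq> V p j"
      "\<forall>x\<in>W 0 \<inter> V p j. \<exists>g::'a \<Rightarrow> int. x \<otimes> inv (\<Otimes>b\<in>B. b [^] g b) \<in> W 1"
      using residually_independent_extend[OF p B0(1) subset_trans[OF B0(2) V_Suc]] by blast
    have "?span B i" if i: "i \<ge> j" for i
    proof (cases "i = j")
      case True
      moreover have "B \<inter> V p j = B" using B by auto
      ultimately show ?thesis using B(4) by simp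
    next
      case False
      show ?thesis
      proof
        fix x assume "x \<in> W 0 \<inter> V p i"
        then obtain g :: "'a \<Rightarrow> int" where g: "x \<otimes> inv (\<Otimes>b\<in>B0 \<inter> V p i. b [^] g b) \<in> W 1"
          using B0(3)[rule_format, of i x] False i by auto
        \<comment> \<open>A newly added element that happens to lie in \<open>V p i\<close> enters
          with exponent 0.\<close>
        have "(\<Otimes>b\<in>B \<inter> V p i. b [^] (if b \<in> B0 then g b else 0)) = (\<Otimes>b\<in>B0 \<inter> V p i. b [^] g b)"
          by (rule finprod_mono_neutral_cong_right)
            (use B in \<open>auto simp: residually_independent_def V_def\<close>)
        then show "\<exists>g::'a \<Rightarrow> int. x \<otimes> inv (\<Otimes>b\<in>B \<inter> V p i. b [^] g b) \<in> W 1"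
          using g by (intro exI[of _ "\<lambda>b. if b \<in> B0 then g b else 0"]) simp
      qed
    qed
    then have "\<forall>i\<ge>j. ?span B i" by simp
    then show ?case using B(2,3) by (intro exI[of _ B] conjI)
  qed
  then obtain B where B: "residually_independent p B" "\<forall>i\<ge>0. ?span B i" by (elim exE conjE)
  have "\<forall>i. ?span B i" using B(2) by simp
  then show ?thesis using B(1) by (intro exI[of _ B] conjI)
qed

end

section \<open>Convergent two-sided products\<close>

context compact_filtered_cgroup
begin

text \<open>The two ends of the interval move independently, which makes the notion shift invariant.\<close>

definition bisums :: "(int \<Rightarrow> 'a) \<Rightarrow> 'a \<Rightarrow> bool" where
  "bisums u x \<longleftrightarrow> (\<forall>s. u s \<in> carrier G) \<and> x \<in> carrier G \<and>
     (\<forall>N. \<exists>K. \<forall>a b. a \<le> - K \<longrightarrow> K \<le> b \<longrightarrow> inv (\<Otimes>s\<in>{a..<b}. u s) \<otimes> x \<in> W N)"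

lemma quot_W_cancel:
  assumes "a \<in> carrier G" "x \<in> carrier G" "y \<in> carrier G" "inv a \<otimes> x \<in> W N" "inv a \<otimes> y \<in> W N"
  shows "inv x \<otimes> y \<in> W N"
proof -
  have "inv (inv a \<otimes> x) \<otimes> (inv a \<otimes> y) = inv x \<otimes> y"
    using quot_mult[of "inv a" "inv a" x y] assms by simp
  then show ?thesis using assms W_mult W_inv by metis
qed

lemma bisums_unique:
  assumes "bisums u x" "bisums u y"
  shows "x = y"
proof -
  have c: "x \<in> carrier G" "y \<in> carrier G" "\<And>s. u s \<in> carrier G"
    using assms by (auto simp: bisums_def)
  have "inv x \<otimes> y \<in> W N" for N
  proof -
    obtain K L where K: "\<And>a b. a \<le> - K \<Longrightarrow> K \<le> b \<Longrightarrow> inv (\<Otimes>s\<in>{a..<b}. u s) \<otimes> x \<in> W N"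
      and L: "\<And>a b. a \<le> - L \<Longrightarrow> L \<le> b \<Longrightarrow> inv (\<Otimes>s\<in>{a..<b}. u s) \<otimes> y \<in> W N"
      using assms unfolding bisums_def by meson
    let ?M = "max K L"
    show ?thesis
      using quot_W_cancel[OF _ c(1,2) K[of "- ?M" ?M] L[of "- ?M" ?M]] c by (auto intro: finprod_closed)
  qed
  then have "inv x \<otimes> y = \<one>" using W_separated by blast
  then show ?thesis using c by (metis inv_equality inv_inv inv_closed)
qed

lemma bisums_mult:
  assumes "bisums u x" "bisums v y"
  shows "bisums (\<lambda>s. u s \<otimes> v s) (x \<otimes> y)"
  unfolding bisums_def
proof (intro conjI allI)
  have c: "x \<in> carrier G" "y \<in> carrier G" "\<And>s. u s \<in> carrier G" "\<And>s. v s \<in> carrier G"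
    using assms by (auto simp: bisums_def)
  then show "u s \<otimes> v s \<in> carrier G" "x \<otimes> y \<in> carrier G" for s by auto
  fix N
  obtain K L where K: "\<And>a b. a \<le> - K \<Longrightarrow> K \<le> b \<Longrightarrow> inv (\<Otimes>s\<in>{a..<b}. u s) \<otimes> x \<in> W N"
    and L: "\<And>a b. a \<le> - L \<Longrightarrow> L \<le> b \<Longrightarrow> inv (\<Otimes>s\<in>{a..<b}. v s) \<otimes> y \<in> W N"
    using assms unfolding bisums_def by meson
  have "inv (\<Otimes>s\<in>{a..<b}. u s \<otimes> v s) \<otimes> (x \<otimes> y) \<in> W N" if "a \<le> - max K L" "max K L \<le> b" for a b
  proof -
    have "(\<Otimes>s\<in>{a..<b}. u s \<otimes> v s) = (\<Otimes>s\<in>{a..<b}. u s) \<otimes> (\<Otimes>s\<in>{a..<b}. v s)"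
      using c by (intro finprod_multf) auto
    moreover have "(\<Otimes>s\<in>{a..<b}. u s) \<in> carrier G" "(\<Otimes>s\<in>{a..<b}. v s) \<in> carrier G"
      using c by (auto intro: finprod_closed)
    ultimately show ?thesis
      using K[of a b] L[of a b] that c W_mult by (simp add: quot_mult)
  qed
  then show "\<exists>K. \<forall>a b. a \<le> - K \<longrightarrow> K \<le> b \<longrightarrow> inv (\<Otimes>s\<in>{a..<b}. u s \<otimes> v s) \<otimes> (x \<otimes> y) \<in> W N"
    by blast
qed

lemma bisums_one: "bisums (\<lambda>s. \<one>) \<one>"
  using W_one by (auto simp: bisums_def)

lemma bisums_nat_pow: "bisums u x \<Longrightarrow> bisums (\<lambda>s. u s [^] (n::nat)) (x [^] n)"
  by (induction n) (auto simp: bisums_one bisums_mult)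

lemma finprod_interval_split:
  assumes "\<And>s. u s \<in> carrier G" "a \<le> b" "b \<le> (c::int)"
  shows "(\<Otimes>s\<in>{a..<c}. u s) = (\<Otimes>s\<in>{a..<b}. u s) \<otimes> (\<Otimes>s\<in>{b..<c}. u s)"
proof -
  have "{a..<c} = {a..<b} \<union> {b..<c}" using assms by auto
  then show ?thesis using assms(1) by (simp add: finprod_Un_disjoint Pi_def)
qed

lemma finprod_interval_lower:
  assumes "\<And>s. u s \<in> carrier G" "\<And>s. s < L \<Longrightarrow> u s = \<one>" "a \<le> L" "L \<le> (b::int)"
  shows "(\<Otimes>s\<in>{a..<b}. u s) = (\<Otimes>s\<in>{L..<b}. u s)"
proof -
  have "(\<Otimes>s\<in>{a..<L}. u s) = \<one>" using assms by (intro finprod_one_eqI) auto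
  moreover have "(\<Otimes>s\<in>{L..<b}. u s) \<in> carrier G" using assms by (auto intro: finprod_closed)
  ultimately show ?thesis using finprod_interval_split[of u, OF assms(1,3,4)] by simp
qed

text \<open>The terms shrink at a linear rate as \<open>s\<close> grows, and the bound
  \<open>L\<close> leaves only this one direction for passing to the limit, so completeness applies
  to the partial products.\<close>

lemma bisums_exists:
  assumes low: "\<And>s. s < L \<Longrightarrow> u s = \<one>" and small: "\<And>s. u s \<in> W (s - c)"
  shows "\<exists>x. bisums u x"
proof -
  have uc: "u s \<in> carrier G" for s using small W_carrier by blast
  \<comment> \<open>Starting at \<open>M \<ge> c\<close> places the term at position
    \<open>M + n\<close> in \<open>W n\<close>, the rate demanded by \<open>complete\<close>;
    \<open>M \<ge> L\<close> lets the intervals be split at their last point.\<close>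
  define M where "M = max L c"
  define w where "w n = (\<Otimes>s\<in>{L..<M + int n}. u s)" for n
  have wc: "w n \<in> carrier G" for n unfolding w_def using uc by (auto intro: finprod_closed)
  have "inv (w n) \<otimes> w (Suc n) \<in> W (int n)" for n
  proof -
    have "{M + int n..<M + int (Suc n)} = {M + int n}" by auto
    then have "w (Suc n) = w n \<otimes> u (M + int n)"
      using finprod_interval_split[of u L "M + int n" "M + int (Suc n)", OF uc] uc
      by (simp add: w_def M_def)
    then have "inv (w n) \<otimes> w (Suc n) = u (M + int n)"
      using wc uc by (simp add: m_assoc[symmetric])
    then show ?thesis using W_mono_mem[OF small[of "M + int n"], of "int n"] by (simp add: M_def)
  qed
  then obtain z where z: "z \<in> carrier G" "\<And>n. inv (w n) \<otimes> z \<in> W (int n)"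
    using complete[of w] wc by blast
  have "inv (\<Otimes>s\<in>{a..<b}. u s) \<otimes> z \<in> W N" if ab: "a \<le> - (\<bar>L\<bar> + \<bar>M\<bar> + \<bar>N\<bar>)" "\<bar>L\<bar> + \<bar>M\<bar> + \<bar>N\<bar> \<le> b" for N a b
  proof -
    have "(\<Otimes>s\<in>{a..<b}. u s) = (\<Otimes>s\<in>{L..<b}. u s)"
      using finprod_interval_lower[of u L a b] uc low ab by auto
    also have "\<dots> = w (nat (b - M))" using ab by (simp add: w_def)
    finally have "(\<Otimes>s\<in>{a..<b}. u s) = w (nat (b - M))" .
    moreover have "N \<le> int (nat (b - M))" using ab by linarith
    ultimately show ?thesis
      using W_mono_mem[OF z(2)[of "nat (b - M)"], of N] by simp
  qed
  then have "bisums u z" unfolding bisums_def using uc z(1) by blast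
  then show ?thesis by blast
qed

lemma bisums_small:
  assumes "bisums u x" "\<And>s. u s \<in> W M"
  shows "x \<in> W M"
proof -
  have x: "x \<in> carrier G" using assms(1) by (simp add: bisums_def)
  obtain K where "\<And>a b. a \<le> - K \<Longrightarrow> K \<le> b \<Longrightarrow> inv (\<Otimes>s\<in>{a..<b}. u s) \<otimes> x \<in> W M"
    using assms(1) unfolding bisums_def by meson
  then have K: "inv (\<Otimes>s\<in>{- K..<K}. u s) \<otimes> x \<in> W M" by simp
  have P: "(\<Otimes>s\<in>{- K..<K}. u s) \<in> W M"
    by (rule finprod_in_subgroup[OF W_subgroup assms(2)])
  then have "(\<Otimes>s\<in>{- K..<K}. u s) \<otimes> (inv (\<Otimes>s\<in>{- K..<K}. u s) \<otimes> x) \<in> W M"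
    using K W_mult by blast
  then show ?thesis using x W_carrier[OF P] by (simp add: m_assoc[symmetric])
qed

lemma bisums_gaut:
  assumes "bisums u x"
  shows "bisums (\<lambda>s. gaut G (u (s - 1))) (gaut G x)"
  unfolding bisums_def
proof (intro conjI allI)
  have c: "x \<in> carrier G" "\<And>s. u s \<in> carrier G" using assms by (auto simp: bisums_def)
  then show "gaut G (u (s - 1)) \<in> carrier G" "gaut G x \<in> carrier G" for s
    using gaut_closed by auto
  fix N
  \<comment> \<open>\<open>gaut\<close> gains one level, so approximation up to
    \<open>W (N - 1)\<close> is enough; using \<open>K + 1\<close> below pays for the shifted
    summation window.\<close>
  obtain K where K: "\<And>a b. a \<le> - K \<Longrightarrow> K \<le> b \<Longrightarrow> inv (\<Otimes>s\<in>{a..<b}. u s) \<otimes> x \<in> W (N - 1)"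
    using assms unfolding bisums_def by meson
  have hom: "group_hom G G (gaut G)"
    using gaut_iso by (simp add: group_hom_def group_hom_axioms_def iso_def)
  have "inv (\<Otimes>s\<in>{a..<b}. gaut G (u (s - 1))) \<otimes> gaut G x \<in> W N" if "a \<le> - (K + 1)" "K + 1 \<le> b" for a b
  proof -
    have fc: "(\<Otimes>s\<in>A. u s) \<in> carrier G" for A using c by (auto intro: finprod_closed)
    have gf: "gaut G (\<Otimes>s\<in>A. u s) = (\<Otimes>s\<in>A. gaut G (u s))" if "finite A" for A
      using that
    proof (induction A rule: finite_induct)
      case (insert s A)
      then show ?case using c fc gaut_closed gaut_mult by (simp add: Pi_def)
    qed (simp add: group_hom.hom_one[OF hom])
    have "{a..<b} = (\<lambda>s. s + 1) ` {a - 1..<b - 1}"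
      by (auto simp: image_iff intro: bexI[of _ "_ - 1"])
    then have "(\<Otimes>s\<in>{a..<b}. gaut G (u (s - 1)))
        = (\<Otimes>s\<in>(\<lambda>s. s + 1) ` {a - 1..<b - 1}. gaut G (u (s - 1)))" by simp
    also have "\<dots> = (\<Otimes>s\<in>{a - 1..<b - 1}. gaut G (u s))"
      by (subst finprod_reindex) (use c gaut_closed in auto)
    also have "\<dots> = gaut G (\<Otimes>s\<in>{a - 1..<b - 1}. u s)" using gf by simp
    finally have "inv (\<Otimes>s\<in>{a..<b}. gaut G (u (s - 1))) \<otimes> gaut G x
        = gaut G (inv (\<Otimes>s\<in>{a - 1..<b - 1}. u s) \<otimes> x)"
      using fc c gaut_mult group_hom.hom_inv[OF hom] by simp
    then show ?thesis
      using K[of "a - 1" "b - 1"] that gaut_W_iff[of "inv (\<Otimes>s\<in>{a - 1..<b - 1}. u s) \<otimes> x" "N - 1"] fc c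
      by simp
  qed
  then show "\<exists>K. \<forall>a b. a \<le> - K \<longrightarrow> K \<le> b \<longrightarrow>
      inv (\<Otimes>s\<in>{a..<b}. gaut G (u (s - 1))) \<otimes> gaut G x \<in> W N" by blast
qed

text \<open>In a product with value \<open>\<one>\<close> the lowest term is, up to an element of
  \<open>W (L + 1)\<close>, the inverse of the remaining terms, and these all lie in
  \<open>W (L + 1)\<close>. Uniqueness of expansions rests on this.\<close>

lemma bisums_lowest_term:
  assumes "bisums u \<one>" "\<And>s. s < L \<Longrightarrow> u s = \<one>" "\<And>s. u s \<in> W s"
  shows "u L \<in> W (L + 1)"
proof -
  have uc: "u s \<in> carrier G" for s using assms W_carrier by blast
  obtain K where K: "\<And>a b. a \<le> - K \<Longrightarrow> K \<le> b \<Longrightarrow> inv (\<Otimes>s\<in>{a..<b}. u s) \<otimes> \<one> \<in> W (L + 1)"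
    using assms(1) unfolding bisums_def by meson
  define b where "b = \<bar>K\<bar> + \<bar>L\<bar> + 1"
  have "(\<Otimes>s\<in>{- b..<b}. u s) = (\<Otimes>s\<in>{L..<b}. u s)"
    using finprod_interval_lower[of u L "- b" b] uc assms by (auto simp: b_def)
  also have "\<dots> = (\<Otimes>s\<in>{L..<L + 1}. u s) \<otimes> (\<Otimes>s\<in>{L + 1..<b}. u s)"
    by (rule finprod_interval_split) (auto simp: b_def uc)
  also have "{L..<L + 1} = {L}" by auto
  finally have eq: "(\<Otimes>s\<in>{- b..<b}. u s) = u L \<otimes> (\<Otimes>s\<in>{L + 1..<b}. u s)" using uc by simp
  have fc: "(\<Otimes>s\<in>A. u s) \<in> carrier G" for A using uc by (auto intro: finprod_closed)
  have "inv (\<Otimes>s\<in>{- b..<b}. u s) \<in> W (L + 1)" using K[of "- b" b] fc by (simp add: b_def)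
  then have 1: "(\<Otimes>s\<in>{- b..<b}. u s) \<in> W (L + 1)" using W_inv fc by (metis inv_inv)
  have 2: "(\<Otimes>s\<in>{L + 1..<b}. u s) \<in> W (L + 1)"
    by (rule finprod_in_subgroup[OF W_subgroup]) (use assms(3) W_mono_mem in auto)
  have "u L = (\<Otimes>s\<in>{- b..<b}. u s) \<otimes> inv (\<Otimes>s\<in>{L + 1..<b}. u s)"
    using eq fc uc by (simp add: m_assoc)
  then show ?thesis using W_mult[OF 1 W_inv[OF 2]] by simp
qed

end

section \<open>Expansions in adapted generators\<close>

text \<open>An index \<open>(p, n, k)\<close> stands for the \<open>k\<close>-th generator of order
  \<open>p^n\<close>, and the exponents \<open>g i * int (p^(n-1))\<close> produce the multiples of
  its socle element. \<open>y_order\<close> bounds the order from above; independence makes it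
  exact. In \<open>socle_span\<close> elements of height at least \<open>j\<close> use generators
  with \<open>j < n\<close> only.\<close>

locale adapted_cgroup = compact_filtered_cgroup G W
  for G :: "('a, 'b) cgroup_scheme" (structure) and W +
  fixes I :: "(nat \<times> nat \<times> nat) set" and y :: "nat \<times> nat \<times> nat \<Rightarrow> 'a"
  assumes finite_I: "finite I"
    and I_prime: "i \<in> I \<Longrightarrow> prime (fst i)" and I_height: "i \<in> I \<Longrightarrow> fst (snd i) \<ge> 1"
    and y_closed: "i \<in> I \<Longrightarrow> y i \<in> carrier G"
    and y_order: "i \<in> I \<Longrightarrow> y i [^] (fst i ^ fst (snd i)) = \<one>"
    and socle_W: "i \<in> I \<Longrightarrow> y i [^] (fst i ^ (fst (snd i) - 1)) \<in> W 0"
    and socle_independent: "\<lbrakk>prime p;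
          (\<Otimes>i\<in>{i \<in> I. fst i = p}. y i [^] (g i * int (fst i ^ (fst (snd i) - 1)))) \<in> W 1;
          i \<in> I; fst i = p\<rbrakk> \<Longrightarrow> int p dvd g i"
    and socle_span: "\<lbrakk>prime p; x \<in> W 0; x \<in> V p j\<rbrakk> \<Longrightarrow>
          \<exists>g::nat \<times> nat \<times> nat \<Rightarrow> int. x \<otimes> inv (\<Otimes>i\<in>{i \<in> I. fst i = p \<and> j < fst (snd i)}.
             y i [^] (g i * int (fst i ^ (fst (snd i) - 1)))) \<in> W 1"
begin

text \<open>Coefficients are arbitrary integers, so that adding expansions is coefficientwise. They
  count only modulo the orders of the generators, as \<open>digit_cong\<close> records.\<close>

definition digit :: "(nat \<times> nat \<times> nat \<Rightarrow> int) \<Rightarrow> 'a" where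
  "digit a = (\<Otimes>i\<in>I. y i [^] a i)"

text \<open>\<open>f i\<close> is the coefficient function of a Laurent series for the generator
  \<open>i\<close>, with \<alpha> in place of t. A relation is used because an arbitrary
  \<open>f\<close> may fail to converge.\<close>

definition conv :: "(nat \<times> nat \<times> nat \<Rightarrow> int \<Rightarrow> int) \<Rightarrow> 'a \<Rightarrow> bool" where
  "conv f x \<longleftrightarrow> bisums (\<lambda>s. gpow G s (digit (\<lambda>i. f i s))) x"

lemma digit_closed: "digit a \<in> carrier G"
  unfolding digit_def using y_closed by (auto intro: finprod_closed)

lemma digit_add: "digit (\<lambda>i. a i + b i) = digit a \<otimes> digit b"
proof -
  have "digit (\<lambda>i. a i + b i) = (\<Otimes>i\<in>I. y i [^] a i \<otimes> y i [^] b i)"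
    unfolding digit_def using y_closed by (intro finprod_cong) (auto simp: int_pow_mult simp_implies_def)
  then show ?thesis
    unfolding digit_def using y_closed by (simp add: finprod_multf Pi_def)
qed

lemma digit_nat_mult: "digit (\<lambda>i. int n * a i) = digit a [^] n"
proof (induction n)
  case 0
  show ?case by (simp add: digit_def)
next
  case (Suc n)
  have "digit (\<lambda>i. int (Suc n) * a i) = digit (\<lambda>i. int n * a i + a i)"
    by (simp add: algebra_simps)
  then show ?case using Suc by (simp add: digit_add)
qed

lemma y_pow_dvd:
  assumes "i \<in> I" "int (fst i ^ fst (snd i)) dvd a"
  shows "y i [^] a = \<one>"
proof -
  obtain t where "a = int (fst i ^ fst (snd i)) * t" using assms(2) by (elim dvdE)
  then have "y i [^] a = (y i [^] int (fst i ^ fst (snd i))) [^] t"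
    using int_pow_pow[OF y_closed[OF assms(1)]] by simp
  then show ?thesis using y_order[OF assms(1)] by (simp only: int_pow_int int_pow_one)
qed

lemma digit_cong:
  assumes "\<And>i. i \<in> I \<Longrightarrow> int (fst i ^ fst (snd i)) dvd a i - b i"
  shows "digit a = digit b"
  unfolding digit_def
proof (rule finprod_cong')
  show "(\<lambda>i. y i [^] b i) \<in> I \<rightarrow> carrier G" using y_closed by auto
  fix i assume "i \<in> I"
  then have "y i [^] (a i - b i) = \<one>" "y i \<in> carrier G"
    using assms y_pow_dvd y_closed by auto
  then show "y i [^] a i = y i [^] b i"
    using int_pow_mult[of "y i" "b i" "a i - b i"] by simp
qed simp

lemma digit_zero: "digit (\<lambda>i. 0) = \<one>"
  by (simp add: digit_def)

text \<open>Finitely many generators share one level, and so does the subgroup they generate. This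
  constant is the source of the discrepancy between the first nonzero coefficient of an expansion
  and the level of its value.\<close>

lemma digit_bound: "\<exists>c\<ge>0. \<forall>a. digit a \<in> W (- c)"
proof -
  have "\<forall>i\<in>I. \<exists>k. y i \<in> W k" using W_exhaust y_closed by blast
  then obtain k where k: "\<And>i. i \<in> I \<Longrightarrow> y i \<in> W (k i)" by metis
  define c where "c = Max (insert 0 ((\<lambda>i. - k i) ` I))"
  have "y i \<in> W (- c)" if "i \<in> I" for i
  proof (rule W_mono_mem[OF k[OF that]])
    have "- k i \<le> c" unfolding c_def using that finite_I by (intro Max_ge) auto
    then show "- c \<le> k i" by simp
  qed
  then have "digit a \<in> W (- c)" for a
    unfolding digit_def
    by (intro finprod_in_subgroup[OF W_subgroup] subgroup_int_pow_closed[OF W_subgroup])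
  moreover have "c \<ge> 0" using finite_I by (auto simp: c_def)
  ultimately show ?thesis by blast
qed

lemma conv_closed: "conv f x \<Longrightarrow> x \<in> carrier G"
  by (simp add: conv_def bisums_def)

lemma conv_unique: "conv f x \<Longrightarrow> conv f x' \<Longrightarrow> x = x'"
  unfolding conv_def by (rule bisums_unique)

lemma conv_cong:
  assumes "\<And>i s. i \<in> I \<Longrightarrow> int (fst i ^ fst (snd i)) dvd f i s - g i s" "conv f x"
  shows "conv g x"
proof -
  have "(\<lambda>s. gpow G s (digit (\<lambda>i. f i s))) = (\<lambda>s. gpow G s (digit (\<lambda>i. g i s)))"
    using digit_cong[OF assms(1)] by simp
  then show ?thesis using assms(2) by (simp add: conv_def)
qed

lemma conv_add: "conv f x \<Longrightarrow> conv g z \<Longrightarrow> conv (\<lambda>i s. f i s + g i s) (x \<otimes> z)"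
  unfolding conv_def using bisums_mult by (simp add: digit_add gpow_mult digit_closed)

lemma conv_nat_mult: "conv f x \<Longrightarrow> conv (\<lambda>i s. int n * f i s) (x [^] n)"
  unfolding conv_def using bisums_nat_pow[of _ x n]
  by (simp add: digit_nat_mult group_hom.hom_nat_pow[OF gpow_group_hom] digit_closed)

lemma conv_exists:
  assumes "\<And>i s. i \<in> I \<Longrightarrow> s < L \<Longrightarrow> f i s = 0"
  shows "\<exists>x. conv f x"
proof -
  obtain c where c: "\<And>a. digit a \<in> W (- c)" using digit_bound by blast
  have "gpow G s (digit (\<lambda>i. f i s)) = \<one>" if "s < L" for s
    using digit_cong[of "\<lambda>i. f i s" "\<lambda>i. 0"] assms that digit_zero gpow_one by simp
  moreover have "gpow G s (digit (\<lambda>i. f i s)) \<in> W (s - c)" for s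
    using gpow_W[OF c, of s] by (simp add: algebra_simps)
  ultimately show ?thesis unfolding conv_def by (intro bisums_exists[of L _ c])
qed

text \<open>Continuity of the passage from coefficients to elements, with a shift that is uniform in
  \<open>f\<close>.\<close>

lemma conv_small: "\<exists>c\<ge>0. \<forall>f x M. conv f x \<longrightarrow> (\<forall>i\<in>I. \<forall>s<M. f i s = 0) \<longrightarrow> x \<in> W (M - c)"
proof -
  obtain c where c: "c \<ge> 0" "\<And>a. digit a \<in> W (- c)" using digit_bound by blast
  have "x \<in> W (M - c)" if x: "conv f x" and M: "\<forall>i\<in>I. \<forall>s<M. f i s = 0" for f x M
  proof (rule bisums_small[OF x[unfolded conv_def]])
    fix s
    show "gpow G s (digit (\<lambda>i. f i s)) \<in> W (M - c)"
    proof (cases "s < M")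
      case True
      then show ?thesis
        using digit_cong[of "\<lambda>i. f i s" "\<lambda>i. 0"] M digit_zero gpow_one W_one by simp
    next
      case False
      then show ?thesis using W_mono_mem[OF gpow_W[OF c(2), of s], of "M - c"] by simp
    qed
  qed
  then show ?thesis using c(1) by blast
qed

lemma conv_gaut: "conv f x \<Longrightarrow> conv (\<lambda>i s. f i (s - 1)) (gaut G x)"
  unfolding conv_def using bisums_gaut[of "\<lambda>s. gpow G s (digit (\<lambda>i. f i s))" x]
  by (simp add: gaut_gpow digit_closed)

lemma modulus_Suc:
  assumes "i \<in> I"
  shows "fst i ^ fst (snd i) = fst i * fst i ^ (fst (snd i) - 1)"
  using I_height[OF assms] by (metis One_nat_def Suc_le_D diff_Suc_1 power_Suc)

text \<open>Multiplication by \<open>p\<close> kills a digit vector only if it lies in the \<open>p\<close>-socle, whose lowest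
  term is controlled by independence modulo \<open>W 1\<close>.\<close>

lemma conv_kernel_prime:
  assumes p: "prime p" and conv: "conv f \<one>" and low: "\<And>i s. i \<in> I \<Longrightarrow> s < L \<Longrightarrow> f i s = 0"
    and kill: "\<And>i s. i \<in> I \<Longrightarrow> int (fst i ^ fst (snd i)) dvd int p * f i s"
    and i: "i \<in> I"
  shows "int (fst i ^ fst (snd i)) dvd f i s"
proof -
  let ?b = "\<lambda>i. int (fst i ^ (fst (snd i) - 1))"
  let ?J = "{i \<in> I. fst i = p}"
  define u where "u s = gpow G s (digit (\<lambda>i. f i s))" for s
  have other: "int (fst i ^ fst (snd i)) dvd f i s" if "i \<in> I" "fst i \<noteq> p" for i s
  proof -
    have "coprime (int (fst i ^ fst (snd i))) (int p)"
      using primes_coprime[OF I_prime[OF that(1)] p that(2)] by (simp add: coprime_power_left_iff)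
    then show ?thesis using kill[OF that(1)] coprime_dvd_mult_right_iff by blast
  qed
  have same: "?b i dvd f i s" if "i \<in> I" "fst i = p" for i s
  proof -
    have "int p * ?b i dvd int p * f i s"
      using kill[OF that(1), of s] that(2) modulus_Suc[OF that(1)] by (metis of_nat_mult)
    then show ?thesis using prime_gt_0_nat[OF p] by simp
  qed
  \<comment> \<open>Generators for other primes contribute trivially, and for \<open>p\<close> the
    coefficients are multiples of \<open>p^(n-1)\<close>. Every digit is thus a combination of socle
    elements, which lie in \<open>W 0\<close>.\<close>
  have digit_eq: "digit (\<lambda>i. f i s) = (\<Otimes>i\<in>?J. y i [^] ((f i s div ?b i) * ?b i))" for s
    unfolding digit_def
    by (rule finprod_mono_neutral_cong_right)
      (use finite_I y_closed y_pow_dvd other same in \<open>auto simp del: of_nat_power\<close>)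
  have "digit (\<lambda>i. f i s) \<in> W 0" for s
    unfolding digit_eq
  proof (rule finprod_in_subgroup[OF W_subgroup])
    fix i assume i: "i \<in> ?J"
    have "y i [^] ((f i s div ?b i) * ?b i) = (y i [^] ?b i) [^] (f i s div ?b i)"
      using i y_closed by (simp add: int_pow_pow mult.commute)
    moreover have "y i [^] ?b i \<in> W 0" using i socle_W[of i] by (simp only: int_pow_int mem_Collect_eq)
    ultimately show "y i [^] ((f i s div ?b i) * ?b i) \<in> W 0"
      using subgroup_int_pow_closed[OF W_subgroup] by simp
  qed
  then have uW: "u s \<in> W s" for s
    using gpow_W[of "digit (\<lambda>i. f i s)" 0 s] by (simp add: u_def)
  \<comment> \<open>Induction on the distance from \<open>L\<close>: once all lower terms are
    trivial, the term at \<open>L + n\<close> is the lowest one and is pushed one level deeper by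
    \<open>bisums_lowest_term\<close>. Shifted back to position 0, its digit lies in
    \<open>W 1\<close>, where independence applies.\<close>
  have "\<forall>i\<in>I. int (fst i ^ fst (snd i)) dvd f i (L + int n)" for n
  proof (induction n rule: less_induct)
    case (less n)
    let ?s = "L + int n"
    have "u s = \<one>" if s: "s < ?s" for s
    proof -
      have "int (fst i ^ fst (snd i)) dvd f i s - 0" if "i \<in> I" for i
      proof (cases "s < L")
        case False
        then obtain k where "s = L + int k" using zle_iff_zadd[of L s] by auto
        then show ?thesis using less[of k] s that by auto
      qed (use low that in simp)
      then show ?thesis
        using digit_cong[of "\<lambda>i. f i s" "\<lambda>i. 0"] digit_zero gpow_one by (simp add: u_def)
    qed
    then have "u ?s \<in> W (?s + 1)"
      using bisums_lowest_term[of u ?s] conv uW unfolding conv_def u_def by blast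
    then have mem: "digit (\<lambda>i. f i ?s) \<in> W 1"
      using gpow_W_iff[OF digit_closed, of ?s "\<lambda>i. f i ?s" 1] by (simp add: u_def add.commute)
    show ?case
    proof
      fix i assume i: "i \<in> I"
      show "int (fst i ^ fst (snd i)) dvd f i ?s"
      proof (cases "fst i = p")
        case True
        have "int p dvd f i ?s div ?b i"
          using socle_independent[OF p, of "\<lambda>i. f i ?s div ?b i" i] mem i True
          unfolding digit_eq by simp
        then obtain t where "f i ?s div ?b i = int p * t" by (elim dvdE)
        then have "f i ?s = int p * t * ?b i"
          using same[OF i True, of ?s] by (metis dvd_div_mult_self)
        then have "f i ?s = int (fst i ^ fst (snd i)) * t"
          using modulus_Suc[OF i] True by simp
        then show ?thesis by simp
      qed (use other i in auto)
    qed
  qed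
  then show ?thesis
    using low[OF i, of s] i zle_iff_zadd[of L s] by (cases "s < L") auto
qed

text \<open>With \<open>n = p r\<close>, the coefficients \<open>r f\<close> are killed by
  \<open>p\<close> and still have value \<open>\<one>\<close>, so the prime case makes them trivial
  and the induction continues with the smaller \<open>r\<close>.\<close>

lemma conv_kernel_nat:
  assumes "n > 0" "conv f \<one>" "\<And>i s. i \<in> I \<Longrightarrow> s < L \<Longrightarrow> f i s = 0"
    "\<And>i s. i \<in> I \<Longrightarrow> int (fst i ^ fst (snd i)) dvd int n * f i s" "i \<in> I"
  shows "int (fst i ^ fst (snd i)) dvd f i s"
  using assms
proof (induction n arbitrary: i s rule: less_induct)
  case (less n)
  show ?case
  proof (cases "n = 1")
    case True
    then show ?thesis using less.prems(4)[OF less.prems(5), of s] by simp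
  next
    case False
    then obtain p where p: "prime p" "p dvd n" using prime_factor_nat by blast
    then obtain r where r: "n = p * r" by (elim dvdE)
    have "r > 0" "r < n" using r less.prems(1) prime_gt_1_nat[OF p(1)] by auto
    moreover have "int (fst i ^ fst (snd i)) dvd int r * f i s" if "i \<in> I" for i s
    proof (rule conv_kernel_prime[OF p(1), of "\<lambda>i s. int r * f i s" L])
      show "conv (\<lambda>i s. int r * f i s) \<one>"
        using conv_nat_mult[OF less.prems(2), of r] by simp
    qed (use less.prems that r in \<open>auto simp: mult.assoc\<close>)
    ultimately show ?thesis using less by blast
  qed
qed

text \<open>The product of all orders kills every coefficient, so it can serve as \<open>n\<close>.
  This is injectivity of the expansion on families bounded below.\<close>

lemma conv_kernel:
  assumes "conv f \<one>" "\<And>i s. i \<in> I \<Longrightarrow> s < L \<Longrightarrow> f i s = 0" "i \<in> I"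
  shows "int (fst i ^ fst (snd i)) dvd f i s"
proof (rule conv_kernel_nat[OF _ assms(1,2) _ assms(3)])
  let ?n = "\<Prod>i\<in>I. fst i ^ fst (snd i)"
  show "?n > 0" using I_prime prime_gt_0_nat by (intro prod_pos) auto
  fix i s assume "i \<in> I"
  then have "fst i ^ fst (snd i) dvd ?n" using finite_I by (intro dvd_prodI) auto
  then have "int (fst i ^ fst (snd i)) dvd int ?n" using int_dvd_int_iff by blast
  then show "int (fst i ^ fst (snd i)) dvd int ?n * f i s" by (rule dvd_mult2)
qed

text \<open>Successive approximation, as for p-adic digits: the residue of the remainder, shifted
  back to \<open>W 0\<close>, determines the next digit, and removing this digit moves the remainder
  one level deeper. The remainder never leaves \<open>V p a\<close>, so only generators with
  \<open>a < n\<close> occur and the expansion can later be divided by \<open>p^a\<close>.\<close>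

lemma socle_expansion:
  assumes p: "prime p" and x: "x \<in> V p a" "x \<in> W k"
  shows "\<exists>g. (\<forall>i s. s < k \<longrightarrow> g i s = 0) \<and>
    bisums (\<lambda>s. gpow G s (\<Otimes>i\<in>{i \<in> I. fst i = p \<and> a < fst (snd i)}.
      y i [^] (g i s * int (fst i ^ (fst (snd i) - 1))))) x"
proof -
  let ?b = "\<lambda>i. int (fst i ^ (fst (snd i) - 1))"
  let ?J = "{i \<in> I. fst i = p \<and> a < fst (snd i)}"
  define E where "E g = (\<Otimes>i\<in>?J. y i [^] (g i * ?b i))" for g :: "nat \<times> nat \<times> nat \<Rightarrow> int"
  have E_zero: "E (\<lambda>i. 0) = \<one>" by (simp add: E_def)
  have socle: "y i [^] (t * ?b i) \<in> W 0 \<inter> V p a" if i: "i \<in> ?J" for i t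
  proof -
    have eq: "y i [^] (t * ?b i) = (y i [^] (fst i ^ (fst (snd i) - 1))) [^] t"
      using i y_closed int_pow_pow[of "y i" "?b i" t] by (simp only: int_pow_int mult.commute) auto
    have "y i [^] (fst i ^ (fst (snd i) - 1)) \<in> V p a"
      unfolding V_def
    proof (intro CollectI conjI bexI)
      have "(y i [^] (fst i ^ (fst (snd i) - 1))) [^] p = y i [^] (fst i ^ fst (snd i))"
        using i y_closed modulus_Suc[of i] by (simp add: nat_pow_pow mult.commute)
      then show "(y i [^] (fst i ^ (fst (snd i) - 1))) [^] p = \<one>" using y_order[of i] i by simp
      have "fst i ^ (fst (snd i) - 1) = p ^ (fst (snd i) - 1 - a) * p ^ a"
        using i by (simp add: power_add[symmetric])
      then show "y i [^] (fst i ^ (fst (snd i) - 1)) = (y i [^] (p ^ (fst (snd i) - 1 - a))) [^] (p ^ a)"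
        using i y_closed by (simp add: nat_pow_pow)
    qed (use i y_closed in auto)
    moreover have "y i [^] (fst i ^ (fst (snd i) - 1)) \<in> W 0" using socle_W i by blast
    ultimately show ?thesis
      unfolding eq using subgroup_int_pow_closed[OF W_subgroup] subgroup_int_pow_closed[OF V_subgroup] by blast
  qed
  have E_W: "E g \<in> W 0" for g
    unfolding E_def using finprod_in_subgroup[OF W_subgroup, of ?J "\<lambda>i. y i [^] (g i * ?b i)" 0] socle by blast
  have E_V: "E g \<in> V p a" for g
    unfolding E_def using finprod_in_subgroup[OF V_subgroup, of ?J "\<lambda>i. y i [^] (g i * ?b i)" p a] socle by blast
  have "\<forall>z\<in>W 0 \<inter> V p a. \<exists>g. z \<otimes> inv (E g) \<in> W 1"
    using socle_span[OF p] unfolding E_def by blast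
  \<comment> \<open>\<open>\<gamma>\<close> fixes one digit vector for every element of
    \<open>W 0\<close> in \<open>V p a\<close>.\<close>
  then obtain \<gamma> where \<gamma>: "\<And>z. z \<in> W 0 \<Longrightarrow> z \<in> V p a \<Longrightarrow> z \<otimes> inv (E (\<gamma> z)) \<in> W 1"
    by (metis IntI)
  \<comment> \<open>\<open>X n\<close> is the remainder after \<open>n\<close> digits; it lives at
    level \<open>k + n\<close>, so it is shifted by \<open>- (k + n)\<close> before the next digit
    is read off.\<close>
  define X where "X = rec_nat x (\<lambda>n z. z \<otimes> inv (gpow G (k + int n) (E (\<gamma> (gpow G (- (k + int n)) z)))))"
  have X0: "X 0 = x" and XS: "X (Suc n) = X n \<otimes> inv (gpow G (k + int n) (E (\<gamma> (gpow G (- (k + int n)) (X n)))))" for n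
    by (simp_all add: X_def)
  have X: "X n \<in> W (k + int n) \<inter> V p a" for n
  proof (induction n)
    case 0
    then show ?case using X0 x by simp
  next
    case (Suc n)
    let ?z = "gpow G (- (k + int n)) (X n)"
    have xc: "X n \<in> carrier G" using Suc W_carrier by auto
    have z: "?z \<in> W 0" "?z \<in> V p a"
      using gpow_W[of "X n" "k + int n" "- (k + int n)"] gpow_V Suc by auto
    have "?z \<otimes> inv (E (\<gamma> ?z)) \<in> W 1" using \<gamma> z by blast
    then have "gpow G (k + int n) (?z \<otimes> inv (E (\<gamma> ?z))) \<in> W (1 + (k + int n))"
      by (rule gpow_W)
    moreover have "gpow G (k + int n) (?z \<otimes> inv (E (\<gamma> ?z))) = X (Suc n)"
    proof -
      have "E (\<gamma> ?z) \<in> carrier G" using E_W W_carrier by blast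
      then show ?thesis
        using gpow_mult[of ?z "inv (E (\<gamma> ?z))" "k + int n"] gpow_inv[of "E (\<gamma> ?z)" "k + int n"]
          gpow_cancel[OF xc, of "k + int n"] gpow_closed[OF xc] XS[of n]
        by (simp del: minus_add_distrib)
    qed
    moreover have "X (Suc n) \<in> V p a"
      unfolding XS using Suc E_V gpow_V V_subgroup
      by (meson IntD2 subgroup.m_closed subgroup.m_inv_closed)
    ultimately show ?case by (simp add: algebra_simps)
  qed
  define g where "g i s = (if s < k then 0 else \<gamma> (gpow G (- s) (X (nat (s - k)))) i)" for i s
  define u where "u s = gpow G s (E (\<lambda>i. g i s))" for s
  have uc: "u s \<in> carrier G" for s unfolding u_def using E_W W_carrier gpow_closed by blast
  have ulow: "u s = \<one>" if "s < k" for s using that by (simp add: u_def g_def E_zero gpow_one)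
  have Xc: "X n \<in> carrier G" for n using X W_carrier by blast
  have un: "X (Suc n) = X n \<otimes> inv (u (k + int n))" for n
    using XS[of n] by (simp add: u_def g_def)
  have fc: "(\<Otimes>s\<in>A. u s) \<in> carrier G" for A using uc by (auto intro: finprod_closed)
  have prod: "x = (\<Otimes>s\<in>{k..<k + int n}. u s) \<otimes> X n" for n
  proof (induction n)
    case 0
    then show ?case using X0 x W_carrier by simp
  next
    case (Suc n)
    have "{k + int n..<k + int (Suc n)} = {k + int n}" by auto
    then have "(\<Otimes>s\<in>{k..<k + int (Suc n)}. u s) = (\<Otimes>s\<in>{k..<k + int n}. u s) \<otimes> u (k + int n)"
      using finprod_interval_split[of u k "k + int n" "k + int (Suc n)"] uc by simp
    moreover have "u (k + int n) \<otimes> X (Suc n) = X n"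
      unfolding un using uc Xc by (metis inv_closed inv_solve_right m_closed m_comm)
    ultimately show ?case using Suc fc uc Xc by (simp add: m_assoc)
  qed
  have "bisums u x"
    unfolding bisums_def
  proof (intro conjI allI)
    show "x \<in> carrier G" using x W_carrier by blast
    fix N
    have "inv (\<Otimes>s\<in>{a..<b}. u s) \<otimes> x \<in> W N" if ab: "a \<le> - (\<bar>k\<bar> + \<bar>N\<bar>)" "\<bar>k\<bar> + \<bar>N\<bar> \<le> b" for a b
    proof -
      have "(\<Otimes>s\<in>{a..<b}. u s) = (\<Otimes>s\<in>{k..<b}. u s)"
        using finprod_interval_lower[of u k a b] uc ulow ab by auto
      moreover have "x = (\<Otimes>s\<in>{k..<b}. u s) \<otimes> X (nat (b - k))"
        using prod[of "nat (b - k)"] ab by simp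
      ultimately have "inv (\<Otimes>s\<in>{a..<b}. u s) \<otimes> x = X (nat (b - k))"
        using fc Xc by (metis inv_closed l_inv l_one m_assoc)
      moreover have "N \<le> k + int (nat (b - k))" using ab by linarith
      ultimately show ?thesis using W_mono_mem X by (metis IntD1)
    qed
    then show "\<exists>K. \<forall>a b. a \<le> - K \<longrightarrow> K \<le> b \<longrightarrow> inv (\<Otimes>s\<in>{a..<b}. u s) \<otimes> x \<in> W N" by blast
  qed (rule uc)
  then show ?thesis
    unfolding u_def E_def by (intro exI[of _ g]) (simp add: g_def)
qed

text \<open>Removing one prime from the exponent: the element \<open>x [^] N'\<close> of order \<open>p\<close> is expanded in the
  socle and divided by \<open>N'\<close> digit by digit.\<close>

lemma conv_surj:
  assumes "N > 0"
  shows "\<exists>d\<ge>0. \<forall>k x. x \<in> W k \<longrightarrow> x [^] (N::nat) = \<one> \<longrightarrow>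
           (\<exists>f. (\<forall>i s. s < k - d \<longrightarrow> f i s = 0) \<and> conv f x)"
  using assms
proof (induction N rule: less_induct)
  case (less N)
  show ?case
  proof (cases "N = 1")
    case True
    have "conv (\<lambda>i s. 0) \<one>"
      unfolding conv_def by (simp add: digit_zero gpow_one bisums_one)
    then show ?thesis using True W_carrier by (intro exI[of _ 0]) (auto intro!: exI[of _ "\<lambda>i s. 0"])
  next
    case False
    then obtain p where p: "prime p" "p dvd N" using prime_factor_nat by blast
    then obtain N' where N': "N = p * N'" by (elim dvdE)
    have pos: "N' > 0" "N' < N" using N' less.prems prime_gt_1_nat[OF p(1)] by auto
    obtain d where d0: "d \<ge> 0" and d: "\<And>k x. x \<in> W k \<Longrightarrow> x [^] N' = \<one> \<Longrightarrow>
        \<exists>f. (\<forall>i s. s < k - d \<longrightarrow> f i s = 0) \<and> conv f x"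
      using less.IH[OF pos(2,1)] by blast
    obtain c where c: "c \<ge> 0" "\<And>f x M. conv f x \<Longrightarrow> (\<forall>i\<in>I. \<forall>s<M. f i s = 0) \<Longrightarrow> x \<in> W (M - c)"
      using conv_small by blast
    obtain a r where ar: "N' = p ^ a * r" "\<not> p dvd r"
      using multiplicity_decompose'[of N' p] pos p(1) by (metis not_prime_unit neq0_conv)
    have "coprime r p" using ar(2) p(1) by (metis coprime_commute prime_imp_coprime)
    then obtain r' where r': "[r * r' = 1] (mod p)" using cong_solve_coprime_nat by (metis One_nat_def)
    have "\<exists>f. (\<forall>i s. s < k - (c + d) \<longrightarrow> f i s = 0) \<and> conv f x" if x: "x \<in> W k" "x [^] N = \<one>" for k x
    proof -
      have xc: "x \<in> carrier G" using x W_carrier by blast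
      \<comment> \<open>With \<open>N' = p^a r\<close> and \<open>r r'\<close> congruent to 1 modulo
        \<open>p\<close>, the element \<open>z\<close> is a \<open>p^a\<close>-th power of order
        dividing \<open>p\<close>, and its \<open>r\<close>-th power is \<open>x [^] N'\<close>. The
        factor \<open>r'\<close> absorbs the part of \<open>N'\<close> prime to \<open>p\<close>, so
        only division by \<open>p^a\<close> remains.\<close>
      define z where "z = x [^] (N' * r')"
      have zV: "z \<in> V p a"
        unfolding V_def
      proof (intro CollectI conjI bexI)
        show "z [^] p = \<one>"
        proof -
          have "z [^] p = (x [^] N) [^] r'" using xc by (simp add: z_def nat_pow_pow N' mult_ac)
          then show ?thesis using x by simp
        qed
        show "z = (x [^] (r * r')) [^] (p ^ a)" using xc by (simp add: z_def nat_pow_pow ar mult_ac)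
      qed (use xc in \<open>auto simp: z_def\<close>)
      have pow_W: "w [^] n \<in> W j" if "w \<in> W j" for w j and n :: nat
        using subgroup_int_pow_closed[OF W_subgroup that, of "int n"] by (simp add: int_pow_int)
      have zW: "z \<in> W k" unfolding z_def using pow_W x by blast
      have zr: "z [^] r = x [^] N'"
      proof -
        have zp: "x [^] (N' * p) = \<one>" using x N' by (simp add: mult.commute)
        have zr: "z [^] r = (x [^] N') [^] (r * r')" using xc by (simp add: z_def nat_pow_pow mult_ac)
        define t where "t = r * r' div p"
        have t: "r * r' = 1 + p * t"
          using r' prime_gt_1_nat[OF p(1)] mult_div_mod_eq[of p "r * r'"] by (simp add: cong_def t_def)
        have "(x [^] N') [^] (r * r') = (x [^] N') [^] (1::nat) \<otimes> (x [^] N') [^] (p * t)"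
          unfolding t using xc by (simp only: nat_pow_mult nat_pow_closed)
        also have "(x [^] N') [^] (p * t) = (x [^] (N' * p)) [^] t"
          using xc by (simp add: nat_pow_pow mult.assoc)
        also have "\<dots> = \<one>" using zp by simp
        finally show ?thesis using zr xc by simp
      qed
      obtain g where g: "\<And>i s. s < k \<Longrightarrow> g i s = 0"
        and gz: "bisums (\<lambda>s. gpow G s (\<Otimes>i\<in>{i \<in> I. fst i = p \<and> a < fst (snd i)}.
            y i [^] (g i s * int (fst i ^ (fst (snd i) - 1))))) z"
        using socle_expansion[OF p(1) zV zW] by blast
      \<comment> \<open>The socle coefficients divided by \<open>p^a\<close>: the factor
        \<open>p^(n-1)\<close> becomes \<open>p^(n-1-a)\<close>, which is possible because
        \<open>a < n\<close>.\<close>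
      define f0 where "f0 i s = (if fst i = p \<and> a < fst (snd i)
          then g i s * int (p ^ (fst (snd i) - 1 - a)) else 0)" for i s
      have f0_low: "f0 i s = 0" if "s < k" for i s using g that by (simp add: f0_def)
      obtain w where w: "conv f0 w" using conv_exists[of k f0] f0_low by blast
      have wW: "w \<in> W (k - c)" using c(2)[OF w, of k] f0_low by blast
      have wc: "w \<in> carrier G" using w conv_closed by blast
      have "digit (\<lambda>i. int (p ^ a) * f0 i s) = (\<Otimes>i\<in>{i \<in> I. fst i = p \<and> a < fst (snd i)}.
            y i [^] (g i s * int (fst i ^ (fst (snd i) - 1))))" for s
        unfolding digit_def
      proof (rule finprod_mono_neutral_cong_right)
        fix i assume i: "i \<in> {i \<in> I. fst i = p \<and> a < fst (snd i)}"
        have "p ^ a * p ^ (fst (snd i) - 1 - a) = p ^ (fst (snd i) - 1)"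
          using i by (simp add: power_add[symmetric])
        then have "int (p ^ a) * f0 i s = g i s * int (p ^ (fst (snd i) - 1))"
          using i by (simp add: f0_def) (metis (no_types, opaque_lifting) mult.left_commute of_nat_mult of_nat_power)
        then show "y i [^] (int (p ^ a) * f0 i s) = y i [^] (g i s * int (fst i ^ (fst (snd i) - 1)))"
          using i by simp
      qed (use finite_I y_closed in \<open>auto simp: f0_def\<close>)
      then have "conv (\<lambda>i s. int (p ^ a) * f0 i s) z" using gz by (simp add: conv_def)
      then have wz: "w [^] (p ^ a) = z" using conv_nat_mult[OF w] conv_unique by blast
      have "w [^] N' = x [^] N'"
        using wz zr wc by (metis ar(1) nat_pow_pow)
      \<comment> \<open>The quotient of \<open>x\<close> by the root \<open>w\<close> is covered by
        the induction hypothesis for \<open>N'\<close>. Passing to \<open>w\<close> costs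
        \<open>c\<close> levels and the hypothesis costs \<open>d\<close>, whence the shift
        \<open>c + d\<close>.\<close>
      then have "(x \<otimes> inv w) [^] N' = \<one>"
        using xc wc by (simp add: nat_pow_distrib nat_pow_inv)
      moreover have "x \<otimes> inv w \<in> W (k - c)"
        using W_mult[OF W_mono_mem[OF x(1)] W_inv[OF wW]] c(1) by simp
      ultimately obtain f1 where f1: "\<And>i s. s < k - c - d \<Longrightarrow> f1 i s = 0" "conv f1 (x \<otimes> inv w)"
        using d by blast
      have "conv (\<lambda>i s. f1 i s + f0 i s) x"
        using conv_add[OF f1(2) w] xc wc by (simp add: m_assoc)
      moreover have "f1 i s + f0 i s = 0" if "s < k - (c + d)" for i s
        using f1(1) f0_low that c(1) d0 by simp
      ultimately show ?thesis by (intro exI[of _ "\<lambda>i s. f1 i s + f0 i s"]) simp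
    qed
    then show ?thesis using c(1) d0 by (intro exI[of _ "c + d"]) simp
  qed
qed

end

section \<open>Multiplicities and generators of a given group\<close>

definition std_index :: "(nat \<times> nat \<Rightarrow> nat) \<Rightarrow> (nat \<times> nat \<times> nat) set" where
  "std_index \<nu> = {(p, n, k). prime p \<and> n \<ge> 1 \<and> k < \<nu> (p, n)}"

lemma finite_std_index:
  assumes "\<nu> \<in> finsupp_families"
  shows "finite (std_index \<nu>)"
proof -
  have "std_index \<nu> \<subseteq> (\<lambda>((p, n), k). (p, n, k)) ` (SIGMA i:{i. \<nu> i \<noteq> 0}. {..<\<nu> i})"
  proof
    fix x assume "x \<in> std_index \<nu>"
    then obtain p n k where "x = (p, n, k)" "k < \<nu> (p, n)" by (auto simp: std_index_def)
    then show "x \<in> (\<lambda>((p, n), k). (p, n, k)) ` (SIGMA i:{i. \<nu> i \<noteq> 0}. {..<\<nu> i})"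
      by (intro image_eqI[of _ _ "((p, n), k)"]) auto
  qed
  moreover have "finite (SIGMA i:{i. \<nu> i \<noteq> 0}. {..<\<nu> i})"
    using assms by (intro finite_SigmaI) (auto simp: finsupp_families_def)
  ultimately show ?thesis by (rule finite_subset[OF _ finite_imageI])
qed

context compact_filtered_cgroup
begin

lemma residually_independent_not_W1:
  assumes "prime p" "residually_independent p B" "b \<in> B"
  shows "b \<notin> W 1"
proof
  assume b: "b \<in> W 1"
  let ?g = "\<lambda>x. if x = b then 1 else 0 :: int"
  have B: "finite B" "B \<subseteq> carrier G"
    using assms(2) W_carrier by (auto simp: residually_independent_def)
  have "(\<Otimes>x\<in>B. x [^] ?g x) = (\<Otimes>x\<in>{b}. x [^] ?g x)"
    by (rule finprod_mono_neutral_cong_right) (use B assms(3) in auto)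
  then have "int p dvd ?g b"
    using residually_independentD[OF assms(2), of ?g b] assms(3) b W_carrier[OF b] by simp
  then show False using assms(1) by simp
qed

text \<open>\<open>n\<close> is one more than the height of \<open>b\<close>: a
  \<open>p^(n-1)\<close>-th root of \<open>b\<close> exists, and it has order
  \<open>p^n\<close>.\<close>

lemma V_height:
  assumes p: "prime p" and b: "b \<in> V p 0" "b \<noteq> \<one>"
  shows "\<exists>n\<ge>1. \<forall>i. b \<in> V p i \<longleftrightarrow> i < n"
proof -
  obtain J where "V p J = {\<one>}" using V_trivial[OF p] by blast
  then have J: "b \<notin> V p J" using b by simp
  define n where "n = (LEAST n. b \<notin> V p n)"
  have n: "b \<notin> V p n" unfolding n_def by (rule LeastI[of _ J]) (rule J)
  have "b \<in> V p i \<longleftrightarrow> i < n" for i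
    using V_antimono[of n i p] n not_less_Least[of i "\<lambda>n. b \<notin> V p n"] unfolding n_def[symmetric]
    by (metis linorder_not_less subsetD)
  moreover have "n \<ge> 1" using calculation[of 0] b by auto
  ultimately show ?thesis by blast
qed

theorem adapted_generators: "\<exists>\<nu>\<in>finsupp_families. \<exists>y. adapted_cgroup G W (std_index \<nu>) y"
proof -
  obtain m :: nat where m: "m > 0" "\<And>x. x \<in> carrier G \<Longrightarrow> x [^] m = \<one>"
    using bounded_exponent by blast
  have "\<forall>p. \<exists>B. prime p \<longrightarrow> residually_independent p B \<and>
    (\<forall>i. \<forall>x\<in>W 0 \<inter> V p i. \<exists>g::'a \<Rightarrow> int. x \<otimes> inv (\<Otimes>b\<in>B \<inter> V p i. b [^] g b) \<in> W 1)"
    using adapted_basis by blast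
  from choice[OF this] obtain B where B: "\<And>p. prime p \<Longrightarrow> residually_independent p (B p)"
    and span: "\<And>p i x. prime p \<Longrightarrow> x \<in> W 0 \<inter> V p i \<Longrightarrow>
       \<exists>g::'a \<Rightarrow> int. x \<otimes> inv (\<Otimes>b\<in>B p \<inter> V p i. b [^] g b) \<in> W 1"
    by blast
  have finB: "finite (B p)" and BW: "B p \<subseteq> W 0" and BV: "B p \<subseteq> V p 0" if "prime p" for p
    using B[OF that] by (auto simp: residually_independent_def)
  have Bone: "b \<noteq> \<one>" if "prime p" "b \<in> B p" for p b
    using residually_independent_not_W1[OF that(1) B[OF that(1)] that(2)] W_one by auto
  have "\<forall>p b. \<exists>n. prime p \<and> b \<in> B p \<longrightarrow> n \<ge> 1 \<and> (\<forall>i. b \<in> V p i \<longleftrightarrow> i < n)"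
    using V_height Bone BV by blast
  then obtain lev where lev: "\<And>p b. prime p \<Longrightarrow> b \<in> B p \<Longrightarrow> lev p b \<ge> (1::nat)"
    and lev_V: "\<And>p b i. prime p \<Longrightarrow> b \<in> B p \<Longrightarrow> b \<in> V p i \<longleftrightarrow> i < lev p b"
    by metis
  \<comment> \<open>The basis elements of height exactly \<open>n - 1\<close>. Their number is the
    multiplicity \<open>\<nu> (p, n)\<close>, and the bijections \<open>e\<close> turn them into
    indexed copies.\<close>
  define C where "C p n = {b \<in> B p. lev p b = n}" for p n
  define \<nu> where "\<nu> = (\<lambda>(p, n). if prime p \<and> n \<ge> 1 then card (C p n) else 0)"
  have "\<forall>p n. \<exists>e. prime p \<longrightarrow> bij_betw e {0..<card (C p n)} (C p n)"
    using ex_bij_betw_nat_finite[of "C _ _"] finB unfolding C_def by auto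
  then obtain e where e: "\<And>p n. prime p \<Longrightarrow> bij_betw (e p n) {0..<card (C p n)} (C p n)"
    by metis
  define b where "b = (\<lambda>(p, n, k). e p n k)"
  let ?I = "std_index \<nu>"
  have b_mem: "b i \<in> C (fst i) (fst (snd i))" if "i \<in> ?I" for i
  proof -
    obtain p n k where i: "i = (p, n, k)" by (cases i)
    then have k: "prime p" "k < card (C p n)"
      using that by (auto simp: std_index_def \<nu>_def split: if_splits)
    then have "e p n k \<in> C p n" using bij_betw_apply[OF e[OF k(1), of n], of k] by simp
    then show ?thesis by (simp add: i b_def)
  qed
  have I_pr: "prime (fst i)" "fst (snd i) \<ge> 1" if "i \<in> ?I" for i
    using that by (auto simp: std_index_def)
  have b_props: "b i \<in> B (fst i)" "lev (fst i) (b i) = fst (snd i)" if "i \<in> ?I" for i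
    using b_mem[OF that] by (auto simp: C_def)
  have b_inj: "inj_on b {i \<in> ?I. fst i = p}" for p
  proof (rule inj_onI)
    fix i j assume ij: "i \<in> {i \<in> ?I. fst i = p}" "j \<in> {i \<in> ?I. fst i = p}" "b i = b j"
    then have "fst (snd i) = fst (snd j)" using b_props by (metis (mono_tags, lifting) mem_Collect_eq)
    then obtain n k l where i: "i = (p, n, k)" and j: "j = (p, n, l)"
      using ij by (metis (mono_tags, lifting) mem_Collect_eq prod.collapse)
    have "k < card (C p n)" "l < card (C p n)" "prime p" "e p n k = e p n l"
      using ij unfolding i j by (auto simp: std_index_def \<nu>_def b_def split: if_splits)
    then have "k = l" using e[of p n] by (auto simp: bij_betw_def inj_on_def)
    then show "i = j" using i j by simp
  qed
  have b_image: "b ` {i \<in> ?I. fst i = p \<and> j < fst (snd i)} = B p \<inter> V p j" if p: "prime p" for p j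
  proof (intro subset_antisym subsetI)
    fix x assume "x \<in> b ` {i \<in> ?I. fst i = p \<and> j < fst (snd i)}"
    then obtain i where i: "i \<in> ?I" "fst i = p" "j < fst (snd i)" "x = b i" by auto
    then show "x \<in> B p \<inter> V p j" using b_props[OF i(1)] lev_V[OF p] by auto
  next
    fix x assume x: "x \<in> B p \<inter> V p j"
    then have "x \<in> e p (lev p x) ` {0..<card (C p (lev p x))}"
      using bij_betw_imp_surj_on[OF e[OF p, of "lev p x"]] by (simp add: C_def)
    then obtain k where k: "k < card (C p (lev p x))" "x = e p (lev p x) k" by auto
    have "(p, lev p x, k) \<in> ?I" "j < lev p x"
      using k p lev[OF p] lev_V[OF p] x by (auto simp: std_index_def \<nu>_def)
    then show "x \<in> b ` {i \<in> ?I. fst i = p \<and> j < fst (snd i)}"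
      using k(2) by (intro image_eqI[of _ _ "(p, lev p x, k)"]) (auto simp: b_def)
  qed
  have "\<forall>i. \<exists>u. i \<in> ?I \<longrightarrow> u \<in> carrier G \<and> b i = u [^] (fst i ^ (fst (snd i) - 1))"
  proof (intro allI)
    fix i
    show "\<exists>u. i \<in> ?I \<longrightarrow> u \<in> carrier G \<and> b i = u [^] (fst i ^ (fst (snd i) - 1))"
    proof (cases "i \<in> ?I")
      case True
      then have "b i \<in> V (fst i) (fst (snd i) - 1)"
        using lev_V[OF I_pr(1)[OF True] b_props(1)[OF True]] b_props(2)[OF True] I_pr(2)[OF True] by simp
      then show ?thesis unfolding V_def by blast
    qed simp
  qed
  from choice[OF this] obtain y where y: "\<And>i. i \<in> ?I \<Longrightarrow> y i \<in> carrier G"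
    "\<And>i. i \<in> ?I \<Longrightarrow> b i = y i [^] (fst i ^ (fst (snd i) - 1))" by blast
  have bV: "b i \<in> V (fst i) 0" "b i \<in> W 0" if "i \<in> ?I" for i
    using b_props(1)[OF that] BV[OF I_pr(1)[OF that]] BW[OF I_pr(1)[OF that]] by auto
  have fam: "\<nu> \<in> finsupp_families"
    unfolding finsupp_families_def
  proof (intro CollectI conjI)
    show "{i. \<nu> i \<noteq> 0} \<subseteq> {p. prime p} \<times> {1..}" by (auto simp: \<nu>_def split: if_splits)
    \<comment> \<open>Only primes dividing the exponent \<open>m\<close> carry nontrivial
      \<open>p\<close>-torsion, and for each of them only the finitely many levels of the elements
      of \<open>B p\<close> occur.\<close>
    have "{i. \<nu> i \<noteq> 0} \<subseteq> (SIGMA p:{p. prime p \<and> p dvd m}. lev p ` B p)"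
    proof
      fix i assume "i \<in> {i. \<nu> i \<noteq> 0}"
      then obtain p n where i: "i = (p, n)" "prime p" "card (C p n) \<noteq> 0"
        by (cases i) (auto simp: \<nu>_def split: if_splits)
      then obtain x where x: "x \<in> B p" "lev p x = n"
        unfolding C_def by (metis (mono_tags, lifting) card.empty empty_Collect_eq)
      have "p dvd m"
      proof (rule ccontr)
        assume "\<not> p dvd m"
        then have "coprime p m" using i(2) prime_imp_coprime by blast
        moreover have "x \<in> carrier G" "x [^] p = \<one>" using x BV[OF i(2)] by (auto simp: V_def)
        ultimately have "x = \<one>" using nat_pow_coprime_eq_one m(2) by blast
        then show False using Bone[OF i(2) x(1)] by simp
      qed
      then show "i \<in> (SIGMA p:{p. prime p \<and> p dvd m}. lev p ` B p)" using i x by auto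
    qed
    moreover have "finite {p. prime p \<and> p dvd m}"
      using finite_divisors_nat[OF m(1)] by (rule rev_finite_subset) auto
    then have "finite (SIGMA p:{p. prime p \<and> p dvd m}. lev p ` B p)"
      using finB by (intro finite_SigmaI) auto
    ultimately show "finite {i. \<nu> i \<noteq> 0}" by (rule finite_subset)
  qed
  have y_b: "y i [^] (t * int (fst i ^ (fst (snd i) - 1))) = b i [^] t" if "i \<in> ?I" for i and t :: int
    using int_pow_pow[OF y(1)[OF that], of "int (fst i ^ (fst (snd i) - 1))" t] y(2)[OF that]
    by (simp only: int_pow_int mult.commute)
  have bc: "b i \<in> carrier G" if "i \<in> ?I" for i using bV(2)[OF that] W_carrier by blast
  have "adapted_cgroup G W ?I y"
  proof (intro adapted_cgroup.intro adapted_cgroup_axioms.intro)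
    show "compact_filtered_cgroup G W" by (rule compact_filtered_cgroup_axioms)
    show "finite ?I" using finite_std_index[OF fam] .
    fix i assume i: "i \<in> ?I"
    show "prime (fst i)" "fst (snd i) \<ge> 1" "y i \<in> carrier G" using I_pr i y by auto
    show "y i [^] (fst i ^ (fst (snd i) - 1)) \<in> W 0" using y(2) bV i by metis
    have "fst i ^ fst (snd i) = fst i ^ (fst (snd i) - 1) * fst i"
      using I_pr(2)[OF i] by (metis One_nat_def Suc_le_D diff_Suc_1 mult.commute power_Suc)
    then have "y i [^] (fst i ^ fst (snd i)) = b i [^] fst i"
      using y[OF i] by (simp add: nat_pow_pow)
    then show "y i [^] (fst i ^ fst (snd i)) = \<one>" using bV(1)[OF i] by (simp add: V_def)
  next
    fix p i and g :: "nat \<times> nat \<times> nat \<Rightarrow> int"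
    assume p: "prime p" and i: "i \<in> ?I" "fst i = p"
      and mem: "(\<Otimes>i\<in>{i \<in> ?I. fst i = p}. y i [^] (g i * int (fst i ^ (fst (snd i) - 1)))) \<in> W 1"
    let ?J = "{i \<in> ?I. fst i = p}"
    \<comment> \<open>Coefficients on indices become coefficients on basis elements;
      \<open>b\<close> is injective on the indices of one prime, so nothing is identified.\<close>
    let ?g = "\<lambda>x. g (inv_into ?J b x)"
    have "0 < fst (snd i)" if "i \<in> ?I" for i using I_pr(2)[OF that] by simp
    then have J: "?J = {i \<in> ?I. fst i = p \<and> 0 < fst (snd i)}" by blast
    then have im: "b ` ?J = B p" using b_image[OF p, of 0] BV[OF p] by auto
    have "(\<Otimes>x\<in>b ` ?J. x [^] ?g x) = (\<Otimes>i\<in>?J. b i [^] ?g (b i))"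
      by (rule finprod_reindex[OF _ b_inj]) (use bc in auto)
    also have "\<dots> = (\<Otimes>i\<in>?J. y i [^] (g i * int (fst i ^ (fst (snd i) - 1))))"
    proof (rule finprod_cong')
      fix i assume "i \<in> ?J"
      then show "b i [^] ?g (b i) = y i [^] (g i * int (fst i ^ (fst (snd i) - 1)))"
        using inv_into_f_f[OF b_inj, of i p] y_b[of i "g i"] by simp
    qed (use y in auto)
    finally have "(\<Otimes>x\<in>B p. x [^] ?g x) \<in> W 1" using mem im by simp
    then have "int p dvd ?g (b i)"
      using residually_independentD[OF B[OF p], of ?g "b i"] im i by blast
    then show "int p dvd g i" using inv_into_f_f[OF b_inj, of i p] i by simp
  next
    fix p x j assume p: "prime p" and x: "x \<in> W 0" "x \<in> V p j"
    let ?J = "{i \<in> ?I. fst i = p \<and> j < fst (snd i)}"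
    obtain g :: "'a \<Rightarrow> int" where g: "x \<otimes> inv (\<Otimes>b\<in>B p \<inter> V p j. b [^] g b) \<in> W 1"
      using span[OF p, of x j] x by blast
    have inj: "inj_on b ?J" using b_inj[of p] by (rule inj_on_subset) auto
    have "(\<Otimes>x\<in>b ` ?J. x [^] g x) = (\<Otimes>i\<in>?J. b i [^] g (b i))"
      by (rule finprod_reindex[OF _ inj]) (use bc in auto)
    also have "\<dots> = (\<Otimes>i\<in>?J. y i [^] (g (b i) * int (fst i ^ (fst (snd i) - 1))))"
      by (rule finprod_cong') (use y y_b in \<open>auto simp del: of_nat_power\<close>)
    finally show "\<exists>g::nat \<times> nat \<times> nat \<Rightarrow> int. x \<otimes> inv (\<Otimes>i\<in>?J.
             y i [^] (g i * int (fst i ^ (fst (snd i) - 1)))) \<in> W 1"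
      using g unfolding b_image[OF p] by (intro exI[of _ "\<lambda>i. g (b i)"]) simp
  qed
  then show ?thesis using fam by blast
qed

end

section \<open>The standard groups\<close>

lemma mem_laurent_carrier_iff:
  "m > 0 \<Longrightarrow> x \<in> laurent_carrier m \<longleftrightarrow> (\<forall>s. 0 \<le> x s \<and> x s < int m) \<and> (\<exists>N. \<forall>s<N. x s = 0)"
  by (auto simp: laurent_carrier_def carrier_integer_mod_group)

lemma laurent_carrier_add:
  assumes "m > 0" "x \<in> laurent_carrier m" "y \<in> laurent_carrier m"
  shows "(\<lambda>s. (x s + y s) mod int m) \<in> laurent_carrier m"
proof -
  obtain M N where "\<forall>s<M. x s = 0" "\<forall>s<N. y s = 0"
    using assms by (auto simp: mem_laurent_carrier_iff)
  then have "\<forall>s<min M N. (x s + y s) mod int m = 0" by simp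
  then have "\<exists>N. \<forall>s<N. (x s + y s) mod int m = 0" by blast
  then show ?thesis using assms(1) unfolding mem_laurent_carrier_iff[OF assms(1)] by simp
qed

lemma laurent_carrier_uminus:
  assumes "m > 0" "x \<in> laurent_carrier m"
  shows "(\<lambda>s. (- x s) mod int m) \<in> laurent_carrier m"
proof -
  obtain M where "\<forall>s<M. x s = 0" using assms by (auto simp: mem_laurent_carrier_iff)
  then have "\<forall>s<M. (- x s) mod int m = 0" by simp
  then show ?thesis using assms(1) unfolding mem_laurent_carrier_iff[OF assms(1)] by auto
qed

lemma laurent_carrier_shift:
  assumes "x \<in> laurent_carrier m"
  shows "(\<lambda>s. x (s + d)) \<in> laurent_carrier m"
proof -
  obtain N where "\<forall>s<N. x s = 0" using assms by (auto simp: laurent_carrier_def)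
  then have "\<forall>s<N - d. x (s + d) = 0" by simp
  then show ?thesis using assms by (auto simp: laurent_carrier_def)
qed

lemma comm_group_laurent_cgroup:
  assumes "m > 0"
  shows "comm_group (laurent_cgroup m)"
proof (rule comm_groupI; unfold laurent_cgroup_def; simp add: laurent_carrier_add[OF assms])
  show "(\<lambda>i. 0) \<in> laurent_carrier m" using assms by (simp add: mem_laurent_carrier_iff)
  fix x assume x: "x \<in> laurent_carrier m"
  show "(\<lambda>i. x i mod int m) = x" using x assms by (auto simp: mem_laurent_carrier_iff)
  show "\<exists>y\<in>laurent_carrier m. (\<lambda>i. (y i + x i) mod int m) = (\<lambda>i. 0)"
    using laurent_carrier_uminus[OF assms x]
    by (intro bexI[of _ "\<lambda>s. (- x s) mod int m"]) (auto simp: mod_add_left_eq)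
qed (auto simp: mod_add_left_eq mod_add_right_eq add_ac)

section \<open>The topology of Laurent series\<close>

abbreviation split_map :: "(int \<Rightarrow> int) \<Rightarrow> (int \<Rightarrow> int) \<times> (int \<Rightarrow> int)" where
  "split_map x \<equiv> (restrict x {..<0}, restrict x {0..})"

abbreviation split_topology :: "nat \<Rightarrow> ((int \<Rightarrow> int) \<times> (int \<Rightarrow> int)) topology" where
  "split_topology m \<equiv> prod_topology
          (discrete_topology (carrier (sum_group {..<0} (\<lambda>_. integer_mod_group m))))
          (product_topology (\<lambda>_. discrete_topology (carrier (integer_mod_group m))) {0..})"

lemma restrict_laurent_mem:
  assumes "x \<in> laurent_carrier m"
  shows "restrict x {..<0} \<in> carrier (sum_group {..<0} (\<lambda>_. integer_mod_group m))"
proof -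
  obtain N where N: "\<forall>s<N. x s = 0" using assms by (auto simp: laurent_carrier_def)
  have "{s \<in> {..<0}. restrict x {..<0} s \<noteq> \<one>\<^bsub>integer_mod_group m\<^esub>} \<subseteq> {N..<0}"
    using N by (auto simp: not_less[symmetric])
  then have "finite {s \<in> {..<0}. restrict x {..<0} s \<noteq> \<one>\<^bsub>integer_mod_group m\<^esub>}"
    by (rule finite_subset) simp
  then show ?thesis
    using assms by (subst carrier_sum_group) (auto simp: laurent_carrier_def)
qed

lemma split_map_mem: "x \<in> laurent_carrier m \<Longrightarrow> split_map x \<in> topspace (split_topology m)"
  using restrict_laurent_mem by (auto simp: laurent_carrier_def)

lemma split_map_image: "split_map ` laurent_carrier m = topspace (split_topology m)"
proof (intro subset_antisym subsetI)
  fix z assume "z \<in> split_map ` laurent_carrier m"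
  then show "z \<in> topspace (split_topology m)" using split_map_mem by blast
next
  fix z assume "z \<in> topspace (split_topology m)"
  then obtain a b where z: "z = (a, b)" and a: "a \<in> carrier (sum_group {..<0} (\<lambda>_. integer_mod_group m))"
    and b: "b \<in> (\<Pi>\<^sub>E i\<in>{0..}. carrier (integer_mod_group m))"
    by (cases z) auto
  have a': "a \<in> (\<Pi>\<^sub>E i\<in>{..<0}. carrier (integer_mod_group m))"
    and fin: "finite {s \<in> {..<0}. a s \<noteq> 0}"
    using a by (auto simp: carrier_sum_group)
  define x where "x s = (if s < 0 then a s else b s)" for s :: int
  \<comment> \<open>The negative part has finite support, so its least index gives the lower bound
    required of a Laurent series.\<close>
  have "x s = 0" if "s < Min (insert 0 {s \<in> {..<0}. a s \<noteq> 0})" for s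
    using that fin by (auto simp: x_def)
  then have "\<exists>N. \<forall>s<N. x s = \<one>\<^bsub>integer_mod_group m\<^esub>" by auto
  moreover have "x s \<in> carrier (integer_mod_group m)" for s
    using a' b by (auto simp: x_def)
  ultimately have "x \<in> laurent_carrier m" by (simp add: laurent_carrier_def)
  moreover have "split_map x = z"
    using a' b z by (auto simp: x_def fun_eq_iff PiE_def extensional_def)
  ultimately show "z \<in> split_map ` laurent_carrier m" by blast
qed

lemma split_map_inj: "inj split_map"
proof (rule injI)
  fix x x' assume "split_map x = split_map x'"
  then have "restrict x {..<0} s = restrict x' {..<0} s" "restrict x {0..} s = restrict x' {0..} s" for s
    by simp_all
  then have "x s = x' s" for s by (metis atLeast_iff lessThan_iff not_less restrict_apply')
  then show "x = x'" by blast
qed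

lemma topspace_laurent: "topspace (laurent_topology m) = laurent_carrier m"
  unfolding laurent_topology_def topspace_pullback_topology using split_map_mem by blast

text \<open>Continuity is immediate from the pullback, and openness follows because the map is onto.
  Local compactness and the Hausdorff property can thus be read off from the discrete and the
  compact factor.\<close>

lemma split_map_homeomorphic: "homeomorphic_map (laurent_topology m) (split_topology m) split_map"
proof (rule bijective_open_imp_homeomorphic_map)
  show "continuous_map (laurent_topology m) (split_topology m) split_map"
    using continuous_map_pullback[OF continuous_map_id, of "laurent_carrier m" split_map "split_topology m"]
    by (simp add: laurent_topology_def id_def o_def)
  show "open_map (laurent_topology m) (split_topology m) split_map"
    unfolding open_map_def
  proof (intro allI impI)
    fix U assume "openin (laurent_topology m) U"
    then obtain V where V: "openin (split_topology m) V" "U = split_map -` V \<inter> laurent_carrier m"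
      unfolding laurent_topology_def openin_pullback_topology by blast
    have image_eq: "f ` (f -` T \<inter> C) = T"
      if "T \<subseteq> f ` C" for f :: "(int \<Rightarrow> int) \<Rightarrow> (int \<Rightarrow> int) \<times> (int \<Rightarrow> int)" and T C
      using that by blast
    have "split_map ` U = V"
      unfolding V(2) by (rule image_eq) (use openin_subset[OF V(1)] split_map_image[of m] in simp)
    then show "openin (split_topology m) (split_map ` U)" using V by simp
  qed
qed (use split_map_image topspace_laurent split_map_inj in \<open>auto intro: inj_on_subset\<close>)

lemma locally_compact_laurent: "m > 0 \<Longrightarrow> locally_compact_space (laurent_topology m)"
proof -
  assume m: "m > 0"
  have "compact_space (product_topology (\<lambda>_. discrete_topology (carrier (integer_mod_group m))) {0::int..})"
    using m by (simp add: compact_space_product_topology compact_space_discrete_topology carrier_integer_mod_group)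
  then have "locally_compact_space (split_topology m)"
    by (simp add: locally_compact_space_prod_topology compact_imp_locally_compact_space
        locally_compact_space_discrete_topology)
  then show ?thesis
    using homeomorphic_locally_compact_space[OF homeomorphic_map_imp_homeomorphic_space[OF split_map_homeomorphic]]
    by blast
qed

lemma Hausdorff_laurent: "Hausdorff_space (laurent_topology m)"
proof -
  have "Hausdorff_space (split_topology m)"
    by (simp add: Hausdorff_space_prod_topology Hausdorff_space_product_topology)
  then show ?thesis
    using homeomorphic_Hausdorff_space[OF homeomorphic_map_imp_homeomorphic_space[OF split_map_homeomorphic]]
    by blast
qed

text \<open>The cylinder is a subset of the discrete factor times a box that restricts only the
  coordinates from 0 up to \<open>N\<close>.\<close>

lemma openin_laurent_cylinder:
  assumes "x \<in> laurent_carrier m"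
  shows "openin (laurent_topology m) {y \<in> laurent_carrier m. \<forall>s<N. y s = x s}"
proof -
  let ?C = "carrier (integer_mod_group m)"
  let ?b = "\<Pi>\<^sub>E s\<in>{0..}. if s < N then {x s} else ?C"
  let ?A = "{a \<in> carrier (sum_group {..<0} (\<lambda>_. integer_mod_group m)). \<forall>s<N. s < 0 \<longrightarrow> a s = x s}"
  have "openin (product_topology (\<lambda>_. discrete_topology ?C) {0..}) ?b"
    unfolding openin_PiE_gen
  proof (rule disjI2, intro conjI ballI)
    have "{s \<in> {0..}. (if s < N then {x s} else ?C) \<noteq> topspace (discrete_topology ?C)} \<subseteq> {0..<N}"
      by auto
    then show "finite {s \<in> {0..}. (if s < N then {x s} else ?C) \<noteq> topspace (discrete_topology ?C)}"
      by (rule finite_subset) simp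
    show "openin (discrete_topology ?C) (if s < N then {x s} else ?C)" for s
      using assms by (auto simp: laurent_carrier_def)
  qed
  then have "openin (split_topology m) (?A \<times> ?b)"
    by (simp add: openin_prod_Times_iff)
  moreover have "{y \<in> laurent_carrier m. \<forall>s<N. y s = x s} = split_map -` (?A \<times> ?b) \<inter> laurent_carrier m"
  proof (intro subset_antisym subsetI)
    fix y assume y: "y \<in> {y \<in> laurent_carrier m. \<forall>s<N. y s = x s}"
    then show "y \<in> split_map -` (?A \<times> ?b) \<inter> laurent_carrier m"
      using restrict_laurent_mem[of y m] by (auto simp: laurent_carrier_def)
  next
    fix y assume y: "y \<in> split_map -` (?A \<times> ?b) \<inter> laurent_carrier m"
    then have "split_map y \<in> ?A \<times> ?b" by (simp only: Int_iff vimage_eq)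
    then have ya: "restrict y {..<0} \<in> ?A" and yb: "restrict y {0..} \<in> ?b"
      by (simp_all only: mem_Sigma_iff)
    have "y s = x s" if s: "s < N" for s
    proof (cases "s < 0")
      case False
      then have "restrict y {0..} s \<in> (if s < N then {x s} else ?C)"
        using PiE_mem[OF yb, of s] by simp
      then have "restrict y {0..} s = x s" using s by simp
      then show ?thesis using False by simp
    qed (use ya s in auto)
    then show "y \<in> {y \<in> laurent_carrier m. \<forall>s<N. y s = x s}" using IntD2[OF y] by simp
  qed
  ultimately show ?thesis
    unfolding laurent_topology_def openin_pullback_topology by blast
qed

lemma openin_laurent_contains_cylinder:
  assumes "openin (laurent_topology m) U" "x \<in> U"
  shows "\<exists>N. \<forall>y\<in>laurent_carrier m. (\<forall>s<N. y s = x s) \<longrightarrow> y \<in> U"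
proof -
  obtain T where T: "openin (split_topology m) T" "U = split_map -` T \<inter> laurent_carrier m"
    using assms(1) unfolding laurent_topology_def openin_pullback_topology by blast
  then have "split_map x \<in> T" using assms(2) by auto
  then obtain A B where AB: "restrict x {..<0} \<in> A" "restrict x {0..} \<in> B" "A \<times> B \<subseteq> T"
    "openin (product_topology (\<lambda>_. discrete_topology (carrier (integer_mod_group m))) {0..}) B"
    using T(1) unfolding openin_prod_topology_alt by meson
  then obtain Q where Q: "finite {i \<in> {0..}. Q i \<noteq> carrier (integer_mod_group m)}"
    "restrict x {0..} \<in> Pi\<^sub>E {0..} Q" "Pi\<^sub>E {0..} Q \<subseteq> B"
    unfolding openin_product_topology_alt topspace_discrete_topology by meson
  \<comment> \<open>\<open>N\<close> exceeds every restricted coordinate. The inserted 0 and the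
    added 1 make it positive, so agreement below \<open>N\<close> also fixes the whole discrete
    half.\<close>
  define N where "N = Max (insert 0 {i \<in> {0..}. Q i \<noteq> carrier (integer_mod_group m)}) + 1"
  have N: "N > 0" "\<And>i. i \<ge> N \<Longrightarrow> Q i = carrier (integer_mod_group m)"
  proof -
    show "N > 0" using Q(1) by (simp add: N_def add_strict_increasing2 less_le_trans)
    fix i assume i: "i \<ge> N"
    show "Q i = carrier (integer_mod_group m)"
    proof (rule ccontr)
      assume "\<not> ?thesis"
      moreover have "i \<ge> 0" using i \<open>N > 0\<close> by simp
      ultimately have "i \<le> Max (insert 0 {i \<in> {0..}. Q i \<noteq> carrier (integer_mod_group m)})"
        using Q(1) by (intro Max_ge) auto
      then show False using i by (simp add: N_def)
    qed
  qed
  have "y \<in> U" if y: "y \<in> laurent_carrier m" "\<forall>s<N. y s = x s" for y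
  proof -
    have "restrict y {..<0} = restrict x {..<0}" using y N(1) by (auto simp: restrict_def)
    moreover have "restrict y {0..} \<in> Pi\<^sub>E {0..} Q"
    proof (rule restrict_PiE[THEN iffD2], rule Pi_I)
      fix s :: int assume s: "s \<in> {0..}"
      show "y s \<in> Q s"
      proof (cases "s < N")
        case True
        have "restrict x {0..} s \<in> Q s" using Q(2) s by (rule PiE_mem)
        then show ?thesis using y True s by simp
      next
        case False
        then show ?thesis using N(2)[of s] y by (auto simp: laurent_carrier_def)
      qed
    qed
    then have "restrict y {0..} \<in> B" using Q(3) by blast
    ultimately have "split_map y \<in> T" using AB(1,3) by auto
    then show ?thesis using T(2) y by auto
  qed
  then show ?thesis by blast
qed

section \<open>Finite direct sums of Laurent series groups\<close>

locale standard_family =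
  fixes \<nu> :: "nat \<times> nat \<Rightarrow> nat"
  assumes fam: "\<nu> \<in> finsupp_families"
begin

abbreviation "I \<equiv> std_index \<nu>"
abbreviation "S \<equiv> standard_cgroup \<nu>"
abbreviation md :: "nat \<times> nat \<times> nat \<Rightarrow> nat" where "md i \<equiv> fst i ^ fst (snd i)"

lemma finite_I: "finite I"
  using finite_std_index[OF fam] .

lemma md_pos: "i \<in> I \<Longrightarrow> md i > 0"
  by (auto simp: std_index_def prime_gt_0_nat)

lemma standard_eq: "S = direct_sum_cgroup I (\<lambda>i. laurent_cgroup (md i))"
  unfolding standard_cgroup_def std_index_def by (rule arg_cong2[of _ _ _ _ direct_sum_cgroup]) auto

lemma carrier_S: "carrier S = (\<Pi>\<^sub>E i\<in>I. laurent_carrier (md i))"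
proof -
  have "carrier (sum_group I (\<lambda>i. laurent_cgroup (md i)))
     = {x \<in> \<Pi>\<^sub>E i\<in>I. carrier (laurent_cgroup (md i)). finite {i \<in> I. x i \<noteq> \<one>\<^bsub>laurent_cgroup (md i)\<^esub>}}"
    using comm_group_laurent_cgroup[OF md_pos]
    by (intro carrier_sum_group) (simp add: comm_group_def)
  then show ?thesis using finite_I by (simp add: standard_eq direct_sum_cgroup_def laurent_cgroup_def)
qed

lemma mult_S: "f \<otimes>\<^bsub>S\<^esub> g = (\<lambda>i\<in>I. \<lambda>s. (f i s + g i s) mod int (md i))"
  by (simp add: standard_eq direct_sum_cgroup_def laurent_cgroup_def)

lemma one_S: "\<one>\<^bsub>S\<^esub> = (\<lambda>i\<in>I. \<lambda>s. 0)"
  by (simp add: standard_eq direct_sum_cgroup_def laurent_cgroup_def)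

lemma gaut_S: "gaut S f = (\<lambda>i\<in>I. \<lambda>s. f i (s - 1))"
  by (simp add: standard_eq direct_sum_cgroup_def laurent_cgroup_def)

lemma gtop_S: "gtop S = product_topology (\<lambda>i. laurent_topology (md i)) I"
  by (simp add: standard_eq direct_sum_cgroup_def laurent_cgroup_def)

lemma S_mem: "f \<in> carrier S \<Longrightarrow> i \<in> I \<Longrightarrow> f i \<in> laurent_carrier (md i)"
  unfolding carrier_S by (rule PiE_mem)

lemma S_restrictI: "(\<And>i. i \<in> I \<Longrightarrow> f i \<in> laurent_carrier (md i)) \<Longrightarrow> (\<lambda>i\<in>I. f i) \<in> carrier S"
  unfolding carrier_S restrict_PiE by (rule Pi_I)

lemma S_range: "f \<in> carrier S \<Longrightarrow> i \<in> I \<Longrightarrow> 0 \<le> f i s \<and> f i s < int (md i)"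
  using S_mem[of f i] mem_laurent_carrier_iff[OF md_pos, of i "f i"] by blast

lemma S_low: "f \<in> carrier S \<Longrightarrow> \<exists>L. \<forall>i\<in>I. \<forall>s<L. f i s = 0"
proof -
  assume f: "f \<in> carrier S"
  have "\<forall>i\<in>I. \<exists>N. \<forall>s<N. f i s = 0"
    using S_mem[OF f] by (auto simp: laurent_carrier_def)
  then obtain N where N: "\<And>i s. i \<in> I \<Longrightarrow> s < N i \<Longrightarrow> f i s = 0" by metis
  have "\<forall>i\<in>I. \<forall>s<Min (insert 0 (N ` I)). f i s = 0"
    using N finite_I by auto
  then show ?thesis by blast
qed

lemma S_ext: "f \<in> carrier S \<Longrightarrow> g \<in> carrier S \<Longrightarrow> (\<And>i s. i \<in> I \<Longrightarrow> f i s = g i s) \<Longrightarrow> f = g"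
  unfolding carrier_S by (rule PiE_ext) auto

lemma S_memI:
  assumes "\<And>i s. i \<in> I \<Longrightarrow> 0 \<le> f i s \<and> f i s < int (md i)" "\<And>i s. i \<in> I \<Longrightarrow> s < L \<Longrightarrow> f i s = 0"
  shows "(\<lambda>i\<in>I. f i) \<in> carrier S"
proof (rule S_restrictI)
  fix i assume i: "i \<in> I"
  then have "\<exists>N. \<forall>s<N. f i s = 0" using assms(2) by blast
  then show "f i \<in> laurent_carrier (md i)"
    using assms(1)[OF i] unfolding mem_laurent_carrier_iff[OF md_pos[OF i]] by simp
qed

lemma comm_group_S: "comm_group S"
proof (rule comm_groupI)
  show mult_closed: "f \<otimes>\<^bsub>S\<^esub> g \<in> carrier S" if "f \<in> carrier S" "g \<in> carrier S" for f g
    unfolding mult_S by (intro S_restrictI laurent_carrier_add md_pos S_mem that)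
  show one_mem: "\<one>\<^bsub>S\<^esub> \<in> carrier S"
    unfolding one_S by (rule S_memI) (use md_pos in auto)
  show "f \<otimes>\<^bsub>S\<^esub> g \<otimes>\<^bsub>S\<^esub> h = f \<otimes>\<^bsub>S\<^esub> (g \<otimes>\<^bsub>S\<^esub> h)" for f g h
    unfolding mult_S by (auto simp: fun_eq_iff mod_add_left_eq mod_add_right_eq add_ac)
  show "f \<otimes>\<^bsub>S\<^esub> g = g \<otimes>\<^bsub>S\<^esub> f" for f g
    unfolding mult_S by (simp add: add_ac)
  show "\<one>\<^bsub>S\<^esub> \<otimes>\<^bsub>S\<^esub> f = f" if f: "f \<in> carrier S" for f
    by (rule S_ext[OF mult_closed[OF one_mem f] f]) (use S_range[OF f] in \<open>auto simp: mult_S one_S\<close>)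
  show "\<exists>g\<in>carrier S. g \<otimes>\<^bsub>S\<^esub> f = \<one>\<^bsub>S\<^esub>" if f: "f \<in> carrier S" for f
  proof
    let ?g = "\<lambda>i\<in>I. \<lambda>s. (- f i s) mod int (md i)"
    show g: "?g \<in> carrier S"
      by (intro S_restrictI laurent_carrier_uminus md_pos S_mem f)
    show "?g \<otimes>\<^bsub>S\<^esub> f = \<one>\<^bsub>S\<^esub>"
      unfolding mult_S one_S by (auto simp: fun_eq_iff mod_add_left_eq)
  qed
qed

sublocale S: comm_group S
  by (rule comm_group_S)

lemma inv_S:
  assumes f: "f \<in> carrier S"
  shows "inv\<^bsub>S\<^esub> f = (\<lambda>i\<in>I. \<lambda>s. (- f i s) mod int (md i))"
proof (rule S.inv_equality[OF _ f])
  show "(\<lambda>i\<in>I. \<lambda>s. (- f i s) mod int (md i)) \<in> carrier S"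
    by (intro S_restrictI laurent_carrier_uminus md_pos S_mem f)
  show "(\<lambda>i\<in>I. \<lambda>s. (- f i s) mod int (md i)) \<otimes>\<^bsub>S\<^esub> f = \<one>\<^bsub>S\<^esub>"
    unfolding mult_S one_S by (auto simp: fun_eq_iff mod_add_left_eq)
qed

lemma pow_S: "i \<in> I \<Longrightarrow> (f [^]\<^bsub>S\<^esub> (n::nat)) i s = (int n * f i s) mod int (md i)"
proof (induction n)
  case (Suc n)
  then have "(f [^]\<^bsub>S\<^esub> Suc n) i s = (int n * f i s mod int (md i) + f i s) mod int (md i)"
    by (simp add: mult_S)
  also have "\<dots> = (int n * f i s + f i s) mod int (md i)" by (rule mod_add_left_eq)
  finally show ?case by (simp add: distrib_right add.commute)
qed (simp add: one_S)

text \<open>The counterpart of \<open>W\<close>: in each component, t to the power \<open>k\<close>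
  times the formal power series.\<close>

definition U :: "int \<Rightarrow> (nat \<times> nat \<times> nat \<Rightarrow> int \<Rightarrow> int) set" where
  "U k = {f \<in> carrier S. \<forall>i\<in>I. \<forall>s<k. f i s = 0}"

text \<open>Coefficients are reduced representatives, so congruence modulo the order is equality;
  closeness in the filtration becomes agreement below \<open>k\<close>.\<close>

lemma quot_mem_U_iff:
  assumes f: "f \<in> carrier S" and g: "g \<in> carrier S"
  shows "inv\<^bsub>S\<^esub> f \<otimes>\<^bsub>S\<^esub> g \<in> U k \<longleftrightarrow> (\<forall>i\<in>I. \<forall>s<k. g i s = f i s)"
proof -
  have "(inv\<^bsub>S\<^esub> f \<otimes>\<^bsub>S\<^esub> g) i s = 0 \<longleftrightarrow> g i s = f i s" if i: "i \<in> I" for i s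
  proof -
    have "(inv\<^bsub>S\<^esub> f \<otimes>\<^bsub>S\<^esub> g) i s = (g i s - f i s) mod int (md i)"
      using i inv_S[OF f] by (simp add: mult_S mod_add_left_eq)
    moreover have "(g i s - f i s) mod int (md i) = 0 \<longleftrightarrow> g i s mod int (md i) = f i s mod int (md i)"
      by (simp add: mod_eq_dvd_iff dvd_eq_mod_eq_0)
    ultimately show ?thesis using S_range[OF f i, of s] S_range[OF g i, of s] by simp
  qed
  then show ?thesis using f g by (auto simp: U_def)
qed

lemma gaut_closed_S: "f \<in> carrier S \<Longrightarrow> gaut S f \<in> carrier S"
  unfolding gaut_S by (rule S_restrictI) (use S_mem laurent_carrier_shift[of _ _ "- 1"] in simp)

lemma gaut_iso_S: "gaut S \<in> iso S S"
proof (rule isoI)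
  show "gaut S \<in> hom S S"
  proof (rule homI)
    fix f g assume "f \<in> carrier S" "g \<in> carrier S"
    show "gaut S f \<in> carrier S" by (rule gaut_closed_S) fact
    show "gaut S (f \<otimes>\<^bsub>S\<^esub> g) = gaut S f \<otimes>\<^bsub>S\<^esub> gaut S g"
      by (auto simp: gaut_S mult_S fun_eq_iff)
  qed
  show "bij_betw (gaut S) (carrier S) (carrier S)"
  proof (rule bij_betw_byWitness[of _ "\<lambda>f. \<lambda>i\<in>I. \<lambda>s. f i (s + 1)"])
    have unshift: "(\<lambda>i\<in>I. \<lambda>s. f i (s + 1)) \<in> carrier S" if "f \<in> carrier S" for f
      by (intro S_restrictI laurent_carrier_shift S_mem that)
    then show "(\<lambda>f. \<lambda>i\<in>I. \<lambda>s. f i (s + 1)) ` carrier S \<subseteq> carrier S" by blast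
    show "gaut S ` carrier S \<subseteq> carrier S" using gaut_closed_S by blast
    show "\<forall>f\<in>carrier S. (\<lambda>i\<in>I. \<lambda>s. gaut S f i (s + 1)) = f"
      by (intro ballI S_ext unshift gaut_closed_S) (auto simp: gaut_S)
    show "\<forall>f\<in>carrier S. gaut S (\<lambda>i\<in>I. \<lambda>s. f i (s + 1)) = f"
      by (intro ballI S_ext gaut_closed_S unshift) (auto simp: gaut_S)
  qed
qed

text \<open>Since \<open>I\<close> is finite, the cylinder bounds of the components have a common
  maximum, and a single \<open>k\<close> describes a neighbourhood in the product.\<close>

lemma openin_S_iff:
  "openin (gtop S) T \<longleftrightarrow> T \<subseteq> carrier S \<and>
     (\<forall>f\<in>T. \<exists>k. \<forall>g\<in>carrier S. (\<forall>i\<in>I. \<forall>s<k. g i s = f i s) \<longrightarrow> g \<in> T)"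
proof (intro iffI conjI ballI)
  assume T: "openin (gtop S) T"
  show "T \<subseteq> carrier S"
    using openin_subset[OF T] by (simp add: gtop_S topspace_laurent carrier_S)
  fix f assume f: "f \<in> T"
  obtain Q where Q: "\<And>i. i \<in> I \<Longrightarrow> openin (laurent_topology (md i)) (Q i)" "f \<in> Pi\<^sub>E I Q" "Pi\<^sub>E I Q \<subseteq> T"
    using T f unfolding gtop_S openin_product_topology_alt by meson
  have "\<forall>i\<in>I. \<exists>N. \<forall>y\<in>laurent_carrier (md i). (\<forall>s<N. y s = f i s) \<longrightarrow> y \<in> Q i"
    using openin_laurent_contains_cylinder Q(1,2) by (metis PiE_mem)
  then obtain N where N: "\<And>i y. i \<in> I \<Longrightarrow> y \<in> laurent_carrier (md i) \<Longrightarrow> (\<forall>s<N i. y s = f i s) \<Longrightarrow> y \<in> Q i"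
    by metis
  have "g \<in> T" if g: "g \<in> carrier S" "\<forall>i\<in>I. \<forall>s<Max (insert 0 (N ` I)). g i s = f i s" for g
  proof -
    have "g i \<in> Q i" if i: "i \<in> I" for i
    proof (rule N[OF i])
      show "g i \<in> laurent_carrier (md i)" using S_mem[OF g(1) i] .
      have "N i \<le> Max (insert 0 (N ` I))" using finite_I i by simp
      then show "\<forall>s<N i. g i s = f i s" using g(2) i by auto
    qed
    then have "g \<in> Pi\<^sub>E I Q" using g(1) unfolding carrier_S by (simp add: PiE_iff)
    then show ?thesis using Q by blast
  qed
  then show "\<exists>k. \<forall>g\<in>carrier S. (\<forall>i\<in>I. \<forall>s<k. g i s = f i s) \<longrightarrow> g \<in> T" by blast
next
  assume T: "T \<subseteq> carrier S \<and>
     (\<forall>f\<in>T. \<exists>k. \<forall>g\<in>carrier S. (\<forall>i\<in>I. \<forall>s<k. g i s = f i s) \<longrightarrow> g \<in> T)"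
  show "openin (gtop S) T"
    unfolding gtop_S openin_product_topology_alt
  proof
    fix f assume f: "f \<in> T"
    then have fc: "f \<in> carrier S" using T by blast
    obtain k where k: "\<forall>g\<in>carrier S. (\<forall>i\<in>I. \<forall>s<k. g i s = f i s) \<longrightarrow> g \<in> T" using T f by blast
    define Q where "Q i = {y \<in> laurent_carrier (md i). \<forall>s<k. y s = f i s}" for i
    have "openin (laurent_topology (md i)) (Q i)" if "i \<in> I" for i
      unfolding Q_def by (rule openin_laurent_cylinder) (rule S_mem[OF fc that])
    moreover have "f \<in> Pi\<^sub>E I Q" using fc unfolding carrier_S Q_def by (simp add: PiE_iff)
    moreover have "Pi\<^sub>E I Q \<subseteq> T"
    proof
      fix g assume g: "g \<in> Pi\<^sub>E I Q"
      then have "g i \<in> Q i" if "i \<in> I" for i using that by (rule PiE_mem)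
      then have "g \<in> carrier S" "\<forall>i\<in>I. \<forall>s<k. g i s = f i s"
        using g unfolding carrier_S Q_def by (simp_all add: PiE_iff)
      then show "g \<in> T" using k by blast
    qed
    ultimately show "\<exists>Q. finite {i \<in> I. Q i \<noteq> topspace (laurent_topology (md i))} \<and>
         (\<forall>i\<in>I. openin (laurent_topology (md i)) (Q i)) \<and> f \<in> Pi\<^sub>E I Q \<and> Pi\<^sub>E I Q \<subseteq> T"
      using finite_I by (intro exI[of _ Q]) auto
  qed
qed

lemma U_subgroup: "subgroup (U k) S"
proof (rule S.subgroupI)
  show "U k \<noteq> {}" using S.one_closed by (auto simp: U_def one_S intro!: exI[of _ "\<one>\<^bsub>S\<^esub>"])
  fix f g assume f: "f \<in> U k"
  then have fc: "f \<in> carrier S" by (simp add: U_def)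
  show "inv\<^bsub>S\<^esub> f \<in> U k" using f S.inv_closed[OF fc] inv_S[OF fc] by (simp add: U_def)
  assume "g \<in> U k"
  then show "f \<otimes>\<^bsub>S\<^esub> g \<in> U k" using f S.m_closed[of f g] by (simp add: U_def) (simp add: mult_S)
qed (auto simp: U_def)

lemma filtered_S: "filtered_cgroup S U"
proof (intro filtered_cgroup.intro filtered_cgroup_axioms.intro)
  show "U (k + 1) \<subseteq> U k" for k by (auto simp: U_def)
  show "\<exists>k. f \<in> U k" if "f \<in> carrier S" for f using S_low[OF that] that by (auto simp: U_def)
  show "f = \<one>\<^bsub>S\<^esub>" if f: "\<And>k. f \<in> U k" for f
  proof (rule S_ext)
    fix i s assume "i \<in> I"
    then show "f i s = \<one>\<^bsub>S\<^esub> i s" using f[of "s + 1"] by (simp add: U_def one_S)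
  qed (use f[of 0] in \<open>auto simp: U_def\<close>)
  show "gaut S f \<in> U (k + 1) \<longleftrightarrow> f \<in> U k" if f: "f \<in> carrier S" for f k
  proof
    assume g: "gaut S f \<in> U (k + 1)"
    have "f i s = 0" if "i \<in> I" "s < k" for i s
    proof -
      have "gaut S f i (s + 1) = 0" using g that by (simp add: U_def)
      then show ?thesis using that by (simp add: gaut_S)
    qed
    then show "f \<in> U k" using f by (simp add: U_def)
  next
    assume "f \<in> U k"
    then show "gaut S f \<in> U (k + 1)" using gaut_closed_S[OF f] by (simp add: U_def) (simp add: gaut_S)
  qed
  show "openin (gtop S) T \<longleftrightarrow> T \<subseteq> carrier S \<and>
      (\<forall>f\<in>T. \<exists>k. \<forall>g\<in>carrier S. inv\<^bsub>S\<^esub> f \<otimes>\<^bsub>S\<^esub> g \<in> U k \<longrightarrow> g \<in> T)" for T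
    unfolding openin_S_iff using quot_mem_U_iff by (meson subsetD)
qed (use U_subgroup gaut_iso_S comm_group_S in auto)

theorem standard_lc_abelian_torsion: "lc_abelian_torsion_contraction_group S"
  unfolding lc_abelian_torsion_contraction_group_def
proof (intro conjI)
  show "comm_group S" by (rule comm_group_S)
  show "lc_contraction_group S"
  proof (rule filtered_cgroup.lc_contraction_groupI[OF filtered_S])
    show "Hausdorff_space (gtop S)"
      unfolding gtop_S using Hausdorff_laurent by (simp add: Hausdorff_space_product_topology)
    have "{i \<in> I. \<not> compact_space (laurent_topology (md i))} \<subseteq> I" by blast
    then have "finite {i \<in> I. \<not> compact_space (laurent_topology (md i))}"
      using finite_I finite_subset by blast
    then show "locally_compact_space (gtop S)"
      unfolding gtop_S locally_compact_space_product_topology using locally_compact_laurent[OF md_pos] by blast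
  qed
  have "f [^]\<^bsub>S\<^esub> (\<Prod>i\<in>I. md i) = \<one>\<^bsub>S\<^esub>" if f: "f \<in> carrier S" for f
  proof (rule S_ext)
    fix i s assume i: "i \<in> I"
    have "md i dvd (\<Prod>i\<in>I. md i)" using finite_I i by (intro dvd_prodI) auto
    then have "int (md i) dvd int (\<Prod>i\<in>I. md i) * f i s" using int_dvd_int_iff dvd_mult2 by blast
    then show "(f [^]\<^bsub>S\<^esub> (\<Prod>i\<in>I. md i)) i s = \<one>\<^bsub>S\<^esub> i s"
      unfolding pow_S[OF i] using i by (simp add: one_S)
  qed (use f in auto)
  moreover have "(\<Prod>i\<in>I. md i) > 0" by (rule prod_pos) (rule md_pos)
  ultimately show "torsion_group S"
    unfolding torsion_group_def using S.is_group by blast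
qed

end

section \<open>Classification\<close>

lemma cgroup_isomorphic_sym:
  assumes G: "lc_contraction_group G" and H: "lc_contraction_group H" and "G \<cong>\<^sub>c H"
  shows "H \<cong>\<^sub>c G"
proof -
  obtain h where h: "h \<in> iso G H" "homeomorphic_map (gtop G) (gtop H) h"
    "\<And>x. x \<in> carrier G \<Longrightarrow> h (gaut G x) = gaut H (h x)"
    using assms(3) unfolding cgroup_isomorphic_def by blast
  have top: "group G" "topspace (gtop G) = carrier G" "topspace (gtop H) = carrier H"
    and aut: "gaut G \<in> iso G G"
    using G H by (auto simp: lc_contraction_group_def topological_group_def)
  let ?g = "inv_into (carrier G) h"
  have bij: "bij_betw h (carrier G) (carrier H)" using h(1) by (simp add: iso_def)
  obtain g' where g': "homeomorphic_maps (gtop G) (gtop H) h g'"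
    using h(2) homeomorphic_map_maps by blast
  have eq: "g' y = ?g y" if "y \<in> topspace (gtop H)" for y
  proof -
    have "y \<in> h ` carrier G" using that bij top by (simp add: bij_betw_def)
    then obtain x where x: "x \<in> carrier G" "y = h x" by blast
    then show ?thesis using g' top bij by (simp add: homeomorphic_maps_def bij_betw_def inv_into_f_f)
  qed
  have "homeomorphic_map (gtop H) (gtop G) g'"
    using g' homeomorphic_maps_map homeomorphic_maps_sym homeomorphic_map_maps by blast
  then have "homeomorphic_map (gtop H) (gtop G) ?g"
    using homeomorphic_map_eq[of "gtop H" "gtop G" g' ?g] eq by blast
  moreover have "?g (gaut H y) = gaut G (?g y)" if "y \<in> carrier H" for y
  proof -
    have "y \<in> h ` carrier G" using that bij by (simp add: bij_betw_def)
    then obtain x where x: "x \<in> carrier G" "y = h x" by blast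
    have "gaut G x \<in> carrier G" using aut x by (auto simp: iso_def hom_def)
    then show ?thesis using x bij h(3)[OF x(1), symmetric] by (simp add: bij_betw_def inv_into_f_f)
  qed
  moreover have "?g \<in> iso H G" using group.iso_set_sym[OF top(1) h(1)] .
  ultimately show ?thesis unfolding cgroup_isomorphic_def by blast
qed

lemma cgroup_isomorphic_trans:
  assumes "G \<cong>\<^sub>c H" "H \<cong>\<^sub>c K"
  shows "G \<cong>\<^sub>c K"
proof -
  obtain g h where g: "g \<in> iso G H" "homeomorphic_map (gtop G) (gtop H) g"
      "\<And>x. x \<in> carrier G \<Longrightarrow> g (gaut G x) = gaut H (g x)"
    and h: "h \<in> iso H K" "homeomorphic_map (gtop H) (gtop K) h"
      "\<And>x. x \<in> carrier H \<Longrightarrow> h (gaut H x) = gaut K (h x)"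
    using assms unfolding cgroup_isomorphic_def by blast
  have "(h \<circ> g) (gaut G x) = gaut K ((h \<circ> g) x)" if "x \<in> carrier G" for x
  proof -
    have "g x \<in> carrier H" using g(1) that by (auto simp: iso_def hom_def)
    then show ?thesis using g(3)[OF that] h(3) by simp
  qed
  moreover have "h \<circ> g \<in> iso G K" using iso_set_trans[OF g(1) h(1)] by (simp add: comp_def compose_def)
  moreover have "homeomorphic_map (gtop G) (gtop K) (h \<circ> g)"
    using homeomorphic_map_compose[OF g(2) h(2)] .
  ultimately show ?thesis unfolding cgroup_isomorphic_def by blast
qed

text \<open>The map \<open>h\<close> evaluates a coefficient family. \<open>conv_kernel\<close>
  makes it injective and \<open>conv_surj\<close> surjective; their companions on levels enter
  through two constants, \<open>c\<close> from \<open>conv_small\<close> for continuity of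
  \<open>h\<close> and \<open>d\<close> from \<open>conv_surj\<close> for continuity of its
  inverse.\<close>

theorem (in adapted_cgroup) standard_isomorphic:
  assumes fam: "\<nu> \<in> finsupp_families" and I: "I = std_index \<nu>"
  shows "standard_cgroup \<nu> \<cong>\<^sub>c G"
proof -
  interpret N: standard_family \<nu> using fam by unfold_locales
  let ?S = "standard_cgroup \<nu>"
  define h where "h f = (THE x. conv f x)" for f
  have h: "h f = x" if "conv f x" for f x
    unfolding h_def using that conv_unique by blast
  have conv_h: "conv f (h f)" if f: "f \<in> carrier ?S" for f
  proof -
    obtain L where "\<forall>i\<in>I. \<forall>s<L. f i s = 0" using N.S_low[OF f] I by blast
    then obtain x where "conv f x" using conv_exists[of L f] by blast
    then show ?thesis using h by simp
  qed
  have mod: "int (fst i ^ fst (snd i)) dvd a - a mod int (fst i ^ fst (snd i))" for a and i :: "nat \<times> nat \<times> nat"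
    by (simp add: minus_mod_eq_mult_div)
  have hom: "h \<in> hom ?S G"
  proof (rule homI)
    fix f g assume f: "f \<in> carrier ?S" and g: "g \<in> carrier ?S"
    show "h f \<in> carrier G" using conv_closed[OF conv_h[OF f]] .
    have "conv (f \<otimes>\<^bsub>?S\<^esub> g) (h f \<otimes> h g)"
      by (rule conv_cong[OF _ conv_add[OF conv_h[OF f] conv_h[OF g]]])
        (use I mod in \<open>simp add: N.mult_S del: of_nat_power\<close>)
    then show "h (f \<otimes>\<^bsub>?S\<^esub> g) = h f \<otimes> h g" by (rule h)
  qed
  have ker: "f = \<one>\<^bsub>?S\<^esub>" if f: "f \<in> carrier ?S" and "h f = \<one>" for f
  proof (rule N.S_ext[OF f N.S.one_closed])
    fix i s assume i: "i \<in> std_index \<nu>"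
    obtain L where L: "\<And>i s. i \<in> I \<Longrightarrow> s < L \<Longrightarrow> f i s = 0" using N.S_low[OF f] I by blast
    have "int (fst i ^ fst (snd i)) dvd f i s"
      using conv_kernel[of f L i s] conv_h[OF f] that(2) L i I by simp
    then have "f i s = 0"
      using N.S_range[OF f i, of s] zdvd_not_zless[of "f i s"] by force
    then show "f i s = \<one>\<^bsub>?S\<^esub> i s" using i by (simp add: N.one_S)
  qed
  have inj: "f = g" if f: "f \<in> carrier ?S" and g: "g \<in> carrier ?S" and "h f = h g" for f g
  proof -
    have "h (inv\<^bsub>?S\<^esub> f \<otimes>\<^bsub>?S\<^esub> g) = inv (h f) \<otimes> h g"
      by (rule hom_quot[OF N.S.is_group is_group hom f g])
    also have "\<dots> = \<one>" using that(3) conv_closed[OF conv_h[OF g]] by simp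
    finally have "inv\<^bsub>?S\<^esub> f \<otimes>\<^bsub>?S\<^esub> g = \<one>\<^bsub>?S\<^esub>" using ker f g by simp
    then show ?thesis using f g by (metis N.S.inv_closed N.S.inv_equality N.S.inv_inv)
  qed
  obtain m :: nat where m: "m > 0" "\<And>x. x \<in> carrier G \<Longrightarrow> x [^] m = \<one>"
    using bounded_exponent by blast
  obtain d where d: "\<And>k x. x \<in> W k \<Longrightarrow> x [^] m = \<one> \<Longrightarrow>
           \<exists>f. (\<forall>i s. s < k - d \<longrightarrow> f i s = 0) \<and> conv f x"
    using conv_surj[OF m(1)] by blast
  have lift: "\<exists>f\<in>N.U (k - d). h f = x" if x: "x \<in> W k" for k x
  proof -
    obtain f where f: "\<And>i s. s < k - d \<Longrightarrow> f i s = 0" "conv f x"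
      using d[OF x] m W_carrier[OF x] by blast
    \<comment> \<open>The integers from \<open>conv_surj\<close> are reduced modulo the orders to
      land in the carrier; this keeps the zeros below \<open>k - d\<close> and, by
      \<open>conv_cong\<close>, the value.\<close>
    define g where "g = (\<lambda>i\<in>std_index \<nu>. \<lambda>s. f i s mod int (fst i ^ fst (snd i)))"
    have g: "g \<in> carrier ?S"
      unfolding g_def
      by (rule N.S_memI[of _ "k - d"]) (use N.md_pos f(1) in \<open>auto simp del: of_nat_power\<close>)
    moreover have "\<forall>i\<in>std_index \<nu>. \<forall>s<k - d. g i s = 0" using f(1) by (simp add: g_def)
    moreover have "conv g x"
      by (rule conv_cong[OF _ f(2)]) (use I mod in \<open>simp add: g_def del: of_nat_power\<close>)
    ultimately show ?thesis using h[of g x] by (intro bexI[of _ g]) (auto simp: N.U_def)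
  qed
  have "bij_betw h (carrier ?S) (carrier G)"
    unfolding bij_betw_def
  proof (intro conjI inj_onI subset_antisym subsetI)
    fix x assume "x \<in> carrier G"
    then obtain k where "x \<in> W k" using W_exhaust by blast
    then show "x \<in> h ` carrier ?S" using lift[of x k] by (auto simp: N.U_def)
  next
    fix x assume "x \<in> h ` carrier ?S"
    then show "x \<in> carrier G" using conv_closed[OF conv_h] by blast
  qed (rule inj)
  then have iso: "h \<in> iso ?S G" using hom by (simp add: iso_def)
  have "homeomorphic_map (gtop ?S) (gtop G) h"
  proof (rule filtered_homeomorphic_map[OF N.filtered_S filtered_cgroup_axioms iso])
    fix k
    obtain c where c: "\<And>f x M. conv f x \<Longrightarrow> (\<forall>i\<in>I. \<forall>s<M. f i s = 0) \<Longrightarrow> x \<in> W (M - c)"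
      using conv_small by blast
    have "\<forall>f\<in>N.U (k + c). h f \<in> W k"
    proof
      fix f assume f: "f \<in> N.U (k + c)"
      then have "f \<in> carrier ?S" "\<forall>i\<in>I. \<forall>s<k + c. f i s = 0" using I by (auto simp: N.U_def)
      then show "h f \<in> W k" using c[OF conv_h, of f "k + c"] by simp
    qed
    then show "\<exists>l. \<forall>f\<in>N.U l. h f \<in> W k" by blast
    \<comment> \<open>\<open>lift\<close> gives some preimage in \<open>U k\<close>; injectivity
      identifies it with \<open>f\<close>.\<close>
    have "f \<in> N.U k" if f: "f \<in> carrier ?S" "h f \<in> W (k + d)" for f
    proof -
      obtain g where g: "g \<in> N.U k" "h g = h f" using lift[OF f(2)] by auto
      then have "g = f" using inj[of g f] f by (simp add: N.U_def)
      then show ?thesis using g by simp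
    qed
    then show "\<exists>l. \<forall>f\<in>carrier ?S. h f \<in> W l \<longrightarrow> f \<in> N.U k" by blast
  qed
  moreover have "h (gaut ?S f) = gaut G (h f)" if f: "f \<in> carrier ?S" for f
  proof (rule h)
    show "conv (gaut ?S f) (gaut G (h f))"
      by (rule conv_cong[OF _ conv_gaut[OF conv_h[OF f]]]) (use I in \<open>simp add: N.gaut_S\<close>)
  qed
  ultimately show ?thesis unfolding cgroup_isomorphic_def using iso by blast
qed

section \<open>Invariance of the multiplicities\<close>

lemma (in filtered_cgroup) gaut_funpow_closed: "x \<in> carrier G \<Longrightarrow> (gaut G ^^ n) x \<in> carrier G"
  by (induction n) (auto simp: gaut_closed)

lemma (in filtered_cgroup) gaut_funpow_W_iff:
  assumes "x \<in> carrier G"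
  shows "(gaut G ^^ n) x \<in> W (k + int n) \<longleftrightarrow> x \<in> W k"
proof (induction n)
  case (Suc n)
  have "gaut G ((gaut G ^^ n) x) \<in> W (k + int n + 1) \<longleftrightarrow> (gaut G ^^ n) x \<in> W (k + int n)"
    using gaut_W_iff[OF gaut_funpow_closed[OF assms]] .
  then show ?case using Suc by (simp add: algebra_simps)
qed simp

lemma (in filtered_cgroup) gaut_funpow_surj:
  "x \<in> carrier G \<Longrightarrow> \<exists>z\<in>carrier G. x = (gaut G ^^ n) z"
proof (induction n arbitrary: x)
  case (Suc n)
  then obtain z where z: "z \<in> carrier G" "x = (gaut G ^^ n) z" by blast
  have "gaut G ` carrier G = carrier G" using gaut_iso by (simp add: iso_def bij_betw_def)
  then obtain w where "w \<in> carrier G" "z = gaut G w" using z(1) by blast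
  then show ?case using z(2) by (intro bexI[of _ w]) (simp_all add: funpow_swap1)
qed auto

text \<open>Continuity at the identity gives one pair of levels for \<open>h\<close> and one for its
  inverse. As \<open>h\<close> commutes with the automorphisms, shifting carries these pairs along,
  so the distortion is one constant at all levels.\<close>

lemma filtered_iso_bounds:
  assumes G: "filtered_cgroup G W" and H: "filtered_cgroup H V" and h: "h \<in> iso G H"
    and homeo: "homeomorphic_map (gtop G) (gtop H) h"
    and eqv: "\<And>x. x \<in> carrier G \<Longrightarrow> h (gaut G x) = gaut H (h x)"
  shows "\<exists>c::nat. (\<forall>x\<in>W 0. h x \<in> V (- int c)) \<and>
           (\<forall>k::nat. \<forall>x\<in>carrier G. h x \<in> V (int k + int c) \<longrightarrow> x \<in> W (int k))"
proof -
  interpret G: filtered_cgroup G W by fact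
  interpret H: filtered_cgroup H V by fact
  have clo: "h x \<in> carrier H" if "x \<in> carrier G" for x using h that by (auto simp: iso_def hom_def)
  have inj: "inj_on h (carrier G)" using h by (simp add: iso_def bij_betw_def)
  have h1: "h \<one>\<^bsub>G\<^esub> = \<one>\<^bsub>H\<^esub>"
    using h G.is_group H.is_group by (auto simp: iso_def intro: hom_one)
  have pow: "h ((gaut G ^^ n) x) = (gaut H ^^ n) (h x)" if "x \<in> carrier G" for x n
    by (induction n) (use that eqv G.gaut_funpow_closed in auto)
  have open_V: "openin (gtop H) (V k)" for k
  proof -
    have "{y \<in> carrier H. inv\<^bsub>H\<^esub> \<one>\<^bsub>H\<^esub> \<otimes>\<^bsub>H\<^esub> y \<in> V k} = V k" using H.W_carrier by auto
    then show ?thesis using H.openin_coset[OF H.one_closed, of k] by simp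
  qed
  have open_W: "openin (gtop G) (W k)" for k
  proof -
    have "{y \<in> carrier G. inv\<^bsub>G\<^esub> \<one>\<^bsub>G\<^esub> \<otimes>\<^bsub>G\<^esub> y \<in> W k} = W k" using G.W_carrier by auto
    then show ?thesis using G.openin_coset[OF G.one_closed, of k] by simp
  qed
  have "openin (gtop G) {x \<in> topspace (gtop G). h x \<in> V 0}"
    using openin_continuous_map_preimage[OF homeomorphic_imp_continuous_map[OF homeo] open_V] .
  moreover have "\<one>\<^bsub>G\<^esub> \<in> {x \<in> topspace (gtop G). h x \<in> V 0}"
    using h1 H.W_one by (simp add: G.topspace_eq)
  ultimately obtain a where "\<forall>y\<in>carrier G. inv\<^bsub>G\<^esub> \<one>\<^bsub>G\<^esub> \<otimes>\<^bsub>G\<^esub> y \<in> W a \<longrightarrow> h y \<in> V 0"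
    unfolding G.openin_filtration by blast
  then have a: "\<And>x. x \<in> W a \<Longrightarrow> h x \<in> V 0" using G.W_carrier by auto
  have "openin (gtop H) (h ` W 0)"
    using homeomorphic_imp_open_map[OF homeo] open_W unfolding open_map_def by blast
  moreover have "\<one>\<^bsub>H\<^esub> \<in> h ` W 0" using h1 G.W_one by (metis imageI)
  ultimately obtain b where "\<forall>y\<in>carrier H. inv\<^bsub>H\<^esub> \<one>\<^bsub>H\<^esub> \<otimes>\<^bsub>H\<^esub> y \<in> V b \<longrightarrow> y \<in> h ` W 0"
    unfolding H.openin_filtration by blast
  then have image: "y \<in> h ` W 0" if "y \<in> V b" for y using that H.W_carrier[OF that] by simp
  have b: "x \<in> W 0" if x: "x \<in> carrier G" "h x \<in> V b" for x
  proof -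
    obtain w where w: "w \<in> W 0" "h x = h w" using image[OF x(2)] by blast
    then have "x = w" using inj x(1) G.W_carrier by (auto simp: inj_on_def)
    then show ?thesis using w by simp
  qed
  \<comment> \<open>A natural number above both \<open>a\<close> and \<open>b\<close>:
    \<open>c\<close> applications of the automorphism move \<open>W 0\<close> into
    \<open>W a\<close>, and \<open>V c\<close> is contained in \<open>V b\<close>.\<close>
  define c where "c = nat (max a b)"
  have ac: "a \<le> int c" and bc: "b \<le> int c" by (auto simp: c_def max_def)
  have "h x \<in> V (- int c)" if x: "x \<in> W 0" for x
  proof -
    have "(gaut G ^^ c) x \<in> W a"
      by (rule G.W_mono_mem[OF G.gaut_funpow_W[OF x, of c]]) (use ac in simp)
    then have "(gaut H ^^ c) (h x) \<in> V (- int c + int c)" using a pow G.W_carrier[OF x] by force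
    then show ?thesis using H.gaut_funpow_W_iff clo G.W_carrier[OF x] by blast
  qed
  moreover have "x \<in> W (int k)" if x: "x \<in> carrier G" "h x \<in> V (int k + int c)" for x k
  proof -
    obtain z where z: "z \<in> carrier G" "x = (gaut G ^^ k) z" using G.gaut_funpow_surj[OF x(1)] by blast
    then have "(gaut H ^^ k) (h z) \<in> V (int c + int k)" using x(2) pow by (simp add: add.commute)
    then have "h z \<in> V (int c)" using H.gaut_funpow_W_iff clo z(1) by blast
    then have "h z \<in> V b" by (rule H.W_mono_mem) (rule bc)
    then have "z \<in> W 0" using b z(1) by blast
    then show ?thesis using G.gaut_funpow_W[of z 0 k] z(2) by simp
  qed
  ultimately show ?thesis by blast
qed

text \<open>The dimension over F_p((t)) of the \<open>p\<close>-torsion of \<open>p^j\<close> times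
  the standard group. Consecutive values differ by one multiplicity, so these ranks determine the
  family.\<close>

definition socle_rank :: "(nat \<times> nat \<Rightarrow> nat) \<Rightarrow> nat \<Rightarrow> nat \<Rightarrow> nat" where
  "socle_rank \<nu> p j = card {i \<in> std_index \<nu>. fst i = p \<and> j < fst (snd i)}"

text \<open>Being killed by \<open>p\<close> removes the components at other primes and forces
  multiples of \<open>p^(n-1)\<close> at \<open>p\<close>; being a \<open>p^j\<close>-th power
  removes those with \<open>n \<le> j\<close>. What survives is one digit below \<open>p\<close> per
  position, and these digits are counted below.\<close>

lemma (in standard_family) torsion_coefficients:
  assumes p: "prime p" and f: "f \<in> carrier S" "f [^]\<^bsub>S\<^esub> p = \<one>\<^bsub>S\<^esub>"
    and u: "f = u [^]\<^bsub>S\<^esub> (p ^ j)" and i: "i \<in> I"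
  shows "if fst i = p \<and> j < fst (snd i)
         then int (p ^ (fst (snd i) - 1)) dvd f i s \<and> f i s div int (p ^ (fst (snd i) - 1)) \<in> {0..<int p}
         else f i s = 0"
proof -
  have range: "0 \<le> f i s" "f i s < int (md i)" using S_range[OF f(1) i] by auto
  have "(int p * f i s) mod int (md i) = 0"
    using pow_S[OF i, of f p s] f(2) i by (simp add: one_S)
  then have dvd: "int (md i) dvd int p * f i s" by (simp add: dvd_eq_mod_eq_0)
  show ?thesis
  proof (cases "fst i = p")
    case False
    have "coprime (int (md i)) (int p)"
      using primes_coprime[of "fst i" p] i p False by (auto simp: std_index_def coprime_power_left_iff)
    then have "int (md i) dvd f i s" using dvd coprime_dvd_mult_right_iff by blast
    then have "f i s = 0" using range zdvd_not_zless[of "f i s"] by force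
    then show ?thesis using False by simp
  next
    case True
    show ?thesis
    proof (cases "j < fst (snd i)")
      case j: False
      have "f i s = (int (p ^ j) * u i s) mod int (md i)" using pow_S[OF i, of u "p ^ j" s] u by simp
      moreover have "md i dvd p ^ j" using True j by (simp add: le_imp_power_dvd)
      then have "int (md i) dvd int (p ^ j) * u i s" using int_dvd_int_iff dvd_mult2 by blast
      ultimately have "f i s = 0" by (simp add: dvd_eq_mod_eq_0)
      then show ?thesis using j by simp
    next
      case j: True
      have md: "int (md i) = int p * int (p ^ (fst (snd i) - 1))"
        using True j by (metis Suc_diff_1 Suc_pred' less_nat_zero_code neq0_conv of_nat_mult power_Suc)
      then have d: "int (p ^ (fst (snd i) - 1)) dvd f i s"
        using dvd prime_gt_0_nat[OF p] by simp
      then obtain t where t: "f i s = int (p ^ (fst (snd i) - 1)) * t" by (elim dvdE)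
      have pos: "int (p ^ (fst (snd i) - 1)) > 0" using prime_gt_0_nat[OF p] by simp
      have "0 \<le> t" using range(1) t pos by (metis zero_le_mult_iff not_less)
      moreover have "int (p ^ (fst (snd i) - 1)) * t < int (p ^ (fst (snd i) - 1)) * int p"
        using range(2) t md by (simp only: mult.commute)
      then have "t < int p" using pos by (metis mult_less_cancel_left_pos)
      moreover have "f i s div int (p ^ (fst (snd i) - 1)) = t"
        using t pos by (metis less_irrefl nonzero_mult_div_cancel_left)
      ultimately show ?thesis using d True j by simp
    qed
  qed
qed

text \<open>There are \<open>p^(r k)\<close> elements of the relevant socle supported in
  \<open>[0, k)\<close>, where \<open>r\<close> is the rank for \<open>\<nu>\<close>. Their images
  are told apart by their digits on the window \<open>[-c, k + c)\<close>, and these admit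
  \<open>p^(r' (k + 2 c))\<close> patterns, with \<open>r'\<close> the rank for
  \<open>\<mu>\<close>. Hence \<open>r k \<le> r' (k + 2 c)\<close> for all
  \<open>k\<close>.\<close>

lemma socle_rank_le:
  assumes \<nu>: "\<nu> \<in> finsupp_families" and \<mu>: "\<mu> \<in> finsupp_families" and p: "prime p"
    and iso: "standard_cgroup \<nu> \<cong>\<^sub>c standard_cgroup \<mu>"
  shows "socle_rank \<nu> p j \<le> socle_rank \<mu> p j"
proof -
  interpret N: standard_family \<nu> using \<nu> by unfold_locales
  interpret M: standard_family \<mu> using \<mu> by unfold_locales
  let ?S = "standard_cgroup \<nu>" and ?T = "standard_cgroup \<mu>"
  let ?b = "\<lambda>i::nat \<times> nat \<times> nat. int (p ^ (fst (snd i) - 1))"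
  obtain h where h: "h \<in> iso ?S ?T" "homeomorphic_map (gtop ?S) (gtop ?T) h"
    "\<And>x. x \<in> carrier ?S \<Longrightarrow> h (gaut ?S x) = gaut ?T (h x)"
    using iso unfolding cgroup_isomorphic_def by blast
  have hom: "h \<in> hom ?S ?T" using h(1) by (simp add: iso_def)
  have clo: "h x \<in> carrier ?T" if "x \<in> carrier ?S" for x using hom that by (auto simp: hom_def)
  interpret hom: group_hom ?S ?T h
    using hom N.S.is_group M.S.is_group by (simp add: group_hom_def group_hom_axioms_def)
  obtain c :: nat where c1: "\<And>x. x \<in> N.U 0 \<Longrightarrow> h x \<in> M.U (- int c)"
    and c2: "\<And>k x. x \<in> carrier ?S \<Longrightarrow> h x \<in> M.U (int k + int c) \<Longrightarrow> x \<in> N.U (int k)"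
    using filtered_iso_bounds[of ?S N.U ?T M.U h, OF N.filtered_S M.filtered_S h] by blast
  let ?J = "{i \<in> std_index \<nu>. fst i = p \<and> j < fst (snd i)}"
  let ?K = "{i \<in> std_index \<mu>. fst i = p \<and> j < fst (snd i)}"
  have fin: "finite ?J" "finite ?K" using N.finite_I M.finite_I by auto
  have ineq: "card ?J * k \<le> card ?K * (k + 2 * c)" for k
  proof -
    let ?A = "?J \<times> {0..<int k} \<rightarrow>\<^sub>E {0..<int p}"
    let ?B = "?K \<times> {- int c..<int k + int c} \<rightarrow>\<^sub>E {0..<int p}"
    \<comment> \<open>A digit array becomes a socle element through the factor
      \<open>p^(n-1)\<close>. Its \<open>p^j\<close>-th root \<open>u a\<close> uses
      \<open>p^(n-1-j)\<close> instead.\<close>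
    define F where "F a = (\<lambda>i\<in>std_index \<nu>. \<lambda>s. if i \<in> ?J \<and> s \<in> {0..<int k} then a (i, s) * ?b i else 0)"
      for a :: "(nat \<times> nat \<times> nat) \<times> int \<Rightarrow> int"
    define u where "u a = (\<lambda>i\<in>std_index \<nu>. \<lambda>s. if i \<in> ?J \<and> s \<in> {0..<int k}
        then a (i, s) * int (p ^ (fst (snd i) - 1 - j)) else 0)"
      for a :: "(nat \<times> nat \<times> nat) \<times> int \<Rightarrow> int"
    have arange: "0 \<le> a (i, s)" "a (i, s) < int p" if "a \<in> ?A" "i \<in> ?J" "s \<in> {0..<int k}" for a i s
      using PiE_mem[OF that(1), of "(i, s)"] that(2,3) by auto
    have md: "int (fst i ^ fst (snd i)) = int p * ?b i" if "i \<in> ?J" for i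
      using that by (metis (mono_tags, lifting) Suc_diff_1 Suc_pred' less_nat_zero_code mem_Collect_eq neq0_conv of_nat_mult power_Suc)
    have bpos: "?b i > 0" for i using prime_gt_0_nat[OF p] by simp
    have F_mem: "F a \<in> carrier ?S" if a: "a \<in> ?A" for a
      unfolding F_def
    proof (rule N.S_memI[of _ 0])
      fix i s assume i: "i \<in> std_index \<nu>"
      have "a (i, s) * ?b i < int p * ?b i" if "i \<in> ?J" "s \<in> {0..<int k}"
        using arange[OF a that] bpos by (intro mult_strict_right_mono)
      then show "0 \<le> (if i \<in> ?J \<and> s \<in> {0..<int k} then a (i, s) * ?b i else 0) \<and>
          (if i \<in> ?J \<and> s \<in> {0..<int k} then a (i, s) * ?b i else 0) < int (fst i ^ fst (snd i))"
        using arange[OF a] bpos md N.md_pos[OF i] by (simp del: of_nat_power)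
    qed simp
    have u_mem: "u a \<in> carrier ?S" if a: "a \<in> ?A" for a
      unfolding u_def
    proof (rule N.S_memI[of _ 0])
      fix i s assume i: "i \<in> std_index \<nu>"
      have "a (i, s) * int (p ^ (fst (snd i) - 1 - j)) < int p * ?b i" if J: "i \<in> ?J" "s \<in> {0..<int k}"
      proof -
        have "int (p ^ (fst (snd i) - 1 - j)) \<le> ?b i"
          using prime_gt_0_nat[OF p] by (simp add: power_increasing)
        then have "a (i, s) * int (p ^ (fst (snd i) - 1 - j)) \<le> a (i, s) * ?b i"
          using arange[OF a J] by (intro mult_left_mono)
        also have "\<dots> < int p * ?b i" using arange[OF a J] bpos by (intro mult_strict_right_mono)
        finally show ?thesis .
      qed
      then show "0 \<le> (if i \<in> ?J \<and> s \<in> {0..<int k} then a (i, s) * int (p ^ (fst (snd i) - 1 - j)) else 0) \<and>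
          (if i \<in> ?J \<and> s \<in> {0..<int k} then a (i, s) * int (p ^ (fst (snd i) - 1 - j)) else 0)
            < int (fst i ^ fst (snd i))"
        using arange[OF a] md N.md_pos[OF i] by (simp del: of_nat_power)
    qed simp
    have F_tors: "F a [^]\<^bsub>?S\<^esub> p = \<one>\<^bsub>?S\<^esub>" if a: "a \<in> ?A" for a
    proof (rule N.S_ext)
      fix i s assume i: "i \<in> std_index \<nu>"
      have "int (fst i ^ fst (snd i)) dvd int p * F a i s"
      proof (cases "i \<in> ?J \<and> s \<in> {0..<int k}")
        case True
        then have "F a i s = a (i, s) * ?b i" using i by (simp add: F_def)
        then have "int p * F a i s = (int p * ?b i) * a (i, s)" by (simp only: mult_ac)
        also have "int p * ?b i = int (fst i ^ fst (snd i))" using md[of i] True by simp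
        finally show ?thesis by (metis dvd_triv_left)
      qed (use i in \<open>auto simp: F_def\<close>)
      then show "(F a [^]\<^bsub>?S\<^esub> p) i s = \<one>\<^bsub>?S\<^esub> i s"
        unfolding N.pow_S[OF i] using i by (simp add: N.one_S)
    qed (use F_mem[OF a] in auto)
    have F_div: "F a = u a [^]\<^bsub>?S\<^esub> (p ^ j)" if a: "a \<in> ?A" for a
    proof (rule N.S_ext)
      fix i s assume i: "i \<in> std_index \<nu>"
      have "int (p ^ j) * int (p ^ (fst (snd i) - 1 - j)) = ?b i" if "i \<in> ?J"
        using that by (simp add: power_add[symmetric])
      then have "int (p ^ j) * u a i s = F a i s"
        using i by (simp add: F_def u_def mult.left_commute del: of_nat_power)
      then show "F a i s = (u a [^]\<^bsub>?S\<^esub> (p ^ j)) i s"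
        unfolding N.pow_S[OF i] using N.S_range[OF F_mem[OF a] i, of s] by simp
    qed (use F_mem[OF a] u_mem[OF a] in auto)
    define \<Phi> where "\<Phi> a = (\<lambda>(i, s)\<in>?K \<times> {- int c..<int k + int c}. h (F a) i s div ?b i)"
      for a :: "(nat \<times> nat \<times> nat) \<times> int \<Rightarrow> int"
    have coeffs: "if fst i = p \<and> j < fst (snd i)
         then ?b i dvd h (F a) i s \<and> h (F a) i s div ?b i \<in> {0..<int p} else h (F a) i s = 0"
      if a: "a \<in> ?A" and i: "i \<in> std_index \<mu>" for a i s
    proof (rule M.torsion_coefficients[OF p clo[OF F_mem[OF a]] _ _ i])
      show "h (F a) [^]\<^bsub>?T\<^esub> p = \<one>\<^bsub>?T\<^esub>"
        using hom.hom_nat_pow[OF F_mem[OF a], of p] F_tors[OF a] by simp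
      show "h (F a) = h (u a) [^]\<^bsub>?T\<^esub> (p ^ j)"
        using hom.hom_nat_pow[OF u_mem[OF a], of "p ^ j"] F_div[OF a] by simp
    qed
    have "card ?A \<le> card ?B"
    proof (rule card_inj_on_le[of \<Phi>])
      show "\<Phi> ` ?A \<subseteq> ?B"
      proof (rule image_subsetI)
        fix a assume a: "a \<in> ?A"
        show "\<Phi> a \<in> ?B"
          unfolding \<Phi>_def restrict_PiE
        proof (rule Pi_I)
          fix z assume z: "z \<in> ?K \<times> {- int c..<int k + int c}"
          then show "(case z of (i, s) \<Rightarrow> h (F a) i s div ?b i) \<in> {0..<int p}"
            using coeffs[OF a, of "fst z" "snd z"] by (auto simp: case_prod_beta)
        qed
      qed
      show "finite ?B" using fin by (intro finite_PiE) auto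
      show "inj_on \<Phi> ?A"
      proof (rule inj_onI)
        fix a a' assume a: "a \<in> ?A" and a': "a' \<in> ?A" and eq: "\<Phi> a = \<Phi> a'"
        have low: "h (F x) i s = 0" if x: "x \<in> ?A" and "i \<in> std_index \<mu>" "s < - int c" for x i s
        proof -
          have "F x \<in> N.U 0" using F_mem[OF x] by (auto simp: N.U_def F_def)
          then show ?thesis using c1[of "F x"] that by (simp add: M.U_def)
        qed
        \<comment> \<open>Below \<open>-c\<close> both images vanish, in the window they agree by
          \<open>eq\<close>, and all other components are zero. So the quotient of the images lies
          in \<open>U (k + c)\<close>, which pulls back to \<open>U k\<close> and covers the support
          of the arrays.\<close>
        have "h (F a') i s = h (F a) i s" if i: "i \<in> std_index \<mu>" and s: "s < int k + int c" for i s
        proof (cases "i \<in> ?K \<and> - int c \<le> s")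
          case True
          then have "h (F a) i s div ?b i = h (F a') i s div ?b i"
            using fun_cong[OF eq, of "(i, s)"] s by (simp add: \<Phi>_def)
          moreover have "?b i dvd h (F a) i s" "?b i dvd h (F a') i s"
            using coeffs[OF a i, of s] coeffs[OF a' i, of s] True by auto
          ultimately show ?thesis by (metis dvd_div_mult_self)
        next
          case False
          then show ?thesis
            using coeffs[OF a i, of s] coeffs[OF a' i, of s] low[OF a i] low[OF a' i] i by (cases "s < - int c") auto
        qed
        then have "inv\<^bsub>?T\<^esub> (h (F a)) \<otimes>\<^bsub>?T\<^esub> h (F a') \<in> M.U (int k + int c)"
          using M.quot_mem_U_iff[OF clo[OF F_mem[OF a]] clo[OF F_mem[OF a']]] by blast
        then have "h (inv\<^bsub>?S\<^esub> (F a) \<otimes>\<^bsub>?S\<^esub> F a') \<in> M.U (int k + int c)"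
          using hom_quot[OF N.S.is_group M.S.is_group hom F_mem[OF a] F_mem[OF a']] by simp
        then have "inv\<^bsub>?S\<^esub> (F a) \<otimes>\<^bsub>?S\<^esub> F a' \<in> N.U (int k)"
          using c2 F_mem[OF a] F_mem[OF a'] by simp
        then have agree: "F a' i s = F a i s" if "i \<in> std_index \<nu>" "s < int k" for i s
          using N.quot_mem_U_iff[OF F_mem[OF a] F_mem[OF a']] that by blast
        show "a = a'"
        proof (rule PiE_ext[OF a a'])
          fix z assume z: "z \<in> ?J \<times> {0..<int k}"
          obtain i s where z_eq: "z = (i, s)" "i \<in> ?J" "s \<in> {0..<int k}" using z by (cases z) auto
          have "a' (i, s) * ?b i = a (i, s) * ?b i"
            using agree[of i s] z_eq by (simp add: F_def)
          then show "a z = a' z" using z_eq(1) prime_gt_0_nat[OF p] by auto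
        qed
      qed
    qed
    moreover have "card ?A = p ^ (card ?J * k)"
      using fin by (simp add: card_PiE card_cartesian_product)
    moreover have "card ?B = p ^ (card ?K * (k + 2 * c))"
    proof -
      have "nat (int k + int c - (- int c)) = k + 2 * c" by simp
      then show ?thesis using fin by (simp add: card_PiE card_cartesian_product)
    qed
    ultimately have "p ^ (card ?J * k) \<le> p ^ (card ?K * (k + 2 * c))" by simp
    then show ?thesis using prime_gt_1_nat[OF p] power_increasing_iff by blast
  qed
  show ?thesis
  proof (rule ccontr)
    assume "\<not> ?thesis"
    then have lt: "card ?K + 1 \<le> card ?J" by (simp add: socle_rank_def)
    \<comment> \<open>If the rank were larger by at least 1, the left side would gain at least
      \<open>k\<close>, while the right side gains only the fixed amount
      \<open>card ?K * (2 * c)\<close>.\<close>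
    define k where "k = card ?K * (2 * c) + 1"
    have "(card ?K + 1) * k \<le> card ?J * k" using lt by (rule mult_le_mono1)
    also have "\<dots> \<le> card ?K * (k + 2 * c)" by (rule ineq)
    finally have "k \<le> card ?K * (2 * c)" by (simp add: algebra_simps)
    then show False by (simp add: k_def)
  qed
qed

lemma socle_rank_diff:
  assumes "\<nu> \<in> finsupp_families" "prime p" "n \<ge> 1"
  shows "socle_rank \<nu> p (n - 1) = \<nu> (p, n) + socle_rank \<nu> p n"
proof -
  let ?A = "(\<lambda>k. (p, n, k)) ` {..<\<nu> (p, n)}"
  let ?B = "{i \<in> std_index \<nu>. fst i = p \<and> n < fst (snd i)}"
  have "{i \<in> std_index \<nu>. fst i = p \<and> n - 1 < fst (snd i)} = ?A \<union> ?B"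
  proof -
    have lt: "n - 1 < m \<longleftrightarrow> m = n \<or> n < m" for m using assms(3) by auto
    show ?thesis unfolding lt using assms(2,3) by (auto simp: std_index_def)
  qed
  moreover have "card (?A \<union> ?B) = card ?A + card ?B"
    using finite_std_index[OF assms(1)] by (intro card_Un_disjoint) auto
  moreover have "card ?A = \<nu> (p, n)" by (simp add: card_image inj_on_def)
  ultimately show ?thesis by (simp add: socle_rank_def)
qed

theorem standard_isomorphic_unique:
  assumes \<nu>: "\<nu> \<in> finsupp_families" and \<mu>: "\<mu> \<in> finsupp_families"
    and iso: "standard_cgroup \<nu> \<cong>\<^sub>c standard_cgroup \<mu>"
  shows "\<nu> = \<mu>"
proof
  fix z :: "nat \<times> nat"
  obtain p n where z: "z = (p, n)" by (cases z)
  show "\<nu> z = \<mu> z"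
  proof (cases "prime p \<and> n \<ge> 1")
    case True
    have "lc_contraction_group (standard_cgroup \<kappa>)" if "\<kappa> \<in> finsupp_families" for \<kappa>
      using standard_family.standard_lc_abelian_torsion[of \<kappa>] that
      by (simp add: standard_family_def lc_abelian_torsion_contraction_group_def)
    then have "standard_cgroup \<mu> \<cong>\<^sub>c standard_cgroup \<nu>"
      using cgroup_isomorphic_sym \<nu> \<mu> iso by blast
    then have "socle_rank \<nu> p j = socle_rank \<mu> p j" for j
      using socle_rank_le[OF \<nu> \<mu> _ iso, of p j] socle_rank_le[OF \<mu> \<nu>, of p j] True by simp
    then show ?thesis
      using socle_rank_diff[OF \<nu>, of p n] socle_rank_diff[OF \<mu>, of p n] True z by simp
  next
    case False
    then have "\<nu> z = 0" "\<mu> z = 0" using \<nu> \<mu> z by (auto simp: finsupp_families_def)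
    then show ?thesis by simp
  qed
qed

text \<open>A family is recovered from its graph over the support, which is a finite subset of a
  countable type.\<close>

lemma countable_finsupp_families: "countable finsupp_families"
proof -
  let ?g = "\<lambda>\<nu>::nat \<times> nat \<Rightarrow> nat. (\<lambda>i. (i, \<nu> i)) ` {i. \<nu> i \<noteq> 0}"
  have inj: "inj ?g"
  proof (rule injI, rule ext)
    fix \<nu> \<mu> :: "nat \<times> nat \<Rightarrow> nat" and i assume eq: "?g \<nu> = ?g \<mu>"
    have mem: "(i, n) \<in> ?g \<nu>' \<longleftrightarrow> n \<noteq> 0 \<and> \<nu>' i = n" for n \<nu>' by auto
    have "n \<noteq> 0 \<and> \<nu> i = n \<longleftrightarrow> n \<noteq> 0 \<and> \<mu> i = n" for n
      using mem[of n \<nu>] mem[of n \<mu>] unfolding eq by simp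
    then show "\<nu> i = \<mu> i" by metis
  qed
  have "countable (?g ` finsupp_families)"
  proof (rule countable_subset)
    show "?g ` finsupp_families \<subseteq> {X. finite X}" by (auto simp: finsupp_families_def)
    show "countable {X :: ((nat \<times> nat) \<times> nat) set. finite X}"
      by (rule countable_Collect_finite)
  qed
  then show ?thesis
    by (rule countable_image_inj_on) (rule inj_on_subset[OF inj subset_UNIV])
qed

section \<open>Assembling the classification\<close>

theorem classification_exists:
  assumes G: "lc_abelian_torsion_contraction_group G"
  shows "\<exists>\<nu>\<in>finsupp_families. G \<cong>\<^sub>c standard_cgroup \<nu>"
proof -
  interpret comm_group G using G by (simp add: lc_abelian_torsion_contraction_group_def)
  interpret L: lc_torsion_cgroup G
    using G by unfold_locales (auto simp: lc_abelian_torsion_contraction_group_def)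
  obtain W where "compact_filtered_cgroup G W" using L.compact_filtration by blast
  then obtain \<nu> y where \<nu>: "\<nu> \<in> finsupp_families" "adapted_cgroup G W (std_index \<nu>) y"
    using compact_filtered_cgroup.adapted_generators by blast
  have "standard_cgroup \<nu> \<cong>\<^sub>c G"
    using adapted_cgroup.standard_isomorphic[OF \<nu>(2,1) refl] .
  moreover have "lc_contraction_group (standard_cgroup \<nu>)"
    using standard_family.standard_lc_abelian_torsion[of \<nu>] \<nu>(1)
    by (simp add: standard_family_def lc_abelian_torsion_contraction_group_def)
  ultimately have "G \<cong>\<^sub>c standard_cgroup \<nu>"
    using cgroup_isomorphic_sym L.lc by blast
  then show ?thesis using \<nu>(1) by blast
qed

text \<open>Isomorphism classes can be collected only within one carrier type, so countability is
  stated in two ways: for the classes on a fixed type \<open>'a\<close>, and by a countable set of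
  representatives on the type of the standard groups. The witness for the latter is the same for
  every \<open>'a\<close>.\<close>

theorem corollary5p6:
  shows "(\<forall>\<nu> \<in> finsupp_families. lc_abelian_torsion_contraction_group (standard_cgroup \<nu>))
    \<and> (\<forall>G :: 'a cgroup. lc_abelian_torsion_contraction_group G \<longrightarrow>
          (\<exists>!\<nu>. \<nu> \<in> finsupp_families \<and> G \<cong>\<^sub>c standard_cgroup \<nu>))
    \<and> countable ({G :: 'a cgroup. lc_abelian_torsion_contraction_group G} //
          {(G, H). lc_abelian_torsion_contraction_group G \<and>
                   lc_abelian_torsion_contraction_group H \<and> G \<cong>\<^sub>c H})
    \<and> (\<exists>C :: (nat \<times> nat \<times> nat \<Rightarrow> int \<Rightarrow> int) cgroup set. countable C
          \<and> (\<forall>H \<in> C. lc_abelian_torsion_contraction_group H)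
          \<and> (\<forall>G :: 'a cgroup. lc_abelian_torsion_contraction_group G \<longrightarrow> (\<exists>H \<in> C. G \<cong>\<^sub>c H)))"
proof (intro conjI)
  let ?P = "\<lambda>G :: 'a cgroup. lc_abelian_torsion_contraction_group G"
  have std: "lc_abelian_torsion_contraction_group (standard_cgroup \<nu>)" if "\<nu> \<in> finsupp_families" for \<nu>
    using standard_family.standard_lc_abelian_torsion[of \<nu>] that by (simp add: standard_family_def)
  then show "\<forall>\<nu> \<in> finsupp_families. lc_abelian_torsion_contraction_group (standard_cgroup \<nu>)" by blast
  have lc: "lc_contraction_group G" if "?P G" for G
    using that by (simp add: lc_abelian_torsion_contraction_group_def)
  have lc_std: "lc_contraction_group (standard_cgroup \<nu>)" if "\<nu> \<in> finsupp_families" for \<nu>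
    using std[OF that] by (simp add: lc_abelian_torsion_contraction_group_def)
  show "\<forall>G. ?P G \<longrightarrow> (\<exists>!\<nu>. \<nu> \<in> finsupp_families \<and> G \<cong>\<^sub>c standard_cgroup \<nu>)"
  proof (intro allI impI)
    fix G :: "'a cgroup" assume G: "?P G"
    obtain \<nu> where \<nu>: "\<nu> \<in> finsupp_families" "G \<cong>\<^sub>c standard_cgroup \<nu>"
      using classification_exists[OF G] by blast
    show "\<exists>!\<nu>. \<nu> \<in> finsupp_families \<and> G \<cong>\<^sub>c standard_cgroup \<nu>"
    proof (rule ex1I[of _ \<nu>])
      fix \<mu> assume \<mu>: "\<mu> \<in> finsupp_families \<and> G \<cong>\<^sub>c standard_cgroup \<mu>"
      then have "standard_cgroup \<mu> \<cong>\<^sub>c G" using cgroup_isomorphic_sym[OF lc[OF G] lc_std] by blast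
      then have "standard_cgroup \<mu> \<cong>\<^sub>c standard_cgroup \<nu>" using cgroup_isomorphic_trans \<nu>(2) by blast
      then show "\<mu> = \<nu>" using standard_isomorphic_unique \<mu> \<nu>(1) by blast
    qed (use \<nu> in blast)
  qed
  let ?R = "{(G, H). ?P G \<and> ?P H \<and> G \<cong>\<^sub>c H}"
  let ?F = "\<lambda>\<nu>. {H. ?P H \<and> H \<cong>\<^sub>c standard_cgroup \<nu>}"
  \<comment> \<open>The class of \<open>G\<close> consists of the groups with the same standard
    model as \<open>G\<close>, so it is the value of \<open>?F\<close> at the family of
    \<open>G\<close>.\<close>
  have "{G. ?P G} // ?R \<subseteq> ?F ` finsupp_families"
  proof
    fix X assume "X \<in> {G. ?P G} // ?R"
    then obtain G where G: "?P G" "X = ?R `` {G}" by (auto elim: quotientE)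
    obtain \<nu> where \<nu>: "\<nu> \<in> finsupp_families" "G \<cong>\<^sub>c standard_cgroup \<nu>"
      using classification_exists[OF G(1)] by blast
    have "G \<cong>\<^sub>c H \<longleftrightarrow> H \<cong>\<^sub>c standard_cgroup \<nu>" if H: "?P H" for H
    proof
      assume "G \<cong>\<^sub>c H"
      then show "H \<cong>\<^sub>c standard_cgroup \<nu>"
        using cgroup_isomorphic_sym[OF lc[OF G(1)] lc[OF H]] cgroup_isomorphic_trans \<nu>(2) by blast
    next
      assume "H \<cong>\<^sub>c standard_cgroup \<nu>"
      then show "G \<cong>\<^sub>c H"
        using cgroup_isomorphic_sym[OF lc[OF H] lc_std[OF \<nu>(1)]] cgroup_isomorphic_trans \<nu>(2) by blast
    qed
    then have "X = ?F \<nu>" using G by auto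
    then show "X \<in> ?F ` finsupp_families" using \<nu>(1) by blast
  qed
  then show "countable ({G. ?P G} // ?R)"
    by (rule countable_subset) (rule countable_image[OF countable_finsupp_families])
  show "\<exists>C :: (nat \<times> nat \<times> nat \<Rightarrow> int \<Rightarrow> int) cgroup set. countable C
          \<and> (\<forall>H \<in> C. lc_abelian_torsion_contraction_group H)
          \<and> (\<forall>G :: 'a cgroup. lc_abelian_torsion_contraction_group G \<longrightarrow> (\<exists>H \<in> C. G \<cong>\<^sub>c H))"
    using countable_finsupp_families std classification_exists
    by (intro exI[of _ "standard_cgroup ` finsupp_families"]) auto
qed

end
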